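(* Let $\alpha\le\gamma$ be clans in $\mathtt{Clans}_{p,q}$ and $\beta\le\theta$ be clans in $\mathtt{Clans}_{r,s}$. If $[\beta,\theta]$ interval pattern contains $[\alpha,\gamma]$, then the Mars-Springer varieties are isomorphic: $$\mathcal{N}_{\theta,\beta}\cong\mathcal{N}_{\gamma,\alpha}.$$
   Context: All varieties are over $\mathbb{C}$. **Clans.** Let $n=p+q$. A $(p,q)$-clan is a partial matching of the vertices $\{1,\dots,n\}$ in which each unmatched vertex is assigned a sign $+$ or $-$, such that the number of $+$'s minus the number of $-$'s is $p-q$. It is written as a string $\gamma=\gamma_1\dots\gamma_n$ with entries in $\mathbb{N}\cup\{+,-\}$, a pair of equal numbers indicating a matching; strings differing by a permutation of the natural numbers represent the same clan. A matched pair $i<j$ is called a matching $(i<j)$, with left end $i$ and right end $j$. $\mathtt{Clans}_{p,q}$ is the set of $(p,q)$-clans. The length is $$\ell(\gamma)=\sum_{(i<j)\text{ matching of }\gamma}\bigl(j-i-\#\{\text{matchings }(s<t)\text{ of }\gamma: s<i<t<j\}\bigr).$$ **The permutation $w_\alpha\in S_n$.** The values $1,\dots,p$ are assigned from left to right to the positions of the $+$'s and left ends of matchings of $\alpha$; the values $p+1,\dots,n$ are assigned while reading $\alpha$ from left to right: upon meeting a $-$, assign the smallest unused value of $\{p+1,\dots,n\}$ to its position, and upon meeting a left end of a matching, immediately assign the smallest unused value of $\{p+1,\dots,n\}$ to the corresponding right end. **The affine space $S_\alpha$.** The generic matrix $M_\alpha(\mathbf{z})$ ($n\times n$) has fixed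 entries: (O.1) if $\alpha_i=\pm$, row $i$ has a $1$ in position $w_\alpha(i)$; (O.2) if $(i<j)$ is a matching, row $i$ has $1$'s in positions $w_\alpha(i)$ and $w_\alpha(j)$; (O.3) if $(j<i)$ is a matching, row $i$ has $-1$ in position $w_\alpha(j)$ and $1$ in position $w_\alpha(i)$. A pivot is the northmost of these $1$'s in each column. In the first $p$ columns, set to $0$ all (other) entries: (Z.1) in the same row as a pivot; (Z.2) above a pivot in its column; (Z.3) between the pivot $1$ and the corresponding $-1$ of a column; (Z.4) right of a $-1$. In the last $q$ columns, set to $0$ all (other) entries: (Z.5) in the same row as a pivot; (Z.6) above a pivot in its column; (Z.7) between the pivot $1$ and the second $1$ below it in its column; (Z.8) right of a $1$ which is the second $1$ in its column. The remaining entries $z_{ij}$ are independent variables except: (Z.9) for each pair of matchings $(i<k)$, $(j<\ell)$ with $i<j<k<\ell$, the entry at $(\ell,w_\alpha(k))$ is $-z_{\ell,w_\alpha(i)}$, where $z_{\ell,w_\alpha(i)}$ is the entry at $(\ell,w_\alpha(i))$. $S_\alpha$ is the affine space of all matrices obtained by specializing the variables of $M_\alpha(\mathbf{z})$ to complex numbers; all these matrices are invertible. **Orbits and Bruhat order.** $G=GL_n(\mathbb{C})$, $K=GL_p\times GL_q$ is the block diagonal subgroup, $B$ is the upper triangular Borel subgroup. Let $x_\alpha\in S_\alpha$ be the matrix with all $\mathbf{z}$-variables set to $0$. The $K$-orbit on $G/B$ corresponding to $\alpha$ is $\mathcal{O}_\alpha=Kx_\alpha^{-1}B/B$, with closure $Y_\alpha$.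 Bruhat order on $\mathtt{Clans}_{p,q}$: $\alpha\le\gamma$ iff $Y_\alpha\subseteq Y_\gamma$. **Mars-Springer variety.** For $\gamma\in\mathtt{Clans}_{p,q}$: $\gamma(i;+)$ (resp. $\gamma(i;-)$) is the number of matchings (both ends) and $+$ signs (resp. $-$ signs) among the first $i$ positions of $\gamma$; $\gamma(i;j)$, for $1\le i<j\le n$, is the number of matchings whose left end is weakly left of $i$ and whose right end is strictly right of $j$. For an invertible $n\times n$ matrix $M$ and $i<j$, $M^{[i;j]}$ is the $n\times(i+j)$ matrix whose first $i$ columns are the first $i$ columns of $M^{-1}$ with all entries in the last $q$ rows replaced by zero, and whose last $j$ columns are the first $j$ columns of $M^{-1}$. $\mathcal{N}_{\gamma,\alpha}$ is the reduced subscheme of $S_\alpha$ whose points are the matrices $M$ such that: (R.1) the southwest $(n-i)\times p$ submatrix of $M$ has rank at most $p-\gamma(i;+)$ for $i=1,\dots,n$; (R.2) the southeast $(n-i)\times q$ submatrix of $M$ has rank at most $q-\gamma(i;-)$ for $i=1,\dots,n$; (R.3) $M^{[i;j]}$ has rank at most $j+\gamma(i;j)$ for all $1\le i<j\le n$. ($\mathcal{N}_{\theta,\beta}$ is defined in the same way, with $r,s$ in place of $p,q$.) **Interval pattern containment.** Indices $i_1<\dots<i_{p+q}$ witness that $\theta\in\mathtt{Clans}_{r,s}$ contains $\gamma\in\mathtt{Clans}_{p,q}$ if (1) $\gamma_j=\pm$ implies $\theta_{i_j}=\gamma_j$, and (2) $\gamma_k=\gamma_\ell$ implies $\theta_{i_k}=\theta_{i_\ell}$.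 $[\beta,\theta]$ interval pattern contains $[\alpha,\gamma]$ if (a) there are indices $i_1<\dots<i_{p+q}$ which commonly witness the containment of $\gamma$ in $\theta$ and of $\alpha$ in $\beta$; (b) $\theta$ and $\beta$ agree outside these indices; (c) $\ell(\theta)-\ell(\beta)=\ell(\gamma)-\ell(\alpha)$. *)

theory Defs
  imports
    "HOL-Analysis.Abstract_Topology"
    "Jordan_Normal_Form.Gauss_Jordan_Elimination"
    "Jordan_Normal_Form.DL_Rank"
begin

section \<open>Clans\<close>

text \<open>
  Vertices are numbered from 1. A clan is stored as a signed partial matching rather than as a
  string up to renaming of its numbers, so that equality of clans is equality of records. A pair
  \<open>(i, j)\<close> in \<open>matchings\<close> always has \<open>i < j\<close>.
\<close>

record clan =
  matchings :: "(nat \<times> nat) set"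
  plus_signs :: "nat set"
  minus_signs :: "nat set"

definition left_ends :: "clan \<Rightarrow> nat set" where
  "left_ends \<gamma> = fst ` matchings \<gamma>"

definition right_ends :: "clan \<Rightarrow> nat set" where
  "right_ends \<gamma> = snd ` matchings \<gamma>"

definition Clans :: "nat \<Rightarrow> nat \<Rightarrow> clan set" where
  "Clans p q = {\<gamma>.
     (\<forall>(i, j) \<in> matchings \<gamma>. 1 \<le> i \<and> i < j \<and> j \<le> p + q) \<and>
     (\<forall>(i, j) \<in> matchings \<gamma>. \<forall>(k, l) \<in> matchings \<gamma>. (i, j) \<noteq> (k, l) \<longrightarrow> {i, j} \<inter> {k, l} = {}) \<and>
     plus_signs \<gamma> \<union> minus_signs \<gamma> = {1..p + q} - (left_ends \<gamma> \<union> right_ends \<gamma>) \<and>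
     plus_signs \<gamma> \<inter> minus_signs \<gamma> = {} \<and>
     int (card (plus_signs \<gamma>)) - int (card (minus_signs \<gamma>)) = int p - int q}"

definition clan_length :: "clan \<Rightarrow> int" where
  "clan_length \<gamma> = (\<Sum>(i, j) \<in> matchings \<gamma>.
     int j - int i - int (card {(s, t) \<in> matchings \<gamma>. s < i \<and> i < t \<and> t < j}))"


section \<open>The permutation attached to a clan\<close>

text \<open>
  The \<open>m\<close>-th plus sign or left end receives the value \<open>m\<close>. The \<open>m\<close>-th minus sign or left end
  consumes the value \<open>p + m\<close>, which goes to the position of the minus sign, respectively to the
  right end matched with that left end.
\<close>

definition left_end_of :: "clan \<Rightarrow> nat \<Rightarrow> nat" where
  "left_end_of \<alpha> j = (THE i. (i, j) \<in> matchings \<alpha>)"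

definition clan_perm :: "nat \<Rightarrow> clan \<Rightarrow> nat \<Rightarrow> nat" where
  "clan_perm p \<alpha> i =
     (if i \<in> plus_signs \<alpha> \<union> left_ends \<alpha> then card {k \<in> plus_signs \<alpha> \<union> left_ends \<alpha>. k \<le> i}
      else if i \<in> minus_signs \<alpha> then p + card {k \<in> minus_signs \<alpha> \<union> left_ends \<alpha>. k \<le> i}
      else p + card {k \<in> minus_signs \<alpha> \<union> left_ends \<alpha>. k \<le> left_end_of \<alpha> i})"


section \<open>The generic matrix and the slice\<close>

text \<open>
  In this section rows and columns are numbered from 1; the shift to the 0-based library matrices
  takes place in \<open>generic_matrix\<close>.
\<close>

definition fixed_one :: "nat \<Rightarrow> clan \<Rightarrow> nat \<Rightarrow> nat \<Rightarrow> bool" where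
  "fixed_one p \<alpha> r c \<longleftrightarrow>
     (r \<in> plus_signs \<alpha> \<union> minus_signs \<alpha> \<and> c = clan_perm p \<alpha> r) \<or>
     (\<exists>j. (r, j) \<in> matchings \<alpha> \<and> (c = clan_perm p \<alpha> r \<or> c = clan_perm p \<alpha> j)) \<or>
     (\<exists>j. (j, r) \<in> matchings \<alpha> \<and> c = clan_perm p \<alpha> r)"

definition fixed_minus_one :: "nat \<Rightarrow> clan \<Rightarrow> nat \<Rightarrow> nat \<Rightarrow> bool" where
  "fixed_minus_one p \<alpha> r c \<longleftrightarrow> (\<exists>j. (j, r) \<in> matchings \<alpha> \<and> c = clan_perm p \<alpha> j)"

definition pivot :: "nat \<Rightarrow> clan \<Rightarrow> nat \<Rightarrow> nat \<Rightarrow> bool" where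
  "pivot p \<alpha> r c \<longleftrightarrow> fixed_one p \<alpha> r c \<and> \<not> (\<exists>r' < r. fixed_one p \<alpha> r' c)"

definition second_one :: "nat \<Rightarrow> clan \<Rightarrow> nat \<Rightarrow> nat \<Rightarrow> bool" where
  "second_one p \<alpha> r c \<longleftrightarrow> fixed_one p \<alpha> r c \<and> (\<exists>r' < r. fixed_one p \<alpha> r' c)"

text \<open>
  The zero rules act separately on the block of the first \<open>p\<close> columns and on the block of the
  remaining columns: a pivot (or the \<open>-1\<close>, or the second \<open>1\<close>) in one block does not force zeros
  in its row within the other block.
\<close>

definition forced_zero :: "nat \<Rightarrow> clan \<Rightarrow> nat \<Rightarrow> nat \<Rightarrow> bool" where
  "forced_zero p \<alpha> r c \<longleftrightarrow>
     (if c \<le> p then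
        (\<exists>c' \<le> p. pivot p \<alpha> r c') \<or>
        (\<exists>r' > r. pivot p \<alpha> r' c) \<or>
        (\<exists>r1 r2. pivot p \<alpha> r1 c \<and> fixed_minus_one p \<alpha> r2 c \<and> r1 < r \<and> r < r2) \<or>
        (\<exists>c' < c. fixed_minus_one p \<alpha> r c')
      else
        (\<exists>c' > p. pivot p \<alpha> r c') \<or>
        (\<exists>r' > r. pivot p \<alpha> r' c) \<or>
        (\<exists>r1 r2. pivot p \<alpha> r1 c \<and> second_one p \<alpha> r2 c \<and> r1 < r \<and> r < r2) \<or>
        (\<exists>c' > p. c' < c \<and> second_one p \<alpha> r c'))"

text \<open>
  The pairs of matchings \<open>(i < k)\<close>, \<open>(j < l)\<close> with \<open>i < j < k < l\<close> that tie the entry in row \<open>l\<close>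
  and column \<open>c = w(k)\<close> to the variable in row \<open>l\<close> and column \<open>w(i)\<close>.
\<close>

definition tied :: "nat \<Rightarrow> clan \<Rightarrow> nat \<Rightarrow> nat \<Rightarrow> nat \<Rightarrow> bool" where
  "tied p \<alpha> l c i \<longleftrightarrow> (\<exists>j k. (i, k) \<in> matchings \<alpha> \<and> (j, l) \<in> matchings \<alpha> \<and>
     i < j \<and> j < k \<and> k < l \<and> c = clan_perm p \<alpha> k)"

definition generic_entry ::
    "nat \<Rightarrow> clan \<Rightarrow> (nat \<Rightarrow> nat \<Rightarrow> complex) \<Rightarrow> nat \<Rightarrow> nat \<Rightarrow> complex" where
  "generic_entry p \<alpha> z r c =
     (if fixed_one p \<alpha> r c then 1
      else if fixed_minus_one p \<alpha> r c then - 1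
      else if forced_zero p \<alpha> r c then 0
      else if \<exists>i. tied p \<alpha> r c i then - z r (clan_perm p \<alpha> (THE i. tied p \<alpha> r c i))
      else z r c)"

definition generic_matrix ::
    "nat \<Rightarrow> nat \<Rightarrow> clan \<Rightarrow> (nat \<Rightarrow> nat \<Rightarrow> complex) \<Rightarrow> complex mat" where
  "generic_matrix p q \<alpha> z = mat (p + q) (p + q) (\<lambda>(r, c). generic_entry p \<alpha> z (r + 1) (c + 1))"

definition slice :: "nat \<Rightarrow> nat \<Rightarrow> clan \<Rightarrow> complex mat set" where
  "slice p q \<alpha> = range (generic_matrix p q \<alpha>)"

definition base_point :: "nat \<Rightarrow> nat \<Rightarrow> clan \<Rightarrow> complex mat" where
  "base_point p q \<alpha> = generic_matrix p q \<alpha> (\<lambda>_ _. 0)"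


section \<open>Polynomial functions and the Zariski topology\<close>

inductive_set polynomial_funs :: "nat \<Rightarrow> (complex mat \<Rightarrow> complex) set" for n :: nat where
  const: "(\<lambda>A. c) \<in> polynomial_funs n"
| entry: "i < n \<Longrightarrow> j < n \<Longrightarrow> (\<lambda>A. A $$ (i, j)) \<in> polynomial_funs n"
| add: "f \<in> polynomial_funs n \<Longrightarrow> g \<in> polynomial_funs n \<Longrightarrow> (\<lambda>A. f A + g A) \<in> polynomial_funs n"
| mult: "f \<in> polynomial_funs n \<Longrightarrow> g \<in> polynomial_funs n \<Longrightarrow> (\<lambda>A. f A * g A) \<in> polynomial_funs n"

definition GL :: "nat \<Rightarrow> complex mat set" where
  "GL n = {A \<in> carrier_mat n n. invertible_mat A}"

text \<open>
  The regular functions on \<open>GL n\<close> are the polynomial functions divided by powers of the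
  determinant, so polynomial functions already cut out all closed sets.
\<close>

definition zariski_open :: "nat \<Rightarrow> complex mat set \<Rightarrow> bool" where
  "zariski_open n U \<longleftrightarrow> (\<exists>F \<subseteq> polynomial_funs n. U = GL n - {g \<in> GL n. \<forall>f \<in> F. f g = 0})"

definition zariski_GL :: "nat \<Rightarrow> complex mat topology" where
  "zariski_GL n = topology (zariski_open n)"

lemma zariski_open_iff:
  "zariski_open n U \<longleftrightarrow> U \<subseteq> GL n \<and>
     (\<forall>g \<in> U. \<exists>f \<in> polynomial_funs n. f g \<noteq> 0 \<and> (\<forall>h \<in> GL n. f h \<noteq> 0 \<longrightarrow> h \<in> U))"
  (is "_ \<longleftrightarrow> ?R")
proof
  assume "zariski_open n U"
  then obtain F where F: "F \<subseteq> polynomial_funs n" and U: "U = GL n - {g \<in> GL n. \<forall>f \<in> F. f g = 0}"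
    unfolding zariski_open_def by blast
  show ?R unfolding U using F by blast
next
  assume R: ?R
  let ?F = "{f \<in> polynomial_funs n. \<forall>h \<in> GL n. f h \<noteq> 0 \<longrightarrow> h \<in> U}"
  have "U = GL n - {g \<in> GL n. \<forall>f \<in> ?F. f g = 0}"
    using R by blast
  moreover have "?F \<subseteq> polynomial_funs n" by blast
  ultimately show "zariski_open n U"
    unfolding zariski_open_def by blast
qed

lemma istopology_zariski: "istopology (zariski_open n)"
  unfolding istopology_def
proof (intro conjI allI impI)
  fix S T assume S: "zariski_open n S" and T: "zariski_open n T"
  show "zariski_open n (S \<inter> T)"
    unfolding zariski_open_iff
  proof (intro conjI ballI)
    show "S \<inter> T \<subseteq> GL n" using S by (auto simp: zariski_open_iff)
    fix g assume g: "g \<in> S \<inter> T"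
    obtain f where f: "f \<in> polynomial_funs n" "f g \<noteq> 0" "\<forall>h \<in> GL n. f h \<noteq> 0 \<longrightarrow> h \<in> S"
      using S g unfolding zariski_open_iff by blast
    obtain f' where f': "f' \<in> polynomial_funs n" "f' g \<noteq> 0" "\<forall>h \<in> GL n. f' h \<noteq> 0 \<longrightarrow> h \<in> T"
      using T g unfolding zariski_open_iff by blast
    show "\<exists>f \<in> polynomial_funs n. f g \<noteq> 0 \<and> (\<forall>h \<in> GL n. f h \<noteq> 0 \<longrightarrow> h \<in> S \<inter> T)"
    proof (rule bexI)
      show "(\<lambda>A. f A * f' A) \<in> polynomial_funs n"
        using f(1) f'(1) by (rule polynomial_funs.mult)
      show "f g * f' g \<noteq> 0 \<and> (\<forall>h \<in> GL n. f h * f' h \<noteq> 0 \<longrightarrow> h \<in> S \<inter> T)"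
        using f(2,3) f'(2,3) by simp
    qed
  qed
next
  fix \<K> assume K: "\<forall>K\<in>\<K>. zariski_open n K"
  show "zariski_open n (\<Union>\<K>)"
    unfolding zariski_open_iff
  proof (intro conjI ballI)
    show "\<Union>\<K> \<subseteq> GL n" using K by (auto simp: zariski_open_iff)
    fix g assume "g \<in> \<Union>\<K>"
    then obtain L where L: "L \<in> \<K>" "g \<in> L" by blast
    from L(1) K have "zariski_open n L" by blast
    then obtain f where "f \<in> polynomial_funs n" "f g \<noteq> 0" "\<forall>h \<in> GL n. f h \<noteq> 0 \<longrightarrow> h \<in> L"
      using L(2) unfolding zariski_open_iff by blast
    then show "\<exists>f \<in> polynomial_funs n. f g \<noteq> 0 \<and> (\<forall>h \<in> GL n. f h \<noteq> 0 \<longrightarrow> h \<in> \<Union>\<K>)"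
      using L(1) by blast
  qed
qed

lemma openin_zariski_GL: "openin (zariski_GL n) U \<longleftrightarrow> zariski_open n U"
  unfolding zariski_GL_def by (subst topology_inverse'[OF istopology_zariski]) (rule refl)


section \<open>The flag variety, orbits and Bruhat order\<close>

definition upper_borel :: "nat \<Rightarrow> complex mat set" where
  "upper_borel n = {b \<in> GL n. upper_triangular b}"

definition borel_coset :: "nat \<Rightarrow> complex mat \<Rightarrow> complex mat set" where
  "borel_coset n g = {g * b | b. b \<in> upper_borel n}"

definition flag_variety :: "nat \<Rightarrow> complex mat set set" where
  "flag_variety n = borel_coset n ` GL n"

text \<open>The Zariski topology of \<open>G/B\<close> is the quotient topology along \<open>G \<rightarrow> G/B\<close>.\<close>

definition zariski_flag :: "nat \<Rightarrow> complex mat set topology" where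
  "zariski_flag n = topology (\<lambda>U. U \<subseteq> flag_variety n \<and>
     openin (zariski_GL n) {g \<in> GL n. borel_coset n g \<in> U})"

lemma openin_zariski_flag:
  "openin (zariski_flag n) U \<longleftrightarrow>
     U \<subseteq> flag_variety n \<and> openin (zariski_GL n) {g \<in> GL n. borel_coset n g \<in> U}"
proof -
  have "istopology (\<lambda>U. U \<subseteq> flag_variety n \<and>
      openin (zariski_GL n) {g \<in> GL n. borel_coset n g \<in> U})"
    unfolding istopology_def
  proof (intro conjI allI impI)
    fix S T
    assume S: "S \<subseteq> flag_variety n \<and> openin (zariski_GL n) {g \<in> GL n. borel_coset n g \<in> S}"
      and T: "T \<subseteq> flag_variety n \<and> openin (zariski_GL n) {g \<in> GL n. borel_coset n g \<in> T}"
    show "S \<inter> T \<subseteq> flag_variety n" using S by blast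
    have "{g \<in> GL n. borel_coset n g \<in> S \<inter> T} =
        {g \<in> GL n. borel_coset n g \<in> S} \<inter> {g \<in> GL n. borel_coset n g \<in> T}" by blast
    then show "openin (zariski_GL n) {g \<in> GL n. borel_coset n g \<in> S \<inter> T}"
      using S T by (simp add: openin_Int)
  next
    fix \<K>
    assume K: "\<forall>K\<in>\<K>. K \<subseteq> flag_variety n \<and> openin (zariski_GL n) {g \<in> GL n. borel_coset n g \<in> K}"
    show "\<Union>\<K> \<subseteq> flag_variety n" using K by blast
    have "{g \<in> GL n. borel_coset n g \<in> \<Union>\<K>} = (\<Union>K\<in>\<K>. {g \<in> GL n. borel_coset n g \<in> K})" by blast
    then show "openin (zariski_GL n) {g \<in> GL n. borel_coset n g \<in> \<Union>\<K>}"
      using K by (simp only:) (rule openin_Union, blast)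
  qed
  from topology_inverse'[OF this] show ?thesis
    unfolding zariski_flag_def by (rule fun_cong)
qed

definition block_diagonal :: "nat \<Rightarrow> nat \<Rightarrow> complex mat set" where
  "block_diagonal p q =
     {four_block_mat A (0\<^sub>m p q) (0\<^sub>m q p) D | A D. A \<in> GL p \<and> D \<in> GL q}"

text \<open>
  The Gauss-Jordan procedure \<open>mat_inverse\<close> returns an option; on invertible square matrices
  \<open>the\<close> extracts the two-sided inverse.
\<close>

abbreviation inverse_mat :: "complex mat \<Rightarrow> complex mat" where
  "inverse_mat A \<equiv> the (mat_inverse A)"

definition K_orbit :: "nat \<Rightarrow> nat \<Rightarrow> clan \<Rightarrow> complex mat set set" where
  "K_orbit p q \<alpha> =
     {borel_coset (p + q) (k * inverse_mat (base_point p q \<alpha>)) | k. k \<in> block_diagonal p q}"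

definition K_orbit_closure :: "nat \<Rightarrow> nat \<Rightarrow> clan \<Rightarrow> complex mat set set" where
  "K_orbit_closure p q \<alpha> = zariski_flag (p + q) closure_of K_orbit p q \<alpha>"

definition bruhat_le :: "nat \<Rightarrow> nat \<Rightarrow> clan \<Rightarrow> clan \<Rightarrow> bool" where
  "bruhat_le p q \<alpha> \<gamma> \<longleftrightarrow> K_orbit_closure p q \<alpha> \<subseteq> K_orbit_closure p q \<gamma>"


section \<open>Mars-Springer varieties\<close>

definition plus_count :: "clan \<Rightarrow> nat \<Rightarrow> nat" where
  "plus_count \<gamma> i = card {(s, t) \<in> matchings \<gamma>. s \<le> i \<and> t \<le> i} + card {k \<in> plus_signs \<gamma>. k \<le> i}"

definition minus_count :: "clan \<Rightarrow> nat \<Rightarrow> nat" where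
  "minus_count \<gamma> i = card {(s, t) \<in> matchings \<gamma>. s \<le> i \<and> t \<le> i} + card {k \<in> minus_signs \<gamma>. k \<le> i}"

definition crossing_count :: "clan \<Rightarrow> nat \<Rightarrow> nat \<Rightarrow> nat" where
  "crossing_count \<gamma> i j = card {(s, t) \<in> matchings \<gamma>. s \<le> i \<and> j < t}"

definition southwest :: "nat \<Rightarrow> nat \<Rightarrow> nat \<Rightarrow> complex mat \<Rightarrow> complex mat" where
  "southwest p q i A = mat (p + q - i) p (\<lambda>(r, c). A $$ (i + r, c))"

definition southeast :: "nat \<Rightarrow> nat \<Rightarrow> nat \<Rightarrow> complex mat \<Rightarrow> complex mat" where
  "southeast p q i A = mat (p + q - i) q (\<lambda>(r, c). A $$ (i + r, p + c))"

definition bracket_matrix :: "nat \<Rightarrow> nat \<Rightarrow> nat \<Rightarrow> nat \<Rightarrow> complex mat \<Rightarrow> complex mat" where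
  "bracket_matrix p q i j A = mat (p + q) (i + j) (\<lambda>(r, c).
     if c < i then (if r < p then inverse_mat A $$ (r, c) else 0)
     else inverse_mat A $$ (r, c - i))"

text \<open>
  The bounds \<open>p - \<gamma>(i;+)\<close> and \<open>q - \<gamma>(i;-)\<close> are nonnegative because a \<open>(p,q)\<close>-clan has \<open>p\<close>
  matchings and plus signs and \<open>q\<close> matchings and minus signs in total; so the truncated
  subtraction is harmless.
\<close>

definition mars_springer :: "nat \<Rightarrow> nat \<Rightarrow> clan \<Rightarrow> clan \<Rightarrow> complex mat set" where
  "mars_springer p q \<gamma> \<alpha> = {A \<in> slice p q \<alpha>.
     (\<forall>i \<in> {1..p + q}. vec_space.rank (p + q - i) (southwest p q i A) \<le> p - plus_count \<gamma> i) \<and>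
     (\<forall>i \<in> {1..p + q}. vec_space.rank (p + q - i) (southeast p q i A) \<le> q - minus_count \<gamma> i) \<and>
     (\<forall>i j. 1 \<le> i \<and> i < j \<and> j \<le> p + q \<longrightarrow>
        vec_space.rank (p + q) (bracket_matrix p q i j A) \<le> j + crossing_count \<gamma> i j)}"

text \<open>
  Morphisms of reduced closed subschemes \<open>X\<close>, \<open>Y\<close> of affine spaces of matrices over the complex
  numbers are the maps on points given by polynomials in the entries.
\<close>

definition regular_map ::
    "nat \<Rightarrow> nat \<Rightarrow> complex mat set \<Rightarrow> complex mat set \<Rightarrow> (complex mat \<Rightarrow> complex mat) \<Rightarrow> bool" where
  "regular_map m n X Y \<phi> \<longleftrightarrow> (\<forall>A \<in> X. \<phi> A \<in> Y) \<and>
     (\<forall>i < n. \<forall>j < n. \<exists>f \<in> polynomial_funs m. \<forall>A \<in> X. \<phi> A $$ (i, j) = f A)"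

definition isomorphic_varieties ::
    "nat \<Rightarrow> nat \<Rightarrow> complex mat set \<Rightarrow> complex mat set \<Rightarrow> bool" where
  "isomorphic_varieties m n X Y \<longleftrightarrow> (\<exists>\<phi> \<psi>. regular_map m n X Y \<phi> \<and> regular_map n m Y X \<psi> \<and>
     (\<forall>A \<in> X. \<psi> (\<phi> A) = A) \<and> (\<forall>C \<in> Y. \<phi> (\<psi> C) = C))"


section \<open>Interval pattern containment\<close>

definition witnesses ::
    "nat \<Rightarrow> nat \<Rightarrow> nat \<Rightarrow> nat \<Rightarrow> (nat \<Rightarrow> nat) \<Rightarrow> clan \<Rightarrow> clan \<Rightarrow> bool" where
  "witnesses p q r s \<iota> \<theta> \<gamma> \<longleftrightarrow>
     strict_mono_on {1..p + q} \<iota> \<and> \<iota> ` {1..p + q} \<subseteq> {1..r + s} \<and>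
     (\<forall>j \<in> plus_signs \<gamma>. \<iota> j \<in> plus_signs \<theta>) \<and>
     (\<forall>j \<in> minus_signs \<gamma>. \<iota> j \<in> minus_signs \<theta>) \<and>
     (\<forall>(k, l) \<in> matchings \<gamma>. (\<iota> k, \<iota> l) \<in> matchings \<theta>)"

text \<open>
  When \<open>I\<close> is the image of a common witness, no matching of either clan joins a vertex in \<open>I\<close> to
  a vertex outside \<open>I\<close>.
\<close>

definition agree_outside :: "nat set \<Rightarrow> clan \<Rightarrow> clan \<Rightarrow> bool" where
  "agree_outside I \<theta> \<beta> \<longleftrightarrow>
     plus_signs \<theta> - I = plus_signs \<beta> - I \<and>
     minus_signs \<theta> - I = minus_signs \<beta> - I \<and>
     {(k, l) \<in> matchings \<theta>. k \<notin> I \<or> l \<notin> I} = {(k, l) \<in> matchings \<beta>. k \<notin> I \<or> l \<notin> I}"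

definition interval_contains ::
    "nat \<Rightarrow> nat \<Rightarrow> nat \<Rightarrow> nat \<Rightarrow> clan \<Rightarrow> clan \<Rightarrow> clan \<Rightarrow> clan \<Rightarrow> bool" where
  "interval_contains p q r s \<beta> \<theta> \<alpha> \<gamma> \<longleftrightarrow>
     (\<exists>\<iota>. witnesses p q r s \<iota> \<theta> \<gamma> \<and> witnesses p q r s \<iota> \<beta> \<alpha> \<and>
          agree_outside (\<iota> ` {1..p + q}) \<theta> \<beta>) \<and>
     clan_length \<theta> - clan_length \<beta> = clan_length \<gamma> - clan_length \<alpha>"

end

theory Submission
  imports Defs "HOL-Library.Function_Algebras"
begin

text \<open>
  Label the columns of a matrix in the slice of a clan by vertices: the column of \<open>v\<close> is the one with
  number \<open>w(v)\<close>. In these coordinates the slice has a description in which only the components of the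
  clan (its signs and its arcs) occur: a matrix agrees with the base point except at entries
  \<open>(u, v)\<close> where the component of \<open>v\<close> lies strictly to the left of that of \<open>u\<close> at both ends, and two
  entries are opposite for every crossing of two arcs (\<open>slice_iff\<close>). Deleting all rows and columns
  outside an embedded clan therefore maps the big slice to the small one, and filling up with the
  base point maps the small slice to the big one. These two coordinate maps turn out to be the
  isomorphism. This needs two facts: they respect the rank conditions whenever the big matrix is
  trivial, that is equal to the base point, outside the embedded clan; and every point of the big
  Mars-Springer variety is trivial there.

  The conditions on \<open>[\<pi>X\<inverse> | X\<inverse>]\<close> become transparent after multiplication by \<open>X\<close>: they bound
  the ranks of the lower left blocks of the involution \<open>Q = X\<sigma>X\<inverse>\<close>, where \<open>\<sigma>\<close> is \<open>1\<close> on the first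
  \<open>p\<close> columns and \<open>-1\<close> on the others (\<open>bracket_matrix_rank_iff\<close>). If \<open>X\<close> is trivial outside, then
  \<open>X\<close> and \<open>Q\<close> are direct sums of their restrictions and of explicit outer blocks, whose ranks are
  the contributions of the outside vertices to the bounds; this gives the first fact
  (\<open>rank_conds_iff\<close>).

  For the second fact let \<open>X\<close> be a point of the slice of \<open>\<beta>\<close> that satisfies the rank conditions of
  \<open>\<theta>\<close>. Each block contains a triangular system with nonzero diagonal whose size is the
  corresponding count for \<open>\<beta>\<close>, so the counts for \<open>\<theta>\<close> are at least those for \<open>\<beta>\<close>, and hence those
  for \<open>\<gamma>\<close> at least those for \<open>\<alpha>\<close>. Now the length of a clan is, up to a constant depending only on
  what lies outside, the length of the embedded clan plus the number of its arcs over each outside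
  sign plus twice the number of its arcs over each outside arc (\<open>clan_length_split\<close>); embedded arcs
  that cross an outside arc or lie below it only contribute through the number of embedded vertices
  below that arc, which is part of the constant. So the equality of length differences says that a
  sum of nonnegative differences vanishes, and the counts agree at every outside sign and arc. Where
  the rank bound equals the size of the triangular system, a row or column of the block that
  vanishes on the system vanishes altogether, because otherwise it would extend the system
  (\<open>triangular_full_rank_zero_row\<close>, \<open>triangular_full_rank_zero_col\<close>). For an outside sign this is
  applied to \<open>X\<close>; for an outside arc \<open>(x, y)\<close> it is applied to row \<open>y\<close> and column \<open>x\<close> of \<open>Q\<close>,
  and \<open>QX = X\<sigma>\<close> carries the result over to \<open>X\<close> (\<open>arc_trivial\<close>).
\<close>

section \<open>Rank of a matrix with arbitrary index sets\<close>

text \<open>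
  Independence of the family of columns indexed by \<open>D\<close>, as opposed to the set of these columns:
  two equal columns are dependent. Index sets of arbitrary type let the same notion serve for columns
  labelled by vertices and by library indices.
\<close>
definition indep_cols :: "'r set \<Rightarrow> ('r \<Rightarrow> 'c \<Rightarrow> complex) \<Rightarrow> 'c set \<Rightarrow> bool" where
  "indep_cols R X D \<longleftrightarrow> (\<forall>a. (\<forall>u\<in>R. (\<Sum>d\<in>D. a d * X u d) = 0) \<longrightarrow> (\<forall>d\<in>D. a d = 0))"

text \<open>
  Only upper bounds for ranks occur in the rank conditions, so they are what is defined.
\<close>
definition rank_at_most :: "'r set \<Rightarrow> 'c set \<Rightarrow> ('r \<Rightarrow> 'c \<Rightarrow> complex) \<Rightarrow> nat \<Rightarrow> bool" where
  "rank_at_most R C X k \<longleftrightarrow> (\<forall>D \<subseteq> C. indep_cols R X D \<longrightarrow> card D \<le> k)"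

lemma indep_colsI:
  assumes "\<And>a d. (\<And>u. u \<in> R \<Longrightarrow> (\<Sum>d\<in>D. a d * X u d) = 0) \<Longrightarrow> d \<in> D \<Longrightarrow> a d = 0"
  shows "indep_cols R X D"
  using assms unfolding indep_cols_def by blast

lemma indep_colsD:
  assumes "indep_cols R X D" "\<And>u. u \<in> R \<Longrightarrow> (\<Sum>d\<in>D. a d * X u d) = 0" "d \<in> D"
  shows "a d = 0"
  using assms unfolding indep_cols_def by blast

lemma rank_at_mostD: "rank_at_most R C X k \<Longrightarrow> D \<subseteq> C \<Longrightarrow> indep_cols R X D \<Longrightarrow> card D \<le> k"
  unfolding rank_at_most_def by blast

lemma rank_at_most_card: "finite C \<Longrightarrow> card C \<le> k \<Longrightarrow> rank_at_most R C X k"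
  unfolding rank_at_most_def by (meson card_mono le_trans)

lemma indep_cols_cong:
  assumes "\<And>u d. u \<in> R \<Longrightarrow> d \<in> D \<Longrightarrow> X u d = X' u d"
  shows "indep_cols R X D = indep_cols R X' D"
  using assms unfolding indep_cols_def by (simp cong: sum.cong)

lemma rank_at_most_cong:
  assumes "\<And>u d. u \<in> R \<Longrightarrow> d \<in> C \<Longrightarrow> X u d = X' u d"
  shows "rank_at_most R C X k = rank_at_most R C X' k"
proof -
  have "indep_cols R X D = indep_cols R X' D" if "D \<subseteq> C" for D
    using assms that by (intro indep_cols_cong) auto
  then show ?thesis unfolding rank_at_most_def by blast
qed

lemma indep_cols_image:
  assumes "inj_on g D" and f: "f ` R = R'" and X: "\<And>u d. u \<in> R \<Longrightarrow> d \<in> D \<Longrightarrow> X u d = X' (f u) (g d)"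
  shows "indep_cols R X D \<longleftrightarrow> indep_cols R' X' (g ` D)"
proof
  assume L: "indep_cols R X D"
  show "indep_cols R' X' (g ` D)"
  proof (rule indep_colsI)
    fix a e assume z: "\<And>u. u \<in> R' \<Longrightarrow> (\<Sum>d\<in>g ` D. a d * X' u d) = 0" and "e \<in> g ` D"
    then obtain d where d: "d \<in> D" "e = g d" by blast
    have "(\<Sum>d\<in>D. a (g d) * X u d) = 0" if "u \<in> R" for u
      using z[of "f u"] that f by (simp add: sum.reindex[OF assms(1)] X cong: sum.cong) blast
    from indep_colsD[OF L this d(1)] show "a e = 0" using d by simp
  qed
next
  assume L: "indep_cols R' X' (g ` D)"
  show "indep_cols R X D"
  proof (rule indep_colsI)
    fix a d assume z: "\<And>u. u \<in> R \<Longrightarrow> (\<Sum>d\<in>D. a d * X u d) = 0" and d: "d \<in> D"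
    have "(\<Sum>e\<in>g ` D. a (the_inv_into D g e) * X' u e) = 0" if "u \<in> R'" for u
    proof -
      from that f obtain w where w: "w \<in> R" "u = f w" by blast
      have "(\<Sum>e\<in>g ` D. a (the_inv_into D g e) * X' u e) = (\<Sum>d\<in>D. a d * X w d)"
        by (simp add: sum.reindex[OF assms(1)] the_inv_into_f_f[OF assms(1)] w X cong: sum.cong)
      then show ?thesis using z w by simp
    qed
    from indep_colsD[OF L this, of "g d"] show "a d = 0" using d by (simp add: the_inv_into_f_f[OF assms(1)])
  qed
qed

lemma rank_at_most_reindex:
  assumes g: "bij_betw g C C'" and f: "f ` R = R'"
    and X: "\<And>u d. u \<in> R \<Longrightarrow> d \<in> C \<Longrightarrow> X u d = X' (f u) (g d)"
  shows "rank_at_most R C X k \<longleftrightarrow> rank_at_most R' C' X' k"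
proof -
  have inj: "inj_on g D" if "D \<subseteq> C" for D using g that by (auto simp: bij_betw_def intro: inj_on_subset)
  have i: "indep_cols R X D \<longleftrightarrow> indep_cols R' X' (g ` D)" if "D \<subseteq> C" for D
    using that X by (intro indep_cols_image[OF inj f]) auto
  have "(\<forall>D\<subseteq>C. P (g ` D)) \<longleftrightarrow> (\<forall>D\<subseteq>C'. P D)" for P
    using g unfolding bij_betw_def by (metis image_mono subset_imageE)
  from this[of "\<lambda>D. indep_cols R' X' D \<longrightarrow> card D \<le> k"] show ?thesis
    unfolding rank_at_most_def using i card_image[OF inj] by (metis (no_types, lifting))
qed

lemma indep_cols_subset:
  assumes "indep_cols R X D" "E \<subseteq> D" "finite D" shows "indep_cols R X E"
proof (rule indep_colsI)
  fix a d assume z: "\<And>u. u \<in> R \<Longrightarrow> (\<Sum>d\<in>E. a d * X u d) = 0" and d: "d \<in> E"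
  have "(\<Sum>d\<in>D. (if d \<in> E then a d else 0) * X u d) = (\<Sum>d\<in>E. a d * X u d)" for u
    using assms by (intro sum.mono_neutral_cong_right) auto
  then have "\<And>u. u \<in> R \<Longrightarrow> (\<Sum>d\<in>D. (if d \<in> E then a d else 0) * X u d) = 0" using z by simp
  from indep_colsD[OF assms(1) this, of d] show "a d = 0" using assms(2) d by auto
qed

lemma indep_cols_nonzero:
  assumes "indep_cols R X D" "finite D" "c \<in> D" shows "\<exists>u\<in>R. X u c \<noteq> 0"
proof (rule ccontr)
  assume "\<not> ?thesis"
  then have "(\<Sum>d\<in>D. (if d = c then 1 else 0) * X u d) = 0" if "u \<in> R" for u
    using that by (auto intro!: sum.neutral)
  from indep_colsD[OF assms(1) this assms(3)] show False by simp
qed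

text \<open>
  In a linear relation take the column \<open>e\<close> with nonzero coefficient and least \<open>f e\<close>. In row \<open>\<rho> e\<close>
  only this column contributes.
\<close>
lemma indep_cols_triangular:
  fixes f :: "'c \<Rightarrow> nat"
  assumes fin: "finite D" and \<rho>: "\<And>d. d \<in> D \<Longrightarrow> \<rho> d \<in> R" and nz: "\<And>d. d \<in> D \<Longrightarrow> X (\<rho> d) d \<noteq> 0"
    and tri: "\<And>d e. d \<in> D \<Longrightarrow> e \<in> D \<Longrightarrow> d \<noteq> e \<Longrightarrow> X (\<rho> d) e \<noteq> 0 \<Longrightarrow> f e < f d"
  shows "indep_cols R X D"
proof (rule indep_colsI, rule ccontr)
  fix a d assume z: "\<And>u. u \<in> R \<Longrightarrow> (\<Sum>d\<in>D. a d * X u d) = 0" and d: "d \<in> D" "a d \<noteq> 0"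
  define e where "e = arg_min f (\<lambda>d. d \<in> D \<and> a d \<noteq> 0)"
  have e: "e \<in> D" "a e \<noteq> 0" and min: "\<And>d'. d' \<in> D \<Longrightarrow> a d' \<noteq> 0 \<Longrightarrow> f e \<le> f d'"
    using arg_min_natI[of "\<lambda>d. d \<in> D \<and> a d \<noteq> 0" d f] arg_min_nat_le[of "\<lambda>d. d \<in> D \<and> a d \<noteq> 0" _ f] d
    unfolding e_def by auto
  have "a d' * X (\<rho> e) d' = 0" if "d' \<in> D - {e}" for d'
    using tri[of e d'] min[of d'] that e by (cases "a d' = 0"; cases "X (\<rho> e) d' = 0"; force)
  then have "(\<Sum>d\<in>D. a d * X (\<rho> e) d) = a e * X (\<rho> e) e"
    using e fin by (simp add: sum.remove[of D e] sum.neutral)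
  then show False using z[OF \<rho>[OF e(1)]] e nz by simp
qed

text \<open>
  If the column \<open>c\<close> were nonzero in row \<open>u\<close>, then \<open>(u, c)\<close> could be added as the last step of the
  triangular system, which is already as large as the rank permits.
\<close>
lemma triangular_full_rank_zero_col:
  fixes f :: "'c \<Rightarrow> nat"
  assumes fin: "finite D" and DC: "D \<subseteq> C" and \<rho>: "\<And>d. d \<in> D \<Longrightarrow> \<rho> d \<in> R"
    and nz: "\<And>d. d \<in> D \<Longrightarrow> X (\<rho> d) d \<noteq> 0"
    and tri: "\<And>d e. d \<in> D \<Longrightarrow> e \<in> D \<Longrightarrow> d \<noteq> e \<Longrightarrow> X (\<rho> d) e \<noteq> 0 \<Longrightarrow> f e < f d"
    and rk: "rank_at_most R C X (card D)"
    and c: "c \<in> C" "c \<notin> D" "\<And>d. d \<in> D \<Longrightarrow> X (\<rho> d) c = 0" and u: "u \<in> R"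
  shows "X u c = 0"
proof (rule ccontr)
  assume n: "X u c \<noteq> 0"
  define g where "g d = (if d = c then Suc (Max (f ` D)) else f d)" for d
  have "indep_cols R X (insert c D)"
  proof (rule indep_cols_triangular[where \<rho>="\<rho>(c := u)" and f=g])
    fix d e assume de: "d \<in> insert c D" "e \<in> insert c D" "d \<noteq> e" "X ((\<rho>(c := u)) d) e \<noteq> 0"
    show "g e < g d"
    proof (cases "d = c")
      case True
      then show ?thesis using de fin by (auto simp: g_def less_Suc_eq_le)
    next
      case False
      then show ?thesis using de tri[of d e] c(3)[of d] c(2) by (auto simp: g_def)
    qed
  qed (use fin \<rho> nz u n c in auto)
  then have "card (insert c D) \<le> card D" using rk DC c(1) by (intro rank_at_mostD[OF rk]) auto
  then show False using c fin by simp
qed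

text \<open>
  As before, but a row vanishing on the system is added as its first step.
\<close>
lemma triangular_full_rank_zero_row:
  fixes f :: "'c \<Rightarrow> nat"
  assumes fin: "finite D" and DC: "D \<subseteq> C" and \<rho>: "\<And>d. d \<in> D \<Longrightarrow> \<rho> d \<in> R"
    and nz: "\<And>d. d \<in> D \<Longrightarrow> X (\<rho> d) d \<noteq> 0"
    and tri: "\<And>d e. d \<in> D \<Longrightarrow> e \<in> D \<Longrightarrow> d \<noteq> e \<Longrightarrow> X (\<rho> d) e \<noteq> 0 \<Longrightarrow> f e < f d"
    and rk: "rank_at_most R C X (card D)"
    and c: "c \<in> C" and u: "u \<in> R" "\<And>d. d \<in> D \<Longrightarrow> X u d = 0"
  shows "X u c = 0"
proof (rule ccontr)
  assume n: "X u c \<noteq> 0"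
  then have cD: "c \<notin> D" using u by auto
  define g where "g d = (if d = c then 0 else Suc (f d))" for d
  have "indep_cols R X (insert c D)"
  proof (rule indep_cols_triangular[where \<rho>="\<rho>(c := u)" and f=g])
    fix d e assume de: "d \<in> insert c D" "e \<in> insert c D" "d \<noteq> e" "X ((\<rho>(c := u)) d) e \<noteq> 0"
    show "g e < g d"
    proof (cases "d = c")
      case True
      then show ?thesis using de u(2)[of e] by auto
    next
      case False
      then show ?thesis using de tri[of d e] cD by (auto simp: g_def)
    qed
  qed (use fin \<rho> nz u n c in auto)
  then have "card (insert c D) \<le> card D" using rk DC c(1) by (intro rank_at_mostD[OF rk]) auto
  then show False using cD fin by simp
qed

text \<open>
  Steinitz exchange in the vector space of functions on the rows; rows outside \<open>R\<close> are set to
  zero so that independence over \<open>R\<close> becomes independence of functions.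
\<close>
lemma indep_cols_exchange:
  fixes X :: "'r \<Rightarrow> 'c \<Rightarrow> complex" and Y :: "'r \<Rightarrow> 'd \<Rightarrow> complex"
  assumes fD: "finite D" and fE: "finite E" and ind: "indep_cols R Y D"
    and sp: "\<And>d. d \<in> D \<Longrightarrow> \<exists>a. \<forall>u\<in>R. Y u d = (\<Sum>e\<in>E. a e * X u e)"
  shows "card D \<le> card E"
proof -
  interpret vs: vector_space "\<lambda>(a::complex) f (x::'r). a * f x"
    by standard (auto simp: algebra_simps)
  have sum_fun: "(\<Sum>i\<in>A. f i) u = (\<Sum>i\<in>A. f i u)" for f :: "'e \<Rightarrow> 'r \<Rightarrow> complex" and A u
    by (induction A rule: infinite_finite_induct) auto
  define y where "y d = (\<lambda>u. if u \<in> R then Y u d else 0)" for d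
  define x where "x e = (\<lambda>u. if u \<in> R then X u e else 0)" for e
  have inj: "inj_on y D"
  proof (rule inj_onI, rule ccontr)
    fix d e assume de: "d \<in> D" "e \<in> D" "y d = y e" "d \<noteq> e"
    have "(\<Sum>c\<in>D. (if c = d then 1 else if c = e then -1 else 0) * Y u c) = 0" if "u \<in> R" for u
    proof -
      have "(\<Sum>c\<in>D. (if c = d then 1 else if c = e then -1 else 0) * Y u c)
          = (\<Sum>c\<in>D. (if c = d then Y u d else 0) + (if c = e then - Y u e else 0))"
        using de by (intro sum.cong) auto
      also have "\<dots> = Y u d - Y u e" using de fD by (simp add: sum.distrib)
      also have "\<dots> = 0" using fun_cong[OF de(3), of u] that by (simp add: y_def)
      finally show ?thesis .
    qed
    from indep_colsD[OF ind this de(1)] show False by simp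
  qed
  have "vs.independent (y ` D)"
  proof (rule vs.independent_if_scalars_zero)
    fix f v assume z: "(\<Sum>v\<in>y ` D. (\<lambda>x. f v * v x)) = 0" and "v \<in> y ` D"
    then obtain d where d: "d \<in> D" "v = y d" by blast
    have "(\<Sum>d\<in>D. f (y d) * Y u d) = 0" if "u \<in> R" for u
    proof -
      have "(\<Sum>v\<in>y ` D. f v * v u) = 0" using fun_cong[OF z, of u] by (simp add: sum_fun)
      then have "(\<Sum>d\<in>D. f (y d) * y d u) = 0" by (simp add: sum.reindex[OF inj])
      then show ?thesis using that by (simp add: y_def)
    qed
    from indep_colsD[OF ind this d(1)] show "f v = 0" using d by simp
  qed (use fD in simp)
  moreover have "y ` D \<subseteq> vs.span (x ` E)"
  proof (rule image_subsetI)
    fix d assume "d \<in> D"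
    then obtain a where a: "\<forall>u\<in>R. Y u d = (\<Sum>e\<in>E. a e * X u e)" using sp by blast
    have "y d = (\<Sum>e\<in>E. (\<lambda>u. a e * x e u))"
      using a by (auto simp: y_def x_def sum_fun)
    also have "\<dots> \<in> vs.span (x ` E)"
      by (intro vs.span_sum vs.span_scale vs.span_base) auto
    finally show "y d \<in> vs.span (x ` E)" .
  qed
  ultimately have "card (y ` D) \<le> card (x ` E)"
    using vs.independent_span_bound[of "x ` E" "y ` D"] fE by simp
  also have "\<dots> \<le> card E" by (rule card_image_le[OF fE])
  finally show ?thesis by (simp add: card_image[OF inj])
qed

lemma ex_greatest_of_bounded:
  fixes f :: "'a \<Rightarrow> nat"
  assumes "P k" "\<forall>y. P y \<longrightarrow> f y \<le> b"
  shows "\<exists>x. P x \<and> (\<forall>y. P y \<longrightarrow> f y \<le> f x)"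
  by (rule ex_has_greatest_nat[where b="Suc b"]) (use assms in \<open>auto simp: less_Suc_eq_le\<close>)

text \<open>
  An independent family of maximal size spans all columns.
\<close>
lemma spanning_indep_cols:
  assumes fC: "finite C"
  obtains E where "E \<subseteq> C" "indep_cols R X E"
    "\<And>c. c \<in> C \<Longrightarrow> \<exists>a. \<forall>u\<in>R. X u c = (\<Sum>e\<in>E. a e * X u e)"
proof -
  define P where "P D \<longleftrightarrow> D \<subseteq> C \<and> indep_cols R X D" for D
  have "P {}" unfolding P_def indep_cols_def by simp
  moreover have "\<forall>D. P D \<longrightarrow> card D \<le> card C" unfolding P_def using fC by (auto intro: card_mono)
  ultimately have "\<exists>E. P E \<and> (\<forall>D. P D \<longrightarrow> card D \<le> card E)"
    by (rule ex_greatest_of_bounded)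
  then obtain E where E: "P E" and max: "\<And>D. P D \<Longrightarrow> card D \<le> card E"
    by blast
  have fE: "finite E" using E fC unfolding P_def by (auto intro: finite_subset)
  have "\<exists>a. \<forall>u\<in>R. X u c = (\<Sum>e\<in>E. a e * X u e)" if c: "c \<in> C" for c
  proof (cases "c \<in> E")
    case True
    have "X u c = (\<Sum>e\<in>E. (if e = c then 1 else 0) * X u e)" for u
    proof -
      have "(\<Sum>e\<in>E. (if e = c then 1 else 0) * X u e) = (\<Sum>e\<in>E. if e = c then X u e else 0)"
        by (intro sum.cong) auto
      also have "\<dots> = X u c" using True fE by simp
      finally show ?thesis by (rule sym)
    qed
    then show ?thesis by (intro exI[of _ "\<lambda>e. if e = c then 1 else 0"] ballI)
  next
    case False
    then have "\<not> P (insert c E)" using max[of "insert c E"] fE by auto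
    then have "\<not> indep_cols R X (insert c E)" using c E unfolding P_def by simp
    then obtain a d where z: "\<forall>u\<in>R. (\<Sum>d\<in>insert c E. a d * X u d) = 0" and d: "d \<in> insert c E" "a d \<noteq> 0"
      unfolding indep_cols_def by blast
    have z': "a c * X u c + (\<Sum>d\<in>E. a d * X u d) = 0" if "u \<in> R" for u
      using bspec[OF z that] False fE by simp
    have ac: "a c \<noteq> 0"
    proof
      assume "a c = 0"
      then have z0: "\<And>u. u \<in> R \<Longrightarrow> (\<Sum>d\<in>E. a d * X u d) = 0" using z' by simp
      have "indep_cols R X E" using E unfolding P_def by simp
      from indep_colsD[OF this z0, of d] have "a d = 0" using d \<open>a c = 0\<close> by auto
      then show False using d by simp
    qed
    have "X u c = (\<Sum>e\<in>E. (- a e / a c) * X u e)" if "u \<in> R" for u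
    proof -
      have "a c * X u c = - (\<Sum>d\<in>E. a d * X u d)" using z'[OF that] by (simp only: eq_neg_iff_add_eq_0)
      then have "X u c = - (\<Sum>d\<in>E. a d * X u d) / a c" unfolding nonzero_eq_divide_eq[OF ac] by (simp only: mult.commute)
      also have "\<dots> = (- 1 / a c) * (\<Sum>d\<in>E. a d * X u d)" by simp
      also have "\<dots> = (\<Sum>e\<in>E. (- a e / a c) * X u e)" unfolding sum_distrib_left by (intro sum.cong) auto
      finally show ?thesis .
    qed
    then show ?thesis by (intro exI[of _ "\<lambda>e. - a e / a c"] ballI)
  qed
  then show ?thesis by (intro that[of E]) (use E in \<open>simp_all add: P_def\<close>)
qed

text \<open>
  The columns of \<open>Y\<close> lie in the span of those of \<open>X\<close>.
\<close>
lemma rank_at_most_col_ops: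
  assumes "finite C" "finite C'" "rank_at_most R C X k"
    and "\<And>u c'. u \<in> R \<Longrightarrow> c' \<in> C' \<Longrightarrow> Y u c' = (\<Sum>c\<in>C. X u c * h c c')"
  shows "rank_at_most R C' Y k"
  unfolding rank_at_most_def
proof (intro allI impI)
  fix D assume D: "D \<subseteq> C'" and ind: "indep_cols R Y D"
  obtain E where E: "E \<subseteq> C" "indep_cols R X E"
    and sp: "\<And>c. c \<in> C \<Longrightarrow> \<exists>a. \<forall>u\<in>R. X u c = (\<Sum>e\<in>E. a e * X u e)"
    using spanning_indep_cols[OF assms(1), of R X] by metis
  from sp obtain a where a: "\<And>c u. c \<in> C \<Longrightarrow> u \<in> R \<Longrightarrow> X u c = (\<Sum>e\<in>E. a c e * X u e)" by metis
  have "card D \<le> card E"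
  proof (rule indep_cols_exchange[OF _ _ ind])
    fix d assume d: "d \<in> D"
    show "\<exists>b. \<forall>u\<in>R. Y u d = (\<Sum>e\<in>E. b e * X u e)"
    proof (intro exI ballI)
      fix u assume u: "u \<in> R"
      have "Y u d = (\<Sum>c\<in>C. (\<Sum>e\<in>E. a c e * X u e) * h c d)"
        using assms(4)[OF u, of d] d D a u by (auto intro!: sum.cong)
      also have "\<dots> = (\<Sum>e\<in>E. (\<Sum>c\<in>C. a c e * h c d) * X u e)"
        unfolding sum_distrib_right by (subst sum.swap) (simp add: mult_ac)
      finally show "Y u d = (\<Sum>e\<in>E. (\<Sum>c\<in>C. a c e * h c d) * X u e)" .
    qed
  qed (use D E assms finite_subset in blast)+
  also have "\<dots> \<le> k" using assms(3) E by (rule rank_at_mostD)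
  finally show "card D \<le> k" .
qed

text \<open>
  The second block has rank exactly \<open>m\<close>: its columns outside \<open>E\<close> vanish, and each column in \<open>E\<close>
  has a row in which it is the only one to be nonzero.
\<close>
lemma rank_at_most_direct_sum:
  fixes X :: "'r \<Rightarrow> 'c \<Rightarrow> complex"
  assumes fin: "finite C1" "finite C2" and dis: "C1 \<inter> C2 = {}"
    and X12: "\<And>u c. u \<in> R1 \<Longrightarrow> c \<in> C2 \<Longrightarrow> X u c = 0"
    and X21: "\<And>u c. u \<in> R2 \<Longrightarrow> c \<in> C1 \<Longrightarrow> X u c = 0"
    and E: "E \<subseteq> C2" "card E = m" and X2: "\<And>u c. u \<in> R2 \<Longrightarrow> c \<in> C2 - E \<Longrightarrow> X u c = 0"
    and \<rho>: "\<And>c. c \<in> E \<Longrightarrow> \<rho> c \<in> R2" "\<And>c. c \<in> E \<Longrightarrow> X (\<rho> c) c \<noteq> 0"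
      "\<And>c e. c \<in> E \<Longrightarrow> e \<in> E \<Longrightarrow> c \<noteq> e \<Longrightarrow> X (\<rho> c) e = 0"
  shows "rank_at_most (R1 \<union> R2) (C1 \<union> C2) X (k + m) \<longleftrightarrow> rank_at_most R1 C1 X k"
proof
  have f0: "finite E" using E fin finite_subset by blast
  {
    assume L: "rank_at_most (R1 \<union> R2) (C1 \<union> C2) X (k + m)"
    show "rank_at_most R1 C1 X k"
      unfolding rank_at_most_def
    proof (intro allI impI)
      fix D assume D: "D \<subseteq> C1" and ind: "indep_cols R1 X D"
      have fD: "finite D" using D fin finite_subset by blast
      have disD: "D \<inter> E = {}" using D E dis by blast
      have "indep_cols (R1 \<union> R2) X (D \<union> E)"
      proof (rule indep_colsI)
        fix a d assume z: "\<And>u. u \<in> R1 \<union> R2 \<Longrightarrow> (\<Sum>d\<in>D \<union> E. a d * X u d) = 0" and d: "d \<in> D \<union> E"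
        have z1: "(\<Sum>d\<in>D. a d * X u d) = 0" if "u \<in> R1" for u
        proof -
          have "(\<Sum>d\<in>E. a d * X u d) = 0" using X12[OF that] E by (intro sum.neutral) auto
          then show ?thesis using z[of u] that by (simp add: sum.union_disjoint[OF fD f0 disD])
        qed
        have z2: "(\<Sum>d\<in>E. a d * X u d) = 0" if "u \<in> R2" for u
        proof -
          have "(\<Sum>d\<in>D. a d * X u d) = 0" using X21[OF that] D by (intro sum.neutral) auto
          then show ?thesis using z[of u] that by (simp add: sum.union_disjoint[OF fD f0 disD])
        qed
        show "a d = 0"
        proof (cases "d \<in> D")
          case True
          then show ?thesis using indep_colsD[OF ind z1] by blast
        next
          case False
          then have d0: "d \<in> E" using d by blast
          have "indep_cols R2 X E"
            by (rule indep_cols_triangular[where \<rho>=\<rho> and f="\<lambda>_. 0"]) (use f0 \<rho> in auto)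
          from indep_colsD[OF this z2 d0] show ?thesis .
        qed
      qed
      from rank_at_mostD[OF L _ this] have "card (D \<union> E) \<le> k + m" using D E by blast
      then show "card D \<le> k" using E by (simp add: card_Un_disjoint[OF fD f0 disD])
    qed
  }
  {
    assume L: "rank_at_most R1 C1 X k"
    show "rank_at_most (R1 \<union> R2) (C1 \<union> C2) X (k + m)"
      unfolding rank_at_most_def
    proof (intro allI impI)
      fix D assume D: "D \<subseteq> C1 \<union> C2" and ind: "indep_cols (R1 \<union> R2) X D"
      have fD: "finite D" using D fin finite_subset by blast
      have "indep_cols R1 X (D \<inter> C1)"
      proof (rule indep_colsI)
        fix a d assume z: "\<And>u. u \<in> R1 \<Longrightarrow> (\<Sum>d\<in>D \<inter> C1. a d * X u d) = 0" and d: "d \<in> D \<inter> C1"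
        have "(\<Sum>d\<in>D \<inter> C1. a d * X u d) = 0" if "u \<in> R1 \<union> R2" for u
          using z X21 that by (cases "u \<in> R1") (auto intro!: sum.neutral)
        then show "a d = 0" using indep_colsD[OF indep_cols_subset[OF ind _ fD], of "D \<inter> C1"] d by blast
      qed
      then have "card (D \<inter> C1) \<le> k" by (intro rank_at_mostD[OF L]) auto
      moreover have "D - C1 \<subseteq> E"
      proof
        fix c assume c: "c \<in> D - C1"
        obtain u where u: "u \<in> R1 \<union> R2" "X u c \<noteq> 0" using indep_cols_nonzero[OF ind fD] c by blast
        then show "c \<in> E" using X12[of u c] X2[of u c] c D by blast
      qed
      then have "card (D - C1) \<le> m" using E f0 card_mono by blast
      moreover have "card D = card (D \<inter> C1) + card (D - C1)"
        by (rule card_Int_Diff[OF fD])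
      ultimately show "card D \<le> k + m" by linarith
    qed
  }
qed

text \<open>
  The library rank is the size of a maximal independent set of columns. Choosing one index for each
  of its elements turns such a set into an independent family.
\<close>
lemma mat_rank_le_iff:
  "vec_space.rank nr (mat nr nc (\<lambda>(i, j). X i j) :: complex mat) \<le> k \<longleftrightarrow> rank_at_most {..<nr} {..<nc} X k"
proof -
  interpret vec_space "TYPE(complex)" nr .
  define A :: "complex mat" where "A = mat nr nc (\<lambda>(i, j). X i j)"
  have A: "A \<in> carrier_mat nr nc" unfolding A_def by simp
  have cA: "set (cols A) \<subseteq> carrier_vec nr" using A cols_dim by blast
  have entry: "col A d $ i = X i d" if "i < nr" "d < nc" for i d using that by (simp add: A_def)
  have colA: "set (cols A) = col A ` {..<nc}" using A by (auto simp: cols_def)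
  have lin: "lin_indpt (col A ` D)" if D: "D \<subseteq> {..<nc}" and inj: "inj_on (col A) D"
      and ind: "indep_cols {..<nr} X D" for D
  proof (rule finite_lin_indpt2)
    have "finite D" using D finite_subset by blast
    then show "finite (col A ` D)" by simp
    show sub: "col A ` D \<subseteq> carrier_vec nr" using cA colA D by blast
    fix a assume z: "lincomb a (col A ` D) = 0\<^sub>v nr"
    show "\<forall>v\<in>col A ` D. a v = 0"
    proof
      fix v assume "v \<in> col A ` D"
      then obtain d where d: "d \<in> D" "v = col A d" by blast
      have "(\<Sum>d\<in>D. a (col A d) * X u d) = 0" if "u \<in> {..<nr}" for u
      proof -
        have "lincomb a (col A ` D) $ u = (\<Sum>d\<in>D. a (col A d) * col A d $ u)"
          using that sub by (subst lincomb_index) (auto simp: sum.reindex[OF inj])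
        also have "\<dots> = (\<Sum>d\<in>D. a (col A d) * X u d)" using D entry that by (intro sum.cong) auto
        finally show ?thesis using z that by simp
      qed
      from indep_colsD[OF ind this d(1)] show "a v = 0" using d by simp
    qed
  qed
  have inj: "inj_on (col A) D" if D: "D \<subseteq> {..<nc}" and ind: "indep_cols {..<nr} X D" for D
  proof (rule inj_onI, rule ccontr)
    fix d e assume de: "d \<in> D" "e \<in> D" "col A d = col A e" "d \<noteq> e"
    have fD: "finite D" using D finite_subset by blast
    have "(\<Sum>c\<in>D. (if c = d then 1 else if c = e then -1 else 0) * X u c) = 0" if "u \<in> {..<nr}" for u
    proof -
      have "(\<Sum>c\<in>D. (if c = d then 1 else if c = e then -1 else 0) * X u c)
          = (\<Sum>c\<in>D. (if c = d then X u d else 0) + (if c = e then - X u e else 0))"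
        using de by (intro sum.cong) auto
      also have "\<dots> = X u d - X u e" using de fD by (simp add: sum.distrib)
      also have "\<dots> = col A d $ u - col A e $ u"
        using de(1,2) D entry[of u d] entry[of u e] lessThan_iff[THEN iffD1, OF that]
        by (metis lessThan_iff subsetD)
      also have "\<dots> = 0" using de(3) by simp
      finally show ?thesis .
    qed
    from indep_colsD[OF ind this de(1)] show False by simp
  qed
  have "rank A \<le> k \<longleftrightarrow> rank_at_most {..<nr} {..<nc} X k"
  proof
    assume L: "rank A \<le> k"
    show "rank_at_most {..<nr} {..<nc} X k"
      unfolding rank_at_most_def
    proof (intro allI impI)
      fix D assume D: "D \<subseteq> {..<nc}" and ind: "indep_cols {..<nr} X D"
      have "card D = card (col A ` D)" using card_image[OF inj[OF D ind]] by simp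
      also have "\<dots> \<le> rank A" using rank_ge_card_indpt[OF A _ lin[OF D inj[OF D ind] ind]] D colA by auto
      finally show "card D \<le> k" using L by simp
    qed
  next
    assume L: "rank_at_most {..<nr} {..<nc} X k"
    have "lin_indpt {}" by (rule finite_lin_indpt2) auto
    then have "\<exists>S. finite S \<and> maximal S (\<lambda>T. T \<subseteq> set (cols A) \<and> lin_indpt T) \<and> {} \<subseteq> S"
      by (intro maximal_exists_superset[OF List.finite_set, of _ "cols A"]; blast)
    then obtain S where S: "maximal S (\<lambda>T. T \<subseteq> set (cols A) \<and> lin_indpt T)" "finite S"
      by blast
    have S1: "S \<subseteq> set (cols A)" "lin_indpt S" using S unfolding maximal_def by auto
    obtain D where D: "D \<subseteq> {..<nc}" "inj_on (col A) D" "S = col A ` D"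
      using S1(1) unfolding colA subset_image_inj by blast
    have "indep_cols {..<nr} X D"
    proof (rule indep_colsI)
      fix a d assume z: "\<And>u. u \<in> {..<nr} \<Longrightarrow> (\<Sum>d\<in>D. a d * X u d) = 0" and d: "d \<in> D"
      define b where "b v = a (the_inv_into D (col A) v)" for v
      have "lincomb b S = 0\<^sub>v nr"
      proof (rule eq_vecI)
        have Sc: "S \<subseteq> carrier_vec nr" using S1 cA by blast
        show "dim_vec (lincomb b S) = dim_vec (0\<^sub>v nr)" using lincomb_dim[OF S(2) Sc] by simp
        fix i assume i: "i < dim_vec (0\<^sub>v nr :: complex vec)"
        then have "lincomb b S $ i = (\<Sum>v\<in>col A ` D. b v * v $ i)"
          using lincomb_index[OF _ Sc, of i b] D(3) by simp
        also have "\<dots> = (\<Sum>d\<in>D. b (col A d) * col A d $ i)" by (simp add: sum.reindex[OF D(2)])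
        also have "\<dots> = (\<Sum>d\<in>D. a d * col A d $ i)"
          by (intro sum.cong) (simp_all add: b_def the_inv_into_f_f[OF D(2)])
        also have "\<dots> = (\<Sum>d\<in>D. a d * X i d)" using D entry i by (intro sum.cong) auto
        also have "\<dots> = 0" using z i by simp
        finally show "lincomb b S $ i = 0\<^sub>v nr $ i" using i by simp
      qed
      then have "\<forall>v\<in>S. b v = 0" using S1(2) S(2) unfolding lin_dep_def by (auto simp: class_field_def)
      then show "a d = 0" using d D by (auto simp: b_def the_inv_into_f_f[OF D(2)])
    qed
    then have "card D \<le> k" using D by (intro rank_at_mostD[OF L])
    then show "rank A \<le> k" using rank_card_indpt[OF A S(1)] D card_image[OF D(2)] by simp
  qed
  then show ?thesis unfolding A_def .
qed

lemma rank_at_most_empty_cols: "rank_at_most R {} X k"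
  unfolding rank_at_most_def by simp

lemma rank_at_most_scale:
  assumes "x \<noteq> 0" shows "rank_at_most R C (\<lambda>u c. x * X u c) k \<longleftrightarrow> rank_at_most R C X k"
proof -
  have "(\<Sum>d\<in>D. a d * (x * X u d)) = x * (\<Sum>d\<in>D. a d * X u d)" for D a u
    by (simp add: sum_distrib_left mult_ac)
  then have "indep_cols R (\<lambda>u c. x * X u c) D \<longleftrightarrow> indep_cols R X D" for D
    unfolding indep_cols_def using assms by simp
  then show ?thesis unfolding rank_at_most_def by simp
qed

lemma indep_cols_left_mult:
  assumes "finite V" and ind: "indep_cols V Y D"
    and Z: "\<And>u d. u \<in> V \<Longrightarrow> d \<in> D \<Longrightarrow> Y u d = (\<Sum>v\<in>V. h u v * Z v d)"
  shows "indep_cols V Z D"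
proof (rule indep_colsI)
  fix a d assume z: "\<And>u. u \<in> V \<Longrightarrow> (\<Sum>d\<in>D. a d * Z u d) = 0" and d: "d \<in> D"
  have "(\<Sum>d\<in>D. a d * Y u d) = 0" if u: "u \<in> V" for u
  proof -
    have "(\<Sum>d\<in>D. a d * Y u d) = (\<Sum>d\<in>D. a d * (\<Sum>v\<in>V. h u v * Z v d))"
      using Z[OF u] by simp
    also have "\<dots> = (\<Sum>v\<in>V. h u v * (\<Sum>d\<in>D. a d * Z v d))"
      unfolding sum_distrib_left by (subst sum.swap) (simp add: mult_ac)
    also have "\<dots> = 0" using z by simp
    finally show ?thesis .
  qed
  from indep_colsD[OF ind this d] show "a d = 0" .
qed

text \<open>
  Modulo the first \<open>j\<close> unit vectors only the rows below \<open>j\<close> matter.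
\<close>
lemma rank_at_most_append_units:
  fixes P :: "nat \<Rightarrow> nat \<Rightarrow> complex"
  assumes "j \<le> n" "finite C"
  defines "Z \<equiv> \<lambda>u. case_sum (P u) (\<lambda>x. if u = x then 1 else 0)"
  shows "rank_at_most {1..n} (C <+> {1..j}) Z (j + k) \<longleftrightarrow> rank_at_most {j<..n} C P k"
proof
  assume L: "rank_at_most {1..n} (C <+> {1..j}) Z (j + k)"
  show "rank_at_most {j<..n} C P k"
    unfolding rank_at_most_def
  proof (intro allI impI)
    fix D assume D: "D \<subseteq> C" and ind: "indep_cols {j<..n} P D"
    have fD: "finite D" using D assms finite_subset by blast
    have "indep_cols {1..n} Z (D <+> {1..j})"
    proof (rule indep_colsI)
      fix a d assume z: "\<And>u. u \<in> {1..n} \<Longrightarrow> (\<Sum>d\<in>D <+> {1..j}. a d * Z u d) = 0" and d: "d \<in> D <+> {1..j}"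
      have z': "(\<Sum>d\<in>D. a (Inl d) * P u d) + (\<Sum>x\<in>{1..j}. if x = u then a (Inr x) else 0) = 0" if "u \<in> {1..n}" for u
      proof -
        have "(\<Sum>x\<in>{1..j}. a (Inr x) * (if u = x then 1 else 0)) = (\<Sum>x\<in>{1..j}. if x = u then a (Inr x) else 0)"
          by (rule sum.cong) auto
        then show ?thesis using z[OF that] fD by (simp add: sum.Plus Z_def comp_def)
      qed
      have "(\<Sum>d\<in>D. a (Inl d) * P u d) = 0" if "u \<in> {j<..n}" for u
        using z'[of u] that by simp
      then have aD: "a (Inl d) = 0" if "d \<in> D" for d
        using indep_colsD[OF ind, of "\<lambda>d. a (Inl d)"] that by blast
      have "a (Inr x) = 0" if "x \<in> {1..j}" for x
        using z'[of x] aD that assms(1) by simp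
      then show "a d = 0" using aD d by auto
    qed
    then have "card (D <+> {1..j}) \<le> j + k" using D by (intro rank_at_mostD[OF L]) auto
    then show "card D \<le> k" using fD by (simp add: card_Plus)
  qed
next
  assume L: "rank_at_most {j<..n} C P k"
  obtain E where E: "E \<subseteq> C" "indep_cols {j<..n} P E"
    and sp: "\<And>c. c \<in> C \<Longrightarrow> \<exists>a. \<forall>u\<in>{j<..n}. P u c = (\<Sum>e\<in>E. a e * P u e)"
    using spanning_indep_cols[OF assms(2), of "{j<..n}" P] by metis
  from sp obtain b where b: "\<And>c u. c \<in> C \<Longrightarrow> u \<in> {j<..n} \<Longrightarrow> P u c = (\<Sum>e\<in>E. b c e * P u e)" by metis
  have fE: "finite E" using E assms finite_subset by blast
  have kE: "card E \<le> k" using rank_at_mostD[OF L E] .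
  show "rank_at_most {1..n} (C <+> {1..j}) Z (j + k)"
    unfolding rank_at_most_def
  proof (intro allI impI)
    fix D assume D: "D \<subseteq> C <+> {1..j}" and ind: "indep_cols {1..n} Z D"
    have fD: "finite D" using D assms finite_subset[of D] by simp
    have "card D \<le> card (E <+> {1..j})"
    proof (rule indep_cols_exchange[OF fD _ ind])
      show "finite (E <+> {1..j})" using fE by simp
      fix d assume "d \<in> D"
      then consider c where "c \<in> C" "d = Inl c" | x where "x \<in> {1..j}" "d = Inr x" using D by blast
      then show "\<exists>a. \<forall>u\<in>{1..n}. Z u d = (\<Sum>e\<in>E <+> {1..j}. a e * Z u e)"
      proof cases
        case (1 c)
        \<comment> \<open>The remainder vanishes after row \<open>j\<close>, so the unit vectors account for it.\<close>
        define r where "r u = P u c - (\<Sum>e\<in>E. b c e * P u e)" for u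
        have "Z u d = (\<Sum>e\<in>E <+> {1..j}. (case_sum (b c) r) e * Z u e)" if u: "u \<in> {1..n}" for u
        proof -
          have "(\<Sum>x\<in>{1..j}. r x * (if u = x then 1 else 0)) = (\<Sum>x\<in>{1..j}. if x = u then r x else 0)"
            by (rule sum.cong) auto
          also have "\<dots> = r u" using b[OF 1(1), of u] u by (auto simp: r_def)
          finally have "(\<Sum>e\<in>E <+> {1..j}. (case_sum (b c) r) e * Z u e) = (\<Sum>e\<in>E. b c e * P u e) + r u"
            using fE by (simp add: sum.Plus Z_def comp_def)
          also have "\<dots> = P u c" by (simp add: r_def)
          finally show ?thesis using 1 by (simp add: Z_def)
        qed
        then show ?thesis by (intro exI ballI)
      next
        case (2 x)
        have "Z u d = (\<Sum>e\<in>E <+> {1..j}. (case_sum (\<lambda>_. 0) (\<lambda>y. if y = x then 1 else 0)) e * Z u e)" for u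
        proof -
          have "(\<Sum>y\<in>{1..j}. (if y = x then 1 else 0) * (if u = y then 1 else 0 :: complex))
              = (\<Sum>y\<in>{1..j}. if y = x then (if u = y then 1 else 0) else 0)"
            by (rule sum.cong) auto
          also have "\<dots> = (if u = x then 1 else 0)" using 2 by simp
          finally show ?thesis using 2 fE by (simp add: sum.Plus Z_def comp_def)
        qed
        then show ?thesis by (intro exI ballI)
      qed
    qed
    also have "\<dots> \<le> j + k" using fE kE by (simp add: card_Plus)
    finally show "card D \<le> j + k" .
  qed
qed

section \<open>Partners, sides and the column labelling of a clan\<close>

text \<open>
  The involution on vertices that fixes the signs and exchanges the ends of each arc.
\<close>
definition partner :: "clan \<Rightarrow> nat \<Rightarrow> nat" where
  "partner \<gamma> v = (if \<exists>u. (v, u) \<in> matchings \<gamma> \<or> (u, v) \<in> matchings \<gamma>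
     then THE u. (v, u) \<in> matchings \<gamma> \<or> (u, v) \<in> matchings \<gamma> else v)"

text \<open>
  The left and right end of the component of \<open>v\<close>; both are \<open>v\<close> if \<open>v\<close> is a sign.
\<close>
definition lo :: "clan \<Rightarrow> nat \<Rightarrow> nat" where "lo \<gamma> v = min v (partner \<gamma> v)"
definition hi :: "clan \<Rightarrow> nat \<Rightarrow> nat" where "hi \<gamma> v = max v (partner \<gamma> v)"

text \<open>
  The vertices whose columns are among the first \<open>p\<close> (for \<open>True\<close>) or the last \<open>q\<close> columns. An arc
  has one end on each side, so a component meets a side in at most one vertex.
\<close>
definition side :: "bool \<Rightarrow> clan \<Rightarrow> nat set" where
  "side T \<gamma> = (if T then plus_signs \<gamma> \<union> left_ends \<gamma> else minus_signs \<gamma> \<union> right_ends \<gamma>)"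

lemma card_le_strict_mono:
  fixes S :: "nat set"
  assumes "finite S" "j \<in> S" "i < j"
  shows "card {k \<in> S. k \<le> i} < card {k \<in> S. k \<le> j}"
proof (rule psubset_card_mono)
  have "j \<in> {k \<in> S. k \<le> j}" "j \<notin> {k \<in> S. k \<le> i}" "{k \<in> S. k \<le> i} \<subseteq> {k \<in> S. k \<le> j}"
    using assms by auto
  then show "{k \<in> S. k \<le> i} \<subset> {k \<in> S. k \<le> j}" by blast
qed (use assms in auto)

lemma card_le_less_iff:
  fixes S :: "nat set"
  assumes "finite S" "i \<in> S" "j \<in> S"
  shows "card {k \<in> S. k \<le> i} < card {k \<in> S. k \<le> j} \<longleftrightarrow> i < j"
  using card_le_strict_mono[OF assms(1,3), of i] card_le_strict_mono[OF assms(1,2), of j]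
  by (metis less_asym linorder_neqE_nat)

lemma bij_betw_card_le:
  fixes S :: "nat set"
  assumes "finite S"
  shows "bij_betw (\<lambda>i. card {k \<in> S. k \<le> i}) S {1..card S}"
proof -
  let ?f = "\<lambda>i. card {k \<in> S. k \<le> i}"
  have inj: "inj_on ?f S"
  proof (rule inj_onI)
    fix i j assume "i \<in> S" "j \<in> S" "?f i = ?f j"
    then show "i = j" using card_le_less_iff[OF assms, of i j] card_le_less_iff[OF assms, of j i] by simp
  qed
  have "?f ` S \<subseteq> {1..card S}"
  proof (rule image_subsetI)
    fix i assume i: "i \<in> S"
    have "card {i} \<le> ?f i" by (rule card_mono) (use i assms in auto)
    moreover have "?f i \<le> card S" by (rule card_mono) (use assms in auto)
    ultimately show "?f i \<in> {1..card S}" by simp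
  qed
  then have "?f ` S = {1..card S}"
    by (rule card_subset_eq[rotated]) (simp_all add: card_image[OF inj])
  then show ?thesis using inj by (simp add: bij_betw_def)
qed

locale pq_clan =
  fixes p q :: nat and \<gamma> :: clan
  assumes clan: "\<gamma> \<in> Clans p q"
begin

abbreviation "m \<equiv> matchings \<gamma>"
abbreviation "V \<equiv> {1..p + q}"
abbreviation "\<tau> \<equiv> partner \<gamma>"
abbreviation "w \<equiv> clan_perm p \<gamma>"

lemma matching_bounds:
  assumes "(i, j) \<in> m" shows "1 \<le> i \<and> i < j \<and> j \<le> p + q"
proof -
  have "\<forall>(i, j) \<in> m. 1 \<le> i \<and> i < j \<and> j \<le> p + q" using clan by (simp add: Clans_def)
  from bspec[OF this assms] show ?thesis by simp
qed

lemma matching_disjoint: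
  assumes "(i, j) \<in> m" "(k, l) \<in> m" "(i, j) \<noteq> (k, l)" shows "{i, j} \<inter> {k, l} = {}"
proof -
  have "\<forall>(i, j) \<in> m. \<forall>(k, l) \<in> m. (i, j) \<noteq> (k, l) \<longrightarrow> {i, j} \<inter> {k, l} = {}"
    using clan by (simp add: Clans_def)
  from bspec[OF this assms(1)] have "\<forall>(k, l) \<in> m. (i, j) \<noteq> (k, l) \<longrightarrow> {i, j} \<inter> {k, l} = {}" by simp
  from bspec[OF this assms(2)] show ?thesis using assms(3) by simp
qed

lemma matching_left_unique: "(i, j) \<in> m \<Longrightarrow> (i, l) \<in> m \<Longrightarrow> j = l"
  using matching_disjoint[of i j i l] by auto

lemma matching_right_unique: "(i, j) \<in> m \<Longrightarrow> (k, j) \<in> m \<Longrightarrow> i = k"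
  using matching_disjoint[of i j k j] by auto

lemma matching_not_chained: "(i, j) \<in> m \<Longrightarrow> (j, l) \<in> m \<Longrightarrow> False"
  using matching_disjoint[of i j j l] matching_bounds[of i j] by auto

lemma matching_in_V: "(i, j) \<in> m \<Longrightarrow> i \<in> V \<and> j \<in> V"
  using matching_bounds[of i j] by auto

lemma signs_eq: "plus_signs \<gamma> \<union> minus_signs \<gamma> = V - (left_ends \<gamma> \<union> right_ends \<gamma>)"
  using clan by (simp add: Clans_def)

lemma signs_disjoint: "plus_signs \<gamma> \<inter> minus_signs \<gamma> = {}"
  using clan by (simp add: Clans_def)

lemma left_endsI: "(i, j) \<in> m \<Longrightarrow> i \<in> left_ends \<gamma>" unfolding left_ends_def by force
lemma right_endsI: "(i, j) \<in> m \<Longrightarrow> j \<in> right_ends \<gamma>" unfolding right_ends_def by force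
lemma left_endsE: "i \<in> left_ends \<gamma> \<Longrightarrow> (\<And>j. (i, j) \<in> m \<Longrightarrow> P) \<Longrightarrow> P" unfolding left_ends_def by auto
lemma right_endsE: "j \<in> right_ends \<gamma> \<Longrightarrow> (\<And>i. (i, j) \<in> m \<Longrightarrow> P) \<Longrightarrow> P" unfolding right_ends_def by auto

lemma partner_left: "(a, b) \<in> m \<Longrightarrow> \<tau> a = b"
proof -
  assume ab: "(a, b) \<in> m"
  have "(THE u. (a, u) \<in> m \<or> (u, a) \<in> m) = b"
    by (rule the_equality) (use ab matching_left_unique matching_not_chained in blast)+
  then show ?thesis using ab unfolding partner_def by auto
qed

lemma partner_right: "(a, b) \<in> m \<Longrightarrow> \<tau> b = a"
proof -
  assume ab: "(a, b) \<in> m"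
  have "(THE u. (b, u) \<in> m \<or> (u, b) \<in> m) = a"
    by (rule the_equality) (use ab matching_right_unique matching_not_chained in blast)+
  then show ?thesis using ab unfolding partner_def by auto
qed

lemma partner_sign: "v \<in> plus_signs \<gamma> \<union> minus_signs \<gamma> \<Longrightarrow> \<tau> v = v"
proof -
  assume "v \<in> plus_signs \<gamma> \<union> minus_signs \<gamma>"
  then have "v \<notin> left_ends \<gamma>" "v \<notin> right_ends \<gamma>" using signs_eq by auto
  then have "\<not> (\<exists>u. (v, u) \<in> m \<or> (u, v) \<in> m)" using left_endsI right_endsI by blast
  then show ?thesis unfolding partner_def by auto
qed

lemma left_notin: "(a, b) \<in> m \<Longrightarrow> a \<notin> plus_signs \<gamma> \<and> a \<notin> minus_signs \<gamma> \<and> a \<notin> right_ends \<gamma> \<and> a \<in> left_ends \<gamma>"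
proof -
  assume ab: "(a, b) \<in> m"
  have l: "a \<in> left_ends \<gamma>" using ab by (rule left_endsI)
  have r: "a \<notin> right_ends \<gamma>"
    using matching_not_chained[OF _ ab] by (auto elim!: right_endsE)
  have "a \<notin> plus_signs \<gamma> \<union> minus_signs \<gamma>" unfolding signs_eq using l by simp
  then show ?thesis using l r by simp
qed

lemma right_notin: "(a, b) \<in> m \<Longrightarrow> b \<notin> plus_signs \<gamma> \<and> b \<notin> minus_signs \<gamma> \<and> b \<notin> left_ends \<gamma> \<and> b \<in> right_ends \<gamma>"
proof -
  assume ab: "(a, b) \<in> m"
  have r: "b \<in> right_ends \<gamma>" using ab by (rule right_endsI)
  have l: "b \<notin> left_ends \<gamma>"
    using matching_not_chained[OF ab] by (auto elim!: left_endsE)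
  have "b \<notin> plus_signs \<gamma> \<union> minus_signs \<gamma>" unfolding signs_eq using r by simp
  then show ?thesis using l r by simp
qed

text \<open>
  Collects all data of a vertex, so that later case distinctions are closed by simplification.
\<close>
lemma vertex_cases:
  assumes "v \<in> V"
  obtains (plus) "v \<in> plus_signs \<gamma>" "v \<notin> minus_signs \<gamma>" "v \<notin> left_ends \<gamma>" "v \<notin> right_ends \<gamma>" "\<tau> v = v"
      "lo \<gamma> v = v" "hi \<gamma> v = v"
  | (minus) "v \<in> minus_signs \<gamma>" "v \<notin> plus_signs \<gamma>" "v \<notin> left_ends \<gamma>" "v \<notin> right_ends \<gamma>" "\<tau> v = v"
      "lo \<gamma> v = v" "hi \<gamma> v = v"
  | (left) b where "(v, b) \<in> m" "v < b" "b \<in> V" "v \<notin> plus_signs \<gamma>" "v \<notin> minus_signs \<gamma>" "v \<in> left_ends \<gamma>" "v \<notin> right_ends \<gamma>"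
      "\<tau> v = b" "\<tau> b = v" "lo \<gamma> v = v" "hi \<gamma> v = b"
  | (right) a where "(a, v) \<in> m" "a < v" "a \<in> V" "v \<notin> plus_signs \<gamma>" "v \<notin> minus_signs \<gamma>" "v \<notin> left_ends \<gamma>" "v \<in> right_ends \<gamma>"
      "\<tau> v = a" "\<tau> a = v" "lo \<gamma> v = a" "hi \<gamma> v = v"
proof -
  have "v \<in> (plus_signs \<gamma> \<union> minus_signs \<gamma>) \<union> (left_ends \<gamma> \<union> right_ends \<gamma>)"
    unfolding signs_eq using assms by simp
  then consider "v \<in> plus_signs \<gamma>" | "v \<in> minus_signs \<gamma>" | "v \<in> left_ends \<gamma>" | "v \<in> right_ends \<gamma>"
    by auto
  then show thesis
  proof cases
    case 1
    then have n: "v \<notin> left_ends \<gamma> \<and> v \<notin> right_ends \<gamma>" "v \<notin> minus_signs \<gamma>" "\<tau> v = v"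
      using equalityD1[OF signs_eq] equalityD1[OF signs_disjoint] partner_sign[of v] by auto
    show ?thesis by (rule that(1)) (simp_all add: 1 n lo_def hi_def)
  next
    case 2
    then have n: "v \<notin> left_ends \<gamma> \<and> v \<notin> right_ends \<gamma>" "v \<notin> plus_signs \<gamma>" "\<tau> v = v"
      using equalityD1[OF signs_eq] equalityD1[OF signs_disjoint] partner_sign[of v] by auto
    show ?thesis by (rule that(2)) (simp_all add: 2 n lo_def hi_def)
  next
    case 3
    then obtain b where b: "(v, b) \<in> m" by (rule left_endsE)
    have "v < b" using matching_bounds[OF b] by simp
    then show ?thesis
      by (intro that(3)[OF b]) (use matching_in_V[OF b] left_notin[OF b] partner_left[OF b] partner_right[OF b] in
        \<open>simp_all add: lo_def hi_def\<close>)
  next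
    case 4
    then obtain a where a: "(a, v) \<in> m" by (rule right_endsE)
    have "a < v" using matching_bounds[OF a] by simp
    then show ?thesis
      by (intro that(4)[OF a]) (use matching_in_V[OF a] right_notin[OF a] partner_left[OF a] partner_right[OF a] in
        \<open>simp_all add: lo_def hi_def\<close>)
  qed
qed

lemma partner_in_V:
  assumes v: "v \<in> V" shows "\<tau> v \<in> V"
  using v by (cases rule: vertex_cases) (use v in simp_all)

lemma partner_partner:
  assumes v: "v \<in> V" shows "\<tau> (\<tau> v) = v"
  using v by (cases rule: vertex_cases) simp_all

lemma lo_hi_in_V:
  assumes v: "v \<in> V" shows "lo \<gamma> v \<in> V \<and> hi \<gamma> v \<in> V"
  using v by (cases rule: vertex_cases) (use v in simp_all)

lemma lo_le: "lo \<gamma> v \<le> v" and hi_ge: "v \<le> hi \<gamma> v" and lo_le_hi: "lo \<gamma> v \<le> hi \<gamma> v"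
  unfolding lo_def hi_def by auto

lemma lo_partner: "v \<in> V \<Longrightarrow> lo \<gamma> (\<tau> v) = lo \<gamma> v" and hi_partner: "v \<in> V \<Longrightarrow> hi \<gamma> (\<tau> v) = hi \<gamma> v"
  unfolding lo_def hi_def using partner_partner by (auto simp: min.commute max.commute)

lemma side_subset: "side T \<gamma> \<subseteq> V"
proof
  fix v assume v: "v \<in> side T \<gamma>"
  show "v \<in> V"
  proof (cases "v \<in> left_ends \<gamma> \<or> v \<in> right_ends \<gamma>")
    case True
    then show ?thesis using matching_in_V by (elim disjE left_endsE right_endsE) simp_all
  next
    case False
    then have "v \<in> plus_signs \<gamma> \<union> minus_signs \<gamma>" using v by (auto simp: side_def split: if_splits)
    then show ?thesis unfolding signs_eq by simp
  qed
qed

lemma finite_side: "finite (side T \<gamma>)"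
  using side_subset finite_subset by blast

lemma side_cover: "V = side True \<gamma> \<union> side False \<gamma>"
proof
  show "V \<subseteq> side True \<gamma> \<union> side False \<gamma>"
  proof
    fix v assume "v \<in> V"
    then show "v \<in> side True \<gamma> \<union> side False \<gamma>" by (cases rule: vertex_cases) (simp_all add: side_def)
  qed
qed (use side_subset in auto)

lemma side_disjoint: "v \<in> side T \<gamma> \<Longrightarrow> v \<notin> side (\<not> T) \<gamma>"
proof -
  assume v: "v \<in> side T \<gamma>"
  then have "v \<in> V" using side_subset by blast
  then show ?thesis using v by (cases rule: vertex_cases; cases T) (simp_all add: side_def)
qed

lemma side_other: "v \<in> V \<Longrightarrow> v \<notin> side T \<gamma> \<longleftrightarrow> v \<in> side (\<not> T) \<gamma>"
  by (erule vertex_cases; cases T) (simp_all add: side_def)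

lemma left_side: "(a, b) \<in> m \<Longrightarrow> a \<in> side T \<gamma> \<longleftrightarrow> T" and right_side: "(a, b) \<in> m \<Longrightarrow> b \<in> side T \<gamma> \<longleftrightarrow> \<not> T"
  using left_notin[of a b] right_notin[of a b] by (auto simp: side_def)

lemma same_component:
  assumes "u \<in> V" "v \<in> V" "lo \<gamma> u = lo \<gamma> v"
  shows "u = v \<or> u = \<tau> v"
proof -
  have "lo \<gamma> u = u \<or> lo \<gamma> u = \<tau> u" "lo \<gamma> v = v \<or> lo \<gamma> v = \<tau> v" unfolding lo_def by auto
  then show ?thesis using assms partner_partner by metis
qed

lemma lo_inj_on_side:
  assumes "u \<in> side T \<gamma>" "v \<in> side T \<gamma>" "lo \<gamma> u = lo \<gamma> v" shows "u = v"
proof -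
  have uv: "u \<in> V" "v \<in> V" using assms side_subset by blast+
  show ?thesis using uv(2)
  proof (cases rule: vertex_cases)
    case (left b)
    then show ?thesis using same_component[OF uv assms(3)] assms(1,2) left_side[OF left(1)] right_side[OF left(1)] by auto
  next
    case (right a)
    then show ?thesis using same_component[OF uv assms(3)] assms(1,2) left_side[OF right(1)] right_side[OF right(1)] by auto
  qed (use same_component[OF uv assms(3)] in auto)
qed

lemma lo_image_side: "lo \<gamma> ` side T \<gamma> = (if T then plus_signs \<gamma> else minus_signs \<gamma>) \<union> left_ends \<gamma>"
proof (cases T)
  case True
  have "lo \<gamma> v = v" if "v \<in> plus_signs \<gamma> \<union> left_ends \<gamma>" for v
    using that partner_sign[of v] partner_left matching_bounds unfolding lo_def by (fastforce elim!: left_endsE)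
  then show ?thesis using True by (auto simp: side_def image_iff)
next
  case False
  have "lo \<gamma> v = v" if "v \<in> minus_signs \<gamma>" for v using that partner_sign[of v] unfolding lo_def by auto
  moreover have r: "lo \<gamma> b = a" if "(a, b) \<in> m" for a b
    using that partner_right[of a b] matching_bounds[of a b] unfolding lo_def by auto
  have "lo \<gamma> ` right_ends \<gamma> = left_ends \<gamma>"
    unfolding right_ends_def left_ends_def image_image by (rule image_cong) (auto simp: r)
  ultimately show ?thesis using False by (simp add: side_def image_Un)
qed

lemma finite_matchings: "finite m"
proof (rule finite_subset)
  show "m \<subseteq> V \<times> V" using matching_in_V by auto
qed auto

lemma card_ends: "card (left_ends \<gamma>) = card m" "card (right_ends \<gamma>) = card m"
  unfolding left_ends_def right_ends_def
  by (auto intro!: card_image inj_onI dest: matching_left_unique matching_right_unique)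

lemma finite_parts: "finite (plus_signs \<gamma>)" "finite (minus_signs \<gamma>)" "finite (left_ends \<gamma>)" "finite (right_ends \<gamma>)"
  using finite_side[of True] finite_side[of False] by (auto simp: side_def)

lemma card_side: "card (side T \<gamma>) = (if T then p else q)"
proof -
  have T: "card (side True \<gamma>) = card (plus_signs \<gamma>) + card m"
    unfolding side_def card_ends(1)[symmetric] if_True
    by (rule card_Un_disjoint) (use finite_parts signs_eq in auto)
  have F: "card (side False \<gamma>) = card (minus_signs \<gamma>) + card m"
    unfolding side_def card_ends(2)[symmetric] if_False
    by (rule card_Un_disjoint) (use finite_parts signs_eq in auto)
  have "card (side True \<gamma>) + card (side False \<gamma>) = p + q"
  proof -
    have "side True \<gamma> \<inter> side False \<gamma> = {}" using side_disjoint[of _ True] by auto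
    then have "card (side True \<gamma> \<union> side False \<gamma>) = card (side True \<gamma>) + card (side False \<gamma>)"
      by (rule card_Un_disjoint[OF finite_side finite_side])
    then show ?thesis unfolding side_cover[symmetric] by simp
  qed
  moreover have "int (card (plus_signs \<gamma>)) - int (card (minus_signs \<gamma>)) = int p - int q"
    using clan by (simp add: Clans_def)
  ultimately show ?thesis using T F by (cases T) auto
qed

text \<open>
  Uniform description of the labelling: on each side, vertices are numbered by the left ends of their
  components. In particular a right end is numbered by the position of its partner.
\<close>
lemma perm_eq:
  assumes "v \<in> side T \<gamma>"
  shows "w v = (if T then 0 else p) + card {k \<in> lo \<gamma> ` side T \<gamma>. k \<le> lo \<gamma> v}"
proof -
  have v: "v \<in> V" using assms side_subset by blast
  have right: "left_end_of \<gamma> v = a" if "(a, v) \<in> m" for a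
    unfolding left_end_of_def using that by (intro the_equality) (auto dest: matching_right_unique)
  show ?thesis unfolding lo_image_side using v
    by (cases rule: vertex_cases)
      (use assms right in \<open>auto simp: clan_perm_def side_def split: if_splits\<close>)
qed

lemma perm_less_iff:
  assumes "u \<in> side T \<gamma>" "v \<in> side T \<gamma>"
  shows "w u < w v \<longleftrightarrow> lo \<gamma> u < lo \<gamma> v"
  using card_le_less_iff[of "lo \<gamma> ` side T \<gamma>" "lo \<gamma> u" "lo \<gamma> v"] assms finite_side
  by (simp add: perm_eq[OF assms(1)] perm_eq[OF assms(2)])

lemma perm_bij_side: "bij_betw w (side T \<gamma>) (if T then {1..p} else {p + 1..p + q})"
proof -
  have inj: "inj_on (lo \<gamma>) (side T \<gamma>)" by (rule inj_onI) (rule lo_inj_on_side)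
  have c: "card (lo \<gamma> ` side T \<gamma>) = (if T then p else q)" using card_image[OF inj] card_side by simp
  have "bij_betw (\<lambda>i. card {k \<in> lo \<gamma> ` side T \<gamma>. k \<le> i}) (lo \<gamma> ` side T \<gamma>) {1..(if T then p else q)}"
    using bij_betw_card_le[of "lo \<gamma> ` side T \<gamma>"] finite_side c by simp
  then have b: "bij_betw (\<lambda>v. card {k \<in> lo \<gamma> ` side T \<gamma>. k \<le> lo \<gamma> v}) (side T \<gamma>) {1..(if T then p else q)}"
    using bij_betw_trans[OF inj_on_imp_bij_betw[OF inj]] by (auto simp: comp_def)
  have "bij_betw (\<lambda>i. (if T then 0 else p) + i) {1..(if T then p else q)} (if T then {1..p} else {p + 1..p + q})"
    by (rule bij_betwI[where g="\<lambda>i. i - (if T then 0 else p)"]) auto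
  from bij_betw_trans[OF b this] have "bij_betw (\<lambda>v. (if T then 0 else p) + card {k \<in> lo \<gamma> ` side T \<gamma>. k \<le> lo \<gamma> v})
     (side T \<gamma>) (if T then {1..p} else {p + 1..p + q})" by (simp add: comp_def)
  then show ?thesis by (subst bij_betw_cong[OF perm_eq])
qed

lemma perm_side: "v \<in> V \<Longrightarrow> w v \<le> p \<longleftrightarrow> v \<in> side True \<gamma>"
  using perm_bij_side[of True] perm_bij_side[of False] side_other[of v True]
  by (auto simp: bij_betw_def) (metis atLeastAtMost_iff imageI le_antisym not_less_eq_eq)+

lemma perm_bij: "bij_betw w V V"
proof -
  have "bij_betw w (side True \<gamma> \<union> side False \<gamma>) ({1..p} \<union> {p + 1..p + q})"
    using perm_bij_side[of True] perm_bij_side[of False]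
    by (intro bij_betw_combine) auto
  moreover have "{1..p} \<union> {p + 1..p + q} = V" by auto
  ultimately show ?thesis using side_cover by simp
qed

lemma perm_in_V: "v \<in> V \<Longrightarrow> w v \<in> V" using bij_betwE[OF perm_bij] by blast
lemma perm_eq_iff: "u \<in> V \<Longrightarrow> v \<in> V \<Longrightarrow> w u = w v \<longleftrightarrow> u = v"
  using inj_on_eq_iff[OF bij_betw_imp_inj_on[OF perm_bij]] by blast

end

section \<open>The slice in vertex coordinates\<close>

text \<open>
  The entries of the base point.
\<close>
definition base_entry :: "clan \<Rightarrow> nat \<Rightarrow> nat \<Rightarrow> complex" where
  "base_entry \<gamma> u v = (if u = v \<or> (u, v) \<in> matchings \<gamma> then 1 else if (v, u) \<in> matchings \<gamma> then - 1 else 0)"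

text \<open>
  The last three conditions express that in each block of columns a pivot row has no free entries:
  a left end is the pivot row of both columns of its arc, a sign that of its own column.
\<close>
definition free_entry :: "clan \<Rightarrow> nat \<Rightarrow> nat \<Rightarrow> bool" where
  "free_entry \<gamma> u v \<longleftrightarrow> lo \<gamma> v < lo \<gamma> u \<and> hi \<gamma> v < hi \<gamma> u \<and> u \<notin> left_ends \<gamma> \<and>
     (v \<in> side True \<gamma> \<longrightarrow> u \<notin> plus_signs \<gamma>) \<and> (v \<in> side False \<gamma> \<longrightarrow> u \<notin> minus_signs \<gamma>)"

text \<open>
  The second condition is the tie of two variables: in the row of a right end \<open>l\<close>, the two columns of an
  arc that crosses the arc of \<open>l\<close> from the left are opposite.
\<close>
definition in_slice :: "nat \<Rightarrow> clan \<Rightarrow> (nat \<Rightarrow> nat \<Rightarrow> complex) \<Rightarrow> bool" where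
  "in_slice n \<gamma> X \<longleftrightarrow>
     (\<forall>u\<in>{1..n}. \<forall>v\<in>{1..n}. \<not> free_entry \<gamma> u v \<longrightarrow> X u v = base_entry \<gamma> u v) \<and>
     (\<forall>i j k l. (i, k) \<in> matchings \<gamma> \<longrightarrow> (j, l) \<in> matchings \<gamma> \<longrightarrow> i < j \<longrightarrow> j < k \<longrightarrow> k < l \<longrightarrow> X l k = - X l i)"

definition by_vertices :: "nat \<Rightarrow> clan \<Rightarrow> complex mat \<Rightarrow> nat \<Rightarrow> nat \<Rightarrow> complex" where
  "by_vertices p \<gamma> A u v = A $$ (u - 1, clan_perm p \<gamma> v - 1)"

context pq_clan
begin

lemma fixed_one_iff:
  assumes v: "v \<in> V" shows "fixed_one p \<gamma> u (w v) \<longleftrightarrow> u = v \<or> (u, v) \<in> m"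
proof
  assume "fixed_one p \<gamma> u (w v)"
  then consider "u \<in> plus_signs \<gamma> \<union> minus_signs \<gamma>" "w v = w u"
    | j where "(u, j) \<in> m" "w v = w u \<or> w v = w j" | j where "(j, u) \<in> m" "w v = w u"
    unfolding fixed_one_def by auto
  then show "u = v \<or> (u, v) \<in> m"
  proof cases
    case 1
    then have "u \<in> V" unfolding signs_eq by simp
    then show ?thesis using perm_eq_iff[OF v] 1 by auto
  next
    case (2 j)
    then show ?thesis using perm_eq_iff[OF v] matching_in_V[of u j] by auto
  next
    case (3 j)
    then show ?thesis using perm_eq_iff[OF v] matching_in_V[of j u] by auto
  qed
next
  assume R: "u = v \<or> (u, v) \<in> m"
  show "fixed_one p \<gamma> u (w v)" using v
    by (cases rule: vertex_cases) (use R in \<open>auto simp: fixed_one_def\<close>)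
qed

lemma fixed_one_range: "fixed_one p \<gamma> u c \<Longrightarrow> \<exists>v\<in>V. c = w v"
proof -
  assume "fixed_one p \<gamma> u c"
  then consider "u \<in> plus_signs \<gamma> \<union> minus_signs \<gamma>" "c = w u"
    | j where "(u, j) \<in> m" "c = w u \<or> c = w j" | j where "(j, u) \<in> m" "c = w u"
    unfolding fixed_one_def by auto
  then show ?thesis
  proof cases
    case 1
    then show ?thesis unfolding signs_eq by blast
  qed (use matching_in_V in blast)+
qed

lemma fixed_minus_one_iff:
  assumes v: "v \<in> V" shows "fixed_minus_one p \<gamma> u (w v) \<longleftrightarrow> (v, u) \<in> m"
proof
  assume "fixed_minus_one p \<gamma> u (w v)"
  then obtain j where j: "(j, u) \<in> m" "w v = w j" unfolding fixed_minus_one_def by auto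
  then have "v = j" using perm_eq_iff[OF v, of j] matching_in_V[of j u] by auto
  then show "(v, u) \<in> m" using j by simp
next
  assume "(v, u) \<in> m"
  then show "fixed_minus_one p \<gamma> u (w v)" unfolding fixed_minus_one_def by auto
qed

lemma matched_right_iff:
  assumes v: "v \<in> V" shows "(u, v) \<in> m \<longleftrightarrow> v \<in> right_ends \<gamma> \<and> u = \<tau> v"
proof (cases "v \<in> right_ends \<gamma>")
  case True
  then obtain a where a: "(a, v) \<in> m" by (rule right_endsE)
  have "(u, v) \<in> m \<longleftrightarrow> u = a"
  proof
    assume "(u, v) \<in> m"
    from matching_right_unique[OF this a] show "u = a" .
  qed (use a in simp)
  then show ?thesis using True partner_right[OF a] by simp
next
  case False
  then have "(u, v) \<notin> m" using right_endsI[of u v] by auto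
  then show ?thesis using False by simp
qed

lemma right_end_lo:
  assumes "v \<in> right_ends \<gamma>" shows "\<tau> v < v" "lo \<gamma> v = \<tau> v"
proof -
  obtain a where "(a, v) \<in> m" using assms by (rule right_endsE)
  then show "\<tau> v < v" using partner_right matching_bounds by force
  then show "lo \<gamma> v = \<tau> v" by (simp add: lo_def)
qed

lemma not_right_end_lo:
  assumes v: "v \<in> V" and "v \<notin> right_ends \<gamma>" shows "lo \<gamma> v = v"
  using v by (cases rule: vertex_cases) (use assms in simp_all)

lemma pivot_iff:
  assumes v: "v \<in> V" shows "pivot p \<gamma> u (w v) \<longleftrightarrow> u = lo \<gamma> v"
proof (cases "v \<in> right_ends \<gamma>")
  case True
  show ?thesis
    unfolding pivot_def fixed_one_iff[OF v] matched_right_iff[OF v] right_end_lo(2)[OF True]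
    using True right_end_lo(1)[OF True] by auto
next
  case False
  then show ?thesis
    unfolding pivot_def fixed_one_iff[OF v] matched_right_iff[OF v] not_right_end_lo[OF v False] by auto
qed

lemma second_one_iff:
  assumes v: "v \<in> V" shows "second_one p \<gamma> u (w v) \<longleftrightarrow> u = v \<and> v \<in> right_ends \<gamma>"
proof (cases "v \<in> right_ends \<gamma>")
  case True
  show ?thesis
    unfolding second_one_def fixed_one_iff[OF v] matched_right_iff[OF v]
    using True right_end_lo(1)[OF True] by auto
next
  case False
  then show ?thesis
    unfolding second_one_def fixed_one_iff[OF v] matched_right_iff[OF v] by auto
qed

lemma pivot_in_block_iff:
  "(\<exists>c\<le>p. pivot p \<gamma> u c) \<longleftrightarrow> u \<in> plus_signs \<gamma> \<union> left_ends \<gamma>"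
  "(\<exists>c>p. pivot p \<gamma> u c) \<longleftrightarrow> u \<in> minus_signs \<gamma> \<union> left_ends \<gamma>"
proof -
  have range: "\<exists>v\<in>V. c = w v" if "pivot p \<gamma> u c" for c
    using that fixed_one_range unfolding pivot_def by blast
  have side: "w v \<le> p \<longleftrightarrow> v \<in> side True \<gamma>" "w v > p \<longleftrightarrow> v \<in> side False \<gamma>" if "v \<in> V" for v
    using perm_side[OF that] side_other[OF that, of True] by auto
  have "(\<exists>c\<le>p. pivot p \<gamma> u c) \<longleftrightarrow> u \<in> lo \<gamma> ` side True \<gamma>"
  proof
    assume "\<exists>c\<le>p. pivot p \<gamma> u c"
    then obtain c where c: "c \<le> p" "pivot p \<gamma> u c" by auto
    obtain v where v: "v \<in> V" "c = w v" using range[OF c(2)] by auto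
    then show "u \<in> lo \<gamma> ` side True \<gamma>" using c pivot_iff[OF v(1)] side(1)[OF v(1)] by auto
  next
    assume "u \<in> lo \<gamma> ` side True \<gamma>"
    then obtain v where v: "v \<in> side True \<gamma>" "u = lo \<gamma> v" by auto
    have vV: "v \<in> V" using v side_subset by blast
    show "\<exists>c\<le>p. pivot p \<gamma> u c" using pivot_iff[OF vV] side(1)[OF vV] v by (intro exI[of _ "w v"]) simp
  qed
  then show "(\<exists>c\<le>p. pivot p \<gamma> u c) \<longleftrightarrow> u \<in> plus_signs \<gamma> \<union> left_ends \<gamma>"
    unfolding lo_image_side by simp
  have "(\<exists>c>p. pivot p \<gamma> u c) \<longleftrightarrow> u \<in> lo \<gamma> ` side False \<gamma>"
  proof
    assume "\<exists>c>p. pivot p \<gamma> u c"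
    then obtain c where c: "c > p" "pivot p \<gamma> u c" by auto
    obtain v where v: "v \<in> V" "c = w v" using range[OF c(2)] by auto
    then show "u \<in> lo \<gamma> ` side False \<gamma>" using c pivot_iff[OF v(1)] side(2)[OF v(1)] by auto
  next
    assume "u \<in> lo \<gamma> ` side False \<gamma>"
    then obtain v where v: "v \<in> side False \<gamma>" "u = lo \<gamma> v" by auto
    have vV: "v \<in> V" using v side_subset by blast
    show "\<exists>c>p. pivot p \<gamma> u c" using pivot_iff[OF vV] side(2)[OF vV] v by (intro exI[of _ "w v"]) simp
  qed
  then show "(\<exists>c>p. pivot p \<gamma> u c) \<longleftrightarrow> u \<in> minus_signs \<gamma> \<union> left_ends \<gamma>"
    unfolding lo_image_side by simp
qed

lemma minus_one_left_iff:
  assumes v: "v \<in> side True \<gamma>"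
  shows "(\<exists>c<w v. fixed_minus_one p \<gamma> u c) \<longleftrightarrow> (\<exists>a. (a, u) \<in> m \<and> a < lo \<gamma> v)"
proof -
  have less: "w a < w v \<longleftrightarrow> a < lo \<gamma> v" if "(a, u) \<in> m" for a
    using perm_less_iff[of a True v] v left_side[OF that, of True] partner_left[OF that] matching_bounds[OF that]
    by (simp add: lo_def)
  show ?thesis
  proof
    assume "\<exists>c<w v. fixed_minus_one p \<gamma> u c"
    then show "\<exists>a. (a, u) \<in> m \<and> a < lo \<gamma> v" unfolding fixed_minus_one_def using less by auto
  next
    assume "\<exists>a. (a, u) \<in> m \<and> a < lo \<gamma> v"
    then obtain a where "(a, u) \<in> m" "a < lo \<gamma> v" by auto
    then show "\<exists>c<w v. fixed_minus_one p \<gamma> u c"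
      unfolding fixed_minus_one_def using less by (intro exI[of _ "w a"]) auto
  qed
qed

lemma second_one_left_iff:
  assumes v: "v \<in> side False \<gamma>"
  shows "(\<exists>c>p. c < w v \<and> second_one p \<gamma> u c) \<longleftrightarrow> (\<exists>a. (a, u) \<in> m \<and> a < lo \<gamma> v)"
proof -
  have less: "w u < w v \<longleftrightarrow> a < lo \<gamma> v" if "(a, u) \<in> m" for a
    using perm_less_iff[of u False v] v right_side[OF that, of False] partner_right[OF that] matching_bounds[OF that]
    by (simp add: lo_def)
  show ?thesis
  proof
    assume "\<exists>c>p. c < w v \<and> second_one p \<gamma> u c"
    then obtain c where c: "c > p" "c < w v" "second_one p \<gamma> u c" by auto
    then obtain x where x: "x \<in> V" "c = w x" using fixed_one_range unfolding second_one_def by blast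
    then have "u = x" "u \<in> right_ends \<gamma>" using c second_one_iff[OF x(1)] by auto
    then obtain a where "(a, u) \<in> m" by (auto elim: right_endsE)
    then show "\<exists>a. (a, u) \<in> m \<and> a < lo \<gamma> v" using less c x \<open>u = x\<close> by auto
  next
    assume "\<exists>a. (a, u) \<in> m \<and> a < lo \<gamma> v"
    then obtain a where a: "(a, u) \<in> m" "a < lo \<gamma> v" by auto
    have u: "u \<in> V" using matching_in_V[OF a(1)] by simp
    have "w u > p" using perm_side[OF u] right_side[OF a(1), of True] by simp
    then show "\<exists>c>p. c < w v \<and> second_one p \<gamma> u c"
      using less[OF a(1)] a second_one_iff[OF u] right_endsI[OF a(1)] by (intro exI[of _ "w u"]) simp
  qed
qed

lemma matched_left_iff:
  assumes v: "v \<in> V" shows "(v, u) \<in> m \<longleftrightarrow> v \<in> left_ends \<gamma> \<and> u = \<tau> v"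
proof (cases "v \<in> left_ends \<gamma>")
  case True
  then obtain b where b: "(v, b) \<in> m" by (rule left_endsE)
  have "(v, u) \<in> m \<longleftrightarrow> u = b"
  proof
    assume "(v, u) \<in> m"
    from matching_left_unique[OF this b] show "u = b" .
  qed (use b in simp)
  then show ?thesis using True partner_left[OF b] by simp
next
  case False
  then have "(v, u) \<notin> m" using left_endsI[of v u] by auto
  then show ?thesis using False by simp
qed

lemma left_end_lo_hi:
  assumes v: "v \<in> V" and "v \<in> left_ends \<gamma>" shows "lo \<gamma> v = v" "hi \<gamma> v = \<tau> v" "v < \<tau> v"
  using v by (cases rule: vertex_cases, use assms in simp_all)+

lemma right_end_hi:
  assumes v: "v \<in> V" and "v \<in> right_ends \<gamma>" shows "hi \<gamma> v = v"
  using v by (cases rule: vertex_cases) (use assms in simp_all)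

lemma distinct_components:
  assumes u: "u \<in> V" and v: "v \<in> V" and ne: "u \<noteq> v" "(u, v) \<notin> m" "(v, u) \<notin> m"
  shows "u \<noteq> \<tau> v" "lo \<gamma> u \<noteq> lo \<gamma> v" "u \<noteq> lo \<gamma> v" "u \<noteq> hi \<gamma> v"
proof -
  show 1: "u \<noteq> \<tau> v" using v by (cases rule: vertex_cases) (use ne in auto)
  show "lo \<gamma> u \<noteq> lo \<gamma> v" using same_component[OF u v] ne(1) 1 by auto
  show "u \<noteq> lo \<gamma> v" "u \<noteq> hi \<gamma> v" using ne(1) 1 by (auto simp: lo_def hi_def min_def max_def)
qed

lemma left_of_iff:
  assumes u: "u \<in> V"
  shows "(\<exists>a. (a, u) \<in> m \<and> a < x) \<longleftrightarrow> u \<in> right_ends \<gamma> \<and> lo \<gamma> u < x"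
  unfolding matched_right_iff[OF u] using right_end_lo(2)[of u] by (cases "u \<in> right_ends \<gamma>") simp_all

lemma between_left_iff:
  assumes v: "v \<in> V"
  shows "(\<exists>r1 r2. r1 = lo \<gamma> v \<and> (v, r2) \<in> m \<and> r1 < u \<and> u < r2) \<longleftrightarrow>
    v \<in> left_ends \<gamma> \<and> lo \<gamma> v < u \<and> u < hi \<gamma> v"
  unfolding matched_left_iff[OF v] using left_end_lo_hi(2)[OF v] by (cases "v \<in> left_ends \<gamma>") simp_all

lemma between_right_iff:
  assumes v: "v \<in> V"
  shows "(\<exists>r1 r2. r1 = lo \<gamma> v \<and> (r2 = v \<and> v \<in> right_ends \<gamma>) \<and> r1 < u \<and> u < r2) \<longleftrightarrow>
    v \<in> right_ends \<gamma> \<and> lo \<gamma> v < u \<and> u < hi \<gamma> v"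
  using right_end_hi[OF v] by (cases "v \<in> right_ends \<gamma>") simp_all

text \<open>
  On this side the \<open>-1\<close> in a column stands in the row of the partner, and \<open>-1\<close>s further left in row \<open>u\<close>
  exist exactly if \<open>u\<close> is the right end of an arc that starts further left.
\<close>
lemma forced_zero_plus_side:
  assumes u: "u \<in> V" and v: "v \<in> side True \<gamma>"
  shows "forced_zero p \<gamma> u (w v) \<longleftrightarrow> u \<in> plus_signs \<gamma> \<union> left_ends \<gamma> \<or> u < lo \<gamma> v \<or>
        (v \<in> left_ends \<gamma> \<and> lo \<gamma> v < u \<and> u < hi \<gamma> v) \<or> (u \<in> right_ends \<gamma> \<and> lo \<gamma> u < lo \<gamma> v)"
proof -
  have vV: "v \<in> V" using v side_subset by (rule subsetD[rotated])
  have wv: "w v \<le> p" using perm_side[OF vV] v by simp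
  have above: "(\<exists>r'>u. r' = lo \<gamma> v) \<longleftrightarrow> u < lo \<gamma> v" by simp
  show ?thesis
    unfolding forced_zero_def if_P[OF wv] pivot_in_block_iff pivot_iff[OF vV] fixed_minus_one_iff[OF vV]
      minus_one_left_iff[OF v] left_of_iff[OF u] between_left_iff[OF vV] above ..
qed

lemma forced_zero_minus_side:
  assumes u: "u \<in> V" and v: "v \<in> side False \<gamma>"
  shows "forced_zero p \<gamma> u (w v) \<longleftrightarrow> u \<in> minus_signs \<gamma> \<union> left_ends \<gamma> \<or> u < lo \<gamma> v \<or>
        (v \<in> right_ends \<gamma> \<and> lo \<gamma> v < u \<and> u < hi \<gamma> v) \<or> (u \<in> right_ends \<gamma> \<and> lo \<gamma> u < lo \<gamma> v)"
proof -
  have vV: "v \<in> V" using v side_subset by (rule subsetD[rotated])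
  have wv: "\<not> w v \<le> p" using perm_side[OF vV] side_disjoint[OF v] by simp
  have above: "(\<exists>r'>u. r' = lo \<gamma> v) \<longleftrightarrow> u < lo \<gamma> v" by simp
  show ?thesis
    unfolding forced_zero_def if_not_P[OF wv] pivot_in_block_iff pivot_iff[OF vV] second_one_iff[OF vV]
      second_one_left_iff[OF v] left_of_iff[OF u] between_right_iff[OF vV] above ..
qed

lemma free_entry_plus_side:
  assumes u: "u \<in> V" and v: "v \<in> side True \<gamma>" and d: "lo \<gamma> u \<noteq> lo \<gamma> v" "u \<noteq> lo \<gamma> v" "u \<noteq> hi \<gamma> v"
  shows "\<not> free_entry \<gamma> u v \<longleftrightarrow> u \<in> plus_signs \<gamma> \<union> left_ends \<gamma> \<or> u < lo \<gamma> v \<or>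
        (v \<in> left_ends \<gamma> \<and> lo \<gamma> v < u \<and> u < hi \<gamma> v) \<or> (u \<in> right_ends \<gamma> \<and> lo \<gamma> u < lo \<gamma> v)"
proof -
  have vV: "v \<in> V" using v side_subset by (rule subsetD[rotated])
  have F: "v \<notin> side False \<gamma>" using side_disjoint[OF v] by simp
  have e: "v \<in> left_ends \<gamma> \<or> lo \<gamma> v = hi \<gamma> v"
    using vV by (cases rule: vertex_cases) (use v in \<open>simp_all add: side_def\<close>)
  have "lo \<gamma> v \<le> hi \<gamma> v" by (rule lo_le_hi)
  with u show ?thesis
    by (cases rule: vertex_cases) (use v F d e in \<open>simp_all add: free_entry_def\<close>, linarith+)
qed

lemma free_entry_minus_side:
  assumes u: "u \<in> V" and v: "v \<in> side False \<gamma>" and d: "lo \<gamma> u \<noteq> lo \<gamma> v" "u \<noteq> lo \<gamma> v" "u \<noteq> hi \<gamma> v"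
  shows "\<not> free_entry \<gamma> u v \<longleftrightarrow> u \<in> minus_signs \<gamma> \<union> left_ends \<gamma> \<or> u < lo \<gamma> v \<or>
        (v \<in> right_ends \<gamma> \<and> lo \<gamma> v < u \<and> u < hi \<gamma> v) \<or> (u \<in> right_ends \<gamma> \<and> lo \<gamma> u < lo \<gamma> v)"
proof -
  have vV: "v \<in> V" using v side_subset by (rule subsetD[rotated])
  have F: "v \<notin> side True \<gamma>" using side_disjoint[OF v] by simp
  have e: "v \<in> right_ends \<gamma> \<or> lo \<gamma> v = hi \<gamma> v"
    using vV by (cases rule: vertex_cases) (use v in \<open>simp_all add: side_def\<close>)
  have "lo \<gamma> v \<le> hi \<gamma> v" by (rule lo_le_hi)
  with u show ?thesis
    by (cases rule: vertex_cases) (use v F d e in \<open>simp_all add: free_entry_def\<close>, linarith+)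
qed

text \<open>
  Apart from pivot rows, another component fails to precede that of \<open>u\<close> at both ends in one of three
  ways: it starts after \<open>u\<close>, \<open>u\<close> lies strictly inside it, or it starts between the ends of the
  component of \<open>u\<close>. They correspond to the zeros above a pivot, between the two fixed entries of a
  column, and to the right of the second fixed entry of a row.
\<close>
lemma forced_zero_iff:
  assumes u: "u \<in> V" and v: "v \<in> V" and ne: "u \<noteq> v" "(u, v) \<notin> m" "(v, u) \<notin> m"
  shows "forced_zero p \<gamma> u (w v) \<longleftrightarrow> \<not> free_entry \<gamma> u v"
proof (cases "v \<in> side True \<gamma>")
  case True
  show ?thesis unfolding forced_zero_plus_side[OF u True] free_entry_plus_side[OF u True distinct_components(2-4)[OF assms]] ..
next
  case False
  then have F: "v \<in> side False \<gamma>" using side_other[OF v, of True] by simp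
  show ?thesis unfolding forced_zero_minus_side[OF u F] free_entry_minus_side[OF u F distinct_components(2-4)[OF assms]] ..
qed

lemma tied_iff:
  assumes v: "v \<in> V"
  shows "tied p \<gamma> u (w v) i \<longleftrightarrow> (\<exists>j. (i, v) \<in> m \<and> (j, u) \<in> m \<and> i < j \<and> j < v \<and> v < u)"
proof
  assume "tied p \<gamma> u (w v) i"
  then obtain j k where jk: "(i, k) \<in> m" "(j, u) \<in> m" "i < j" "j < k" "k < u" "w v = w k"
    unfolding tied_def by auto
  then have "v = k" using perm_eq_iff[OF v] matching_in_V by auto
  then show "\<exists>j. (i, v) \<in> m \<and> (j, u) \<in> m \<and> i < j \<and> j < v \<and> v < u" using jk by auto
qed (auto simp: tied_def)

lemma free_entry_distinct:
  assumes "free_entry \<gamma> u v" shows "u \<noteq> v" "(u, v) \<notin> m" "(v, u) \<notin> m"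
  using assms partner_left[of u v] partner_right[of u v] partner_left[of v u] partner_right[of v u]
  by (auto simp: free_entry_def lo_def min.commute)

lemma generic_entry_eq:
  assumes u: "u \<in> V" and v: "v \<in> V"
  shows "generic_entry p \<gamma> z u (w v) =
    (if \<not> free_entry \<gamma> u v then base_entry \<gamma> u v
     else if \<exists>i j. (i, v) \<in> m \<and> (j, u) \<in> m \<and> i < j \<and> j < v \<and> v < u then - z u (w (\<tau> v)) else z u (w v))"
proof (cases "u = v \<or> (u, v) \<in> m \<or> (v, u) \<in> m")
  case True
  then have "\<not> free_entry \<gamma> u v" using free_entry_distinct by blast
  moreover have "generic_entry p \<gamma> z u (w v) = base_entry \<gamma> u v"
    using True by (auto simp: generic_entry_def fixed_one_iff[OF v] fixed_minus_one_iff[OF v] base_entry_def)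
  ultimately show ?thesis by simp
next
  case False
  then have ne: "u \<noteq> v" "(u, v) \<notin> m" "(v, u) \<notin> m" by auto
  have the: "(THE i. tied p \<gamma> u (w v) i) = \<tau> v" if "(i, v) \<in> m" "(j, u) \<in> m" "i < j" "j < v" "v < u" for i j
  proof (rule the_equality)
    show "tied p \<gamma> u (w v) (\<tau> v)" using that partner_right[OF that(1)] unfolding tied_iff[OF v] by auto
    fix k assume "tied p \<gamma> u (w v) k"
    then show "k = \<tau> v" using partner_right unfolding tied_iff[OF v] by auto
  qed
  have ex: "(\<exists>i. tied p \<gamma> u (w v) i) \<longleftrightarrow> (\<exists>i j. (i, v) \<in> m \<and> (j, u) \<in> m \<and> i < j \<and> j < v \<and> v < u)"
    unfolding tied_iff[OF v] by simp
  have "base_entry \<gamma> u v = 0" using ne by (simp add: base_entry_def)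
  then show ?thesis using ne the unfolding generic_entry_def fixed_one_iff[OF v] fixed_minus_one_iff[OF v]
      forced_zero_iff[OF u v ne] ex by auto
qed

lemma crossing_free:
  assumes "(i, k) \<in> m" "(j, l) \<in> m" "i < j" "j < k" "k < l"
  shows "free_entry \<gamma> l i" "free_entry \<gamma> l k"
  using assms partner_left[OF assms(1)] partner_left[OF assms(2)] partner_right[OF assms(1)] partner_right[OF assms(2)]
    right_notin[OF assms(2)]
  by (auto simp: free_entry_def lo_def hi_def)

text \<open>
  The variables of the generic matrix can be read off as the entries of the matrix itself, so only
  the zeros and the ties remain as conditions.
\<close>
lemma slice_iff:
  "A \<in> slice p q \<gamma> \<longleftrightarrow> A \<in> carrier_mat (p + q) (p + q) \<and> in_slice (p + q) \<gamma> (by_vertices p \<gamma> A)"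
proof
  assume "A \<in> slice p q \<gamma>"
  then obtain z where A: "A = generic_matrix p q \<gamma> z" unfolding slice_def by auto
  have X: "by_vertices p \<gamma> A u v = generic_entry p \<gamma> z u (w v)" if "u \<in> V" "v \<in> V" for u v
    using that perm_in_V[OF that(2)] unfolding A by_vertices_def generic_matrix_def by (auto simp: Suc_diff_Suc)
  have "A \<in> carrier_mat (p + q) (p + q)" unfolding A generic_matrix_def by simp
  moreover have "in_slice (p + q) \<gamma> (by_vertices p \<gamma> A)"
    unfolding in_slice_def
  proof (intro conjI ballI allI impI)
    fix u v assume "u \<in> V" "v \<in> V" "\<not> free_entry \<gamma> u v"
    then show "by_vertices p \<gamma> A u v = base_entry \<gamma> u v" using X generic_entry_eq by simp
  next
    fix i j k l assume c: "(i, k) \<in> m" "(j, l) \<in> m" "i < j" "j < k" "k < l"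
    have V: "i \<in> V" "k \<in> V" "l \<in> V" using c matching_in_V by blast+
    have "\<not> (\<exists>a. (a, i) \<in> m)" using left_notin[OF c(1)] right_endsI by blast
    then have "by_vertices p \<gamma> A l i = z l (w i)"
      using X[OF V(3,1)] generic_entry_eq[OF V(3,1), of z] crossing_free(1)[OF c] by auto
    moreover have "by_vertices p \<gamma> A l k = - z l (w i)"
      using X[OF V(3,2)] generic_entry_eq[OF V(3,2), of z] crossing_free(2)[OF c] c partner_right[OF c(1)] by auto
    ultimately show "by_vertices p \<gamma> A l k = - by_vertices p \<gamma> A l i" by simp
  qed
  ultimately show "A \<in> carrier_mat (p + q) (p + q) \<and> in_slice (p + q) \<gamma> (by_vertices p \<gamma> A)" by simp
next
  assume R: "A \<in> carrier_mat (p + q) (p + q) \<and> in_slice (p + q) \<gamma> (by_vertices p \<gamma> A)"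
  define z where "z r c = A $$ (r - 1, c - 1)" for r c :: nat
  have "A = generic_matrix p q \<gamma> z"
  proof (rule eq_matI)
    fix i j assume ij: "i < dim_row (generic_matrix p q \<gamma> z)" "j < dim_col (generic_matrix p q \<gamma> z)"
    then have i: "i + 1 \<in> V" and j: "j + 1 \<in> V" by (auto simp: generic_matrix_def)
    obtain v where v: "v \<in> V" "w v = j + 1" using perm_bij j unfolding bij_betw_def by (metis imageE)
    have ent: "generic_matrix p q \<gamma> z $$ (i, j) = generic_entry p \<gamma> z (i + 1) (w v)"
      using ij v by (simp add: generic_matrix_def)
    have zX: "z (i + 1) (w x) = by_vertices p \<gamma> A (i + 1) x" for x by (simp add: z_def by_vertices_def)
    have A: "A $$ (i, j) = by_vertices p \<gamma> A (i + 1) v" using v by (simp add: by_vertices_def)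
    have nf: "\<not> free_entry \<gamma> (i + 1) v \<Longrightarrow> by_vertices p \<gamma> A (i + 1) v = base_entry \<gamma> (i + 1) v"
      using R i v(1) unfolding in_slice_def by blast
    have cr: "by_vertices p \<gamma> A (i + 1) v = - by_vertices p \<gamma> A (i + 1) (\<tau> v)"
      if "(a, v) \<in> m" "(b, i + 1) \<in> m" "a < b" "b < v" "v < i + 1" for a b
      using R that partner_right[OF that(1)] unfolding in_slice_def by blast
    show "A $$ (i, j) = generic_matrix p q \<gamma> z $$ (i, j)"
      unfolding ent A generic_entry_eq[OF i v(1)] zX using nf cr by auto
  qed (use R in \<open>auto simp: generic_matrix_def\<close>)
  then show "A \<in> slice p q \<gamma>" unfolding slice_def by blast
qed

end

section \<open>Points of the slice are invertible\<close>

context pq_clan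
begin

lemma in_slice_base:
  assumes "in_slice (p + q) \<gamma> X" "u \<in> V" "v \<in> V" "\<not> free_entry \<gamma> u v" shows "X u v = base_entry \<gamma> u v"
  using assms unfolding in_slice_def by simp

lemma free_entryD: "free_entry \<gamma> u v \<Longrightarrow> lo \<gamma> v < lo \<gamma> u \<and> hi \<gamma> v < hi \<gamma> u \<and> u \<notin> left_ends \<gamma>"
  unfolding free_entry_def by simp

lemma not_free_component:
  assumes "v \<in> V" shows "\<not> free_entry \<gamma> v v" "\<not> free_entry \<gamma> v (\<tau> v)"
  using lo_partner[OF assms] unfolding free_entry_def by auto

lemma in_slice_diag:
  assumes "in_slice (p + q) \<gamma> X" "v \<in> V" shows "X v v = 1"
  using in_slice_base[OF assms(1,2,2) not_free_component(1)[OF assms(2)]] by (simp add: base_entry_def)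

lemma in_slice_arc:
  assumes X: "in_slice (p + q) \<gamma> X" and ab: "(a, b) \<in> m" shows "X a b = 1" "X b a = - 1"
proof -
  have V: "a \<in> V" "b \<in> V" and \<tau>: "\<tau> a = b" "\<tau> b = a" and ne: "a \<noteq> b" and ba: "(b, a) \<notin> m"
    using matching_in_V[OF ab] partner_left[OF ab] partner_right[OF ab] matching_bounds[OF ab] matching_bounds[of b a] by auto
  have "\<not> free_entry \<gamma> a b" "\<not> free_entry \<gamma> b a"
    using not_free_component(2)[OF V(1)] not_free_component(2)[OF V(2)] \<tau> by simp_all
  then show "X a b = 1" "X b a = - 1"
    using in_slice_base[OF X] V ab ne ba by (simp_all add: base_entry_def)
qed

lemma base_entry_nonzero:
  assumes "base_entry \<gamma> u v \<noteq> 0" shows "u = v \<or> u = \<tau> v"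
  using assms partner_left[of v u] partner_right[of u v] by (auto simp: base_entry_def split: if_splits)

lemma in_slice_nonzero:
  assumes "in_slice (p + q) \<gamma> X" "u \<in> V" "v \<in> V" "X u v \<noteq> 0"
  shows "u = v \<or> u = \<tau> v \<or> free_entry \<gamma> u v"
  using assms in_slice_base base_entry_nonzero by metis

text \<open>
  Take a component on which \<open>h\<close> is nonzero and whose sum of end points is minimal. In the rows of
  this component no other component on which \<open>h\<close> is nonzero contributes, and its own block of size
  one or two is invertible.
\<close>
lemma in_slice_kernel:
  assumes X: "in_slice (p + q) \<gamma> X" and z: "\<And>u. u \<in> V \<Longrightarrow> (\<Sum>k\<in>V. X u k * h k) = 0" and v: "v \<in> V"
  shows "h v = 0"
proof (rule ccontr)
  assume n: "h v \<noteq> 0"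
  define t where "t k = lo \<gamma> k + hi \<gamma> k" for k
  define c where "c = arg_min t (\<lambda>k. k \<in> V \<and> h k \<noteq> 0)"
  have c: "c \<in> V" "h c \<noteq> 0" and min: "\<And>k. k \<in> V \<Longrightarrow> h k \<noteq> 0 \<Longrightarrow> t c \<le> t k"
    using arg_min_natI[of "\<lambda>k. k \<in> V \<and> h k \<noteq> 0" v t] arg_min_nat_le[of "\<lambda>k. k \<in> V \<and> h k \<noteq> 0" _ t] v n
    unfolding c_def by auto
  \<comment> \<open>A free entry in row \<open>u\<close> belongs to a vertex with smaller \<open>t\<close>, where \<open>h\<close> vanishes.\<close>
  have row: "(\<Sum>k\<in>{u, \<tau> u}. X u k * h k) = 0" if u: "u \<in> V" "t u = t c" for u
  proof -
    have "X u k * h k = 0" if k: "k \<in> V - {u, \<tau> u}" for k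
    proof (rule ccontr)
      assume nz: "X u k * h k \<noteq> 0"
      have "u \<noteq> \<tau> k" using k partner_partner[of k] by auto
      then have "free_entry \<gamma> u k" using in_slice_nonzero[OF X u(1), of k] k nz by auto
      then have "t k < t u" using free_entryD by (simp add: t_def add_strict_mono)
      then show False using min[of k] k nz u(2) by auto
    qed
    then have "(\<Sum>k\<in>V. X u k * h k) = (\<Sum>k\<in>{u, \<tau> u}. X u k * h k)"
      using u partner_in_V by (intro sum.mono_neutral_right) auto
    then show ?thesis using z[OF u(1)] by simp
  qed
  have d: "X k k = 1" if "k \<in> V" for k using in_slice_diag[OF X that] .
  have tc: "t (\<tau> c) = t c" using lo_partner[OF c(1)] hi_partner[OF c(1)] by (simp add: t_def)
  have pc: "\<tau> c \<in> V" "\<tau> (\<tau> c) = c" using partner_in_V[OF c(1)] partner_partner[OF c(1)] by auto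
  have r1: "(\<Sum>k\<in>{c, \<tau> c}. X c k * h k) = 0" and r2: "(\<Sum>k\<in>{\<tau> c, c}. X (\<tau> c) k * h k) = 0"
    using row[OF c(1)] row[OF pc(1) tc] pc(2) by simp_all
  show False using c(1)
  proof (cases rule: vertex_cases)
    case plus
    then show False using r1 d[OF c(1)] c(2) by simp
  next
    case minus
    then show False using r1 d[OF c(1)] c(2) by simp
  next
    case (left b)
    have "h c + h b = 0" "h b - h c = 0"
      using r1 r2 left d[OF c(1)] d[OF pc(1)] in_slice_arc[OF X left(1)] by auto
    then show False using c(2) by auto
  next
    case (right a)
    have "h c - h a = 0" "h a + h c = 0"
      using r1 r2 right d[OF c(1)] d[OF pc(1)] in_slice_arc[OF X right(1)] by auto
    then show False using c(2) by auto
  qed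
qed

lemma perm_index_bij: "bij_betw (\<lambda>v. w v - 1) V {..<p + q}"
proof -
  have "bij_betw (\<lambda>c. c - 1) V {..<p + q}" by (rule bij_betwI[where g=Suc]) auto
  from bij_betw_trans[OF perm_bij this] show ?thesis by (simp add: comp_def)
qed

lemma sum_perm_index: "(\<Sum>j<p + q. f j) = (\<Sum>v\<in>V. f (w v - 1))"
  using sum.reindex_bij_betw[OF perm_index_bij, of f] by simp

lemma sum_index: "(\<Sum>j<p + q. f j) = (\<Sum>v\<in>V. f (v - 1))"
proof -
  have "bij_betw (\<lambda>c. c - 1) V {..<p + q}" by (rule bij_betwI[where g=Suc]) auto
  from sum.reindex_bij_betw[OF this, of f] show ?thesis by simp
qed

lemma slice_inverse:
  assumes A: "A \<in> slice p q \<gamma>"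
  shows "A * inverse_mat A = 1\<^sub>m (p + q)" "inverse_mat A * A = 1\<^sub>m (p + q)"
    "inverse_mat A \<in> carrier_mat (p + q) (p + q)"
proof -
  let ?n = "p + q"
  have Ac: "A \<in> carrier_mat ?n ?n" and X: "in_slice ?n \<gamma> (by_vertices p \<gamma> A)" using A slice_iff by auto
  have "det A \<noteq> 0"
  proof
    assume "det A = 0"
    then obtain x where x: "x \<in> carrier_vec ?n" "x \<noteq> 0\<^sub>v ?n" "A *\<^sub>v x = 0\<^sub>v ?n"
      using det_0_iff_vec_prod_zero[OF Ac] by auto
    have "(\<Sum>k\<in>V. by_vertices p \<gamma> A u k * x $ (w k - 1)) = 0" if u: "u \<in> V" for u
    proof -
      have "(A *\<^sub>v x) $ (u - 1) = (\<Sum>j<?n. A $$ (u - 1, j) * x $ j)"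
        using Ac x(1) u by (auto simp: scalar_prod_def lessThan_atLeast0 intro!: sum.cong)
      also have "\<dots> = (\<Sum>k\<in>V. by_vertices p \<gamma> A u k * x $ (w k - 1))"
        unfolding sum_perm_index by (simp add: by_vertices_def)
      moreover have "u - 1 < ?n" using u by auto
      ultimately show ?thesis using x(3) by simp
    qed
    then have h: "x $ (w v - 1) = 0" if "v \<in> V" for v
      using in_slice_kernel[OF X, of "\<lambda>k. x $ (w k - 1)"] that by blast
    have "x = 0\<^sub>v ?n"
    proof (rule eq_vecI)
      fix j assume "j < dim_vec (0\<^sub>v ?n :: complex vec)"
      then have "j \<in> (\<lambda>v. w v - 1) ` V" using bij_betw_imp_surj_on[OF perm_index_bij] by simp
      then show "x $ j = 0\<^sub>v ?n $ j" using h \<open>j < _\<close> by auto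
    qed (use x in simp)
    then show False using x(2) by simp
  qed
  then have "A \<in> Units (ring_mat TYPE(complex) ?n ())" by (rule det_non_zero_imp_unit[OF Ac])
  then obtain B where B: "mat_inverse A = Some B" using mat_inverse(1)[OF Ac, of "()"] by (cases "mat_inverse A") auto
  from mat_inverse(2)[OF Ac B] B show "A * inverse_mat A = 1\<^sub>m ?n" "inverse_mat A * A = 1\<^sub>m ?n"
    "inverse_mat A \<in> carrier_mat ?n ?n" by auto
qed

definition inverse_by_vertices :: "complex mat \<Rightarrow> nat \<Rightarrow> nat \<Rightarrow> complex" where
  "inverse_by_vertices A v c = inverse_mat A $$ (w v - 1, c - 1)"

lemma inverse_by_vertices:
  assumes A: "A \<in> slice p q \<gamma>" and u: "u \<in> V" and c: "c \<in> V"
  shows "(\<Sum>k\<in>V. by_vertices p \<gamma> A u k * inverse_by_vertices A k c) = (if u = c then 1 else 0)"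
    "(\<Sum>k\<in>V. inverse_by_vertices A u k * by_vertices p \<gamma> A k c) = (if u = c then 1 else 0)"
proof -
  let ?n = "p + q" let ?B = "inverse_mat A"
  have Ac: "A \<in> carrier_mat ?n ?n" using A slice_iff by auto
  note inv = slice_inverse[OF A]
  have "(A * ?B) $$ (u - 1, c - 1) = (\<Sum>j<?n. A $$ (u - 1, j) * ?B $$ (j, c - 1))"
    using Ac inv(3) u c by (auto simp: scalar_prod_def lessThan_atLeast0 intro!: sum.cong)
  also have "\<dots> = (\<Sum>k\<in>V. by_vertices p \<gamma> A u k * inverse_by_vertices A k c)"
    unfolding sum_perm_index by (simp add: by_vertices_def inverse_by_vertices_def)
  moreover have "u - 1 < ?n" "c - 1 < ?n" "u - 1 = c - 1 \<longleftrightarrow> u = c" using u c by auto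
  ultimately show "(\<Sum>k\<in>V. by_vertices p \<gamma> A u k * inverse_by_vertices A k c) = (if u = c then 1 else 0)"
    using inv(1) by simp
  have wu: "w u \<in> V" "w c \<in> V" using perm_in_V u c by auto
  have "(?B * A) $$ (w u - 1, w c - 1) = (\<Sum>j<?n. ?B $$ (w u - 1, j) * A $$ (j, w c - 1))"
    using Ac inv(3) wu by (auto simp: scalar_prod_def lessThan_atLeast0 intro!: sum.cong)
  also have "\<dots> = (\<Sum>k\<in>V. inverse_by_vertices A u k * by_vertices p \<gamma> A k c)"
    unfolding sum_index by (simp add: by_vertices_def inverse_by_vertices_def)
  moreover have "w u - 1 < ?n" "w c - 1 < ?n" "w u - 1 = w c - 1 \<longleftrightarrow> u = c" using wu perm_eq_iff[OF u c] by auto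
  ultimately show "(\<Sum>k\<in>V. inverse_by_vertices A u k * by_vertices p \<gamma> A k c) = (if u = c then 1 else 0)"
    using inv(2) by simp
qed

end

section \<open>The involution attached to a point of the slice\<close>

text \<open>
  The inverse \<open>G\<close> of \<open>X\<close> is a parameter, with rows labelled like the columns of \<open>X\<close>, so that
  both are functions of two vertices.
\<close>
locale slice_point = pq_clan +
  fixes X G :: "nat \<Rightarrow> nat \<Rightarrow> complex"
  assumes slice: "in_slice (p + q) \<gamma> X"
    and XG: "\<And>u c. u \<in> {1..p + q} \<Longrightarrow> c \<in> {1..p + q} \<Longrightarrow> (\<Sum>k\<in>{1..p + q}. X u k * G k c) = (if u = c then 1 else 0)"
    and GX: "\<And>u c. u \<in> {1..p + q} \<Longrightarrow> c \<in> {1..p + q} \<Longrightarrow> (\<Sum>k\<in>{1..p + q}. G u k * X k c) = (if u = c then 1 else 0)"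
begin

definition sg :: "nat \<Rightarrow> complex" where "sg v = (if v \<in> side True \<gamma> then 1 else - 1)"

text \<open>
  The involution with eigenvalue \<open>1\<close> on the first \<open>p\<close> and \<open>-1\<close> on the last \<open>q\<close> columns of the matrix.
\<close>
definition Q :: "nat \<Rightarrow> nat \<Rightarrow> complex" where
  "Q u c = (\<Sum>v\<in>V. X u v * sg v * G v c)"

text \<open>
  The product of \<open>X\<close> with the inverse of the base point. It is unitriangular for the order in which
  \<open>c\<close> precedes \<open>k\<close> if this holds for the vertices and for their partners.
\<close>
definition N :: "nat \<Rightarrow> nat \<Rightarrow> complex" where
  "N k c = (if \<tau> c = c then X k c else if c < \<tau> c then (X k c + X k (\<tau> c)) / 2 else (X k c - X k (\<tau> c)) / 2)"

text \<open>
  The entry at \<open>(\<tau> c, c)\<close> of the involution of the base point, which is a monomial matrix.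
\<close>
definition eps :: "nat \<Rightarrow> complex" where "eps c = (if \<tau> c = c then sg c else - 1)"

lemma QX:
  assumes v: "v \<in> V" shows "(\<Sum>k\<in>V. Q u k * X k v) = X u v * sg v"
proof -
  have "(\<Sum>k\<in>V. Q u k * X k v) = (\<Sum>j\<in>V. X u j * sg j * (\<Sum>k\<in>V. G j k * X k v))"
    unfolding Q_def sum_distrib_right sum_distrib_left by (subst sum.swap) (simp add: mult_ac)
  also have "\<dots> = (\<Sum>j\<in>V. if j = v then X u j * sg j else 0)"
    using GX v by (intro sum.cong) simp_all
  also have "\<dots> = X u v * sg v" using v by simp
  finally show ?thesis .
qed

lemma GQ:
  assumes v: "v \<in> V" shows "(\<Sum>k\<in>V. G v k * Q k c) = sg v * G v c"
proof -
  have "(\<Sum>k\<in>V. G v k * Q k c) = (\<Sum>j\<in>V. (\<Sum>k\<in>V. G v k * X k j) * (sg j * G j c))"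
    unfolding Q_def sum_distrib_right sum_distrib_left by (subst sum.swap) (simp add: mult_ac)
  also have "\<dots> = (\<Sum>j\<in>V. if j = v then sg j * G j c else 0)"
    using GX v by (intro sum.cong) simp_all
  also have "\<dots> = sg v * G v c" using v by simp
  finally show ?thesis .
qed

text \<open>
  The equation \<open>QX = X\<sigma>\<close> multiplied by the inverse of the base point.
\<close>
lemma QN:
  assumes c: "c \<in> V" shows "(\<Sum>k\<in>V. Q r k * N k c) = eps c * N r (\<tau> c)"
proof -
  have \<tau>c: "\<tau> c \<in> V" using partner_in_V[OF c] .
  note q = QX[OF c, of r] QX[OF \<tau>c, of r]
  show ?thesis using c
  proof (cases rule: vertex_cases)
    case plus
    then show ?thesis using q by (simp add: N_def eps_def)
  next
    case minus
    then show ?thesis using q by (simp add: N_def eps_def)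
  next
    case (left b)
    have s: "sg c = 1" "sg b = - 1" using left_side[OF left(1), of True] right_side[OF left(1), of True] by (simp_all add: sg_def)
    have Nc: "N k c = (X k c + X k b) / 2" "N k b = (X k b - X k c) / 2" for k
      using left(2,8,9) by (simp_all add: N_def)
    have "Q r k * N k c = (1 / 2) * (Q r k * X k c) + (1 / 2) * (Q r k * X k b)" for k
      unfolding Nc by (simp add: field_simps)
    then have "(\<Sum>k\<in>V. Q r k * N k c) = (1 / 2) * (\<Sum>k\<in>V. Q r k * X k c) + (1 / 2) * (\<Sum>k\<in>V. Q r k * X k b)"
      by (simp only: sum.distrib sum_distrib_left)
    also have "\<dots> = (1 / 2) * X r c - (1 / 2) * X r b" unfolding q(1) q(2)[unfolded left(8)] s by simp
    also have "\<dots> = - N r b" unfolding Nc by (simp add: field_simps)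
    finally show ?thesis using left(2,8) by (simp add: eps_def)
  next
    case (right a)
    have s: "sg a = 1" "sg c = - 1" using left_side[OF right(1), of True] right_side[OF right(1), of True] by (simp_all add: sg_def)
    have Nc: "N k c = (X k c - X k a) / 2" "N k a = (X k a + X k c) / 2" for k
      using right(2,8,9) by (simp_all add: N_def)
    have "Q r k * N k c = (1 / 2) * (Q r k * X k c) + (- 1 / 2) * (Q r k * X k a)" for k
      unfolding Nc by (simp add: field_simps)
    then have "(\<Sum>k\<in>V. Q r k * N k c) = (1 / 2) * (\<Sum>k\<in>V. Q r k * X k c) + (- 1 / 2) * (\<Sum>k\<in>V. Q r k * X k a)"
      by (simp only: sum.distrib sum_distrib_left)
    also have "\<dots> = - (1 / 2) * X r c - (1 / 2) * X r a" unfolding q(1) q(2)[unfolded right(8)] s by simp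
    also have "\<dots> = - N r a" unfolding Nc by (simp add: field_simps)
    finally show ?thesis using right(2,8) by (simp add: eps_def)
  qed
qed

lemma N_diag:
  assumes c: "c \<in> V" shows "N c c = 1"
  using c
proof (cases rule: vertex_cases)
  case (left b)
  then show ?thesis using in_slice_diag[OF slice c] in_slice_arc[OF slice left(1)] by (simp add: N_def)
next
  case (right a)
  then show ?thesis using in_slice_diag[OF slice c] in_slice_arc[OF slice right(1)] by (simp add: N_def)
qed (use in_slice_diag[OF slice c] in \<open>simp_all add: N_def\<close>)

lemma N_partner:
  assumes c: "c \<in> V" and ne: "\<tau> c \<noteq> c" shows "N (\<tau> c) c = 0"
  using c
proof (cases rule: vertex_cases)
  case (left b)
  then show ?thesis using in_slice_diag[OF slice left(3)] in_slice_arc[OF slice left(1)] by (simp add: N_def)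
next
  case (right a)
  then show ?thesis using in_slice_diag[OF slice right(3)] in_slice_arc[OF slice right(1)] by (simp add: N_def)
qed (use ne in simp_all)

text \<open>
  A left end \<open>c\<close> and a right end \<open>k\<close> of crossing arcs would violate the second inequality; there the
  tie makes the two summands of \<open>N\<close> cancel. In all other cases the order of the components suffices.
\<close>
lemma N_support:
  assumes k: "k \<in> V" and c: "c \<in> V" and ne: "k \<noteq> c" and nz: "N k c \<noteq> 0"
  shows "c < k \<and> \<tau> c < \<tau> k"
proof -
  have ne2: "k \<noteq> \<tau> c" using N_partner[OF c] ne nz by (cases "\<tau> c = c") auto
  have \<tau>c: "\<tau> c \<in> V" "\<tau> (\<tau> c) = c" using partner_in_V[OF c] partner_partner[OF c] by auto
  have "X k c \<noteq> 0 \<or> X k (\<tau> c) \<noteq> 0" using nz by (auto simp: N_def split: if_splits)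
  then have "free_entry \<gamma> k c \<or> free_entry \<gamma> k (\<tau> c)"
    using in_slice_nonzero[OF slice k c] in_slice_nonzero[OF slice k \<tau>c(1)] ne ne2 \<tau>c by auto
  then have f: "lo \<gamma> c < lo \<gamma> k" "hi \<gamma> c < hi \<gamma> k" "k \<notin> left_ends \<gamma>"
    using lo_partner[OF c] hi_partner[OF c] by (auto simp: free_entry_def)
  show ?thesis using c
  proof (cases rule: vertex_cases)
    case plus
    then show ?thesis using k f by (cases rule: vertex_cases[OF k]) simp_all
  next
    case minus
    then show ?thesis using k f by (cases rule: vertex_cases[OF k]) simp_all
  next
    case (left b)
    show ?thesis using k
    proof (cases rule: vertex_cases)
      case (right x)
      have "b < x"
      proof (rule ccontr)
        assume "\<not> b < x"
        moreover have "b \<noteq> x" using right(1) left(1) matching_not_chained by auto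
        ultimately have "X k b = - X k c"
          using slice left(1) right(1) f left right unfolding in_slice_def by auto
        then show False using nz left by (simp add: N_def)
      qed
      then show ?thesis using left right f by simp
    qed (use left f in simp_all)
  next
    case (right a)
    then show ?thesis using k f by (cases rule: vertex_cases[OF k]) simp_all
  qed
qed

text \<open>
  Solve \<open>QN\<close> for column \<open>c\<close> of \<open>Q\<close>: since \<open>N\<close> is unitriangular, only later columns occur on the
  other side, and they satisfy stronger inequalities.
\<close>
lemma Q_support:
  assumes r: "r \<in> V" and "c \<in> V" "Q r c \<noteq> 0" shows "\<tau> c \<le> r \<and> c \<le> \<tau> r"
  using assms(2,3)
proof (induction "p + q - c" arbitrary: c rule: less_induct)
  case less
  note c = less.prems(1)
  have \<tau>c: "\<tau> c \<in> V" "\<tau> (\<tau> c) = c" using partner_in_V[OF c] partner_partner[OF c] by auto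
  have "Q r c * N c c + (\<Sum>k\<in>V - {c}. Q r k * N k c) = eps c * N r (\<tau> c)"
    using QN[OF c, of r] sum.remove[OF finite_atLeastAtMost c, of "\<lambda>k. Q r k * N k c"] by simp
  then have eq: "Q r c = eps c * N r (\<tau> c) - (\<Sum>k\<in>V - {c}. Q r k * N k c)"
    using N_diag[OF c] by (simp add: algebra_simps)
  show ?case
  proof (cases "N r (\<tau> c) = 0")
    case False
    then show ?thesis using N_support[OF r \<tau>c(1)] \<tau>c by (cases "r = \<tau> c") auto
  next
    case True
    then have "(\<Sum>k\<in>V - {c}. Q r k * N k c) \<noteq> 0" using eq less.prems(2) by auto
    then obtain k where k: "k \<in> V - {c}" "Q r k * N k c \<noteq> 0" by (meson sum.neutral)
    then have s: "c < k \<and> \<tau> c < \<tau> k" using N_support[of k c] c by auto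
    moreover have "\<tau> k \<le> r \<and> k \<le> \<tau> r" using k s by (intro less.hyps) auto
    ultimately show ?thesis by auto
  qed
qed

lemma Q_partner:
  assumes r: "r \<in> V" shows "Q r (\<tau> r) = eps r"
proof -
  have \<tau>r: "\<tau> r \<in> V" "\<tau> (\<tau> r) = r" using partner_in_V[OF r] partner_partner[OF r] by auto
  have "Q r k * N k (\<tau> r) = 0" if "k \<in> V - {\<tau> r}" for k
    using N_support[of k "\<tau> r"] Q_support[OF r, of k] that \<tau>r by fastforce
  then have "(\<Sum>k\<in>V. Q r k * N k (\<tau> r)) = Q r (\<tau> r) * N (\<tau> r) (\<tau> r)"
    using sum.remove[OF finite_atLeastAtMost \<tau>r(1), of "\<lambda>k. Q r k * N k (\<tau> r)"] by (simp add: sum.neutral)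
  moreover have "eps (\<tau> r) = eps r" using \<tau>r by (auto simp: eps_def)
  ultimately show ?thesis using QN[OF \<tau>r(1), of r] N_diag[OF \<tau>r(1)] N_diag[OF r] \<tau>r by simp
qed

end

section \<open>Rank conditions in vertex coordinates\<close>

lemma card_filter_split:
  assumes "finite A" shows "card A = card {x \<in> A. P x} + card {x \<in> A. \<not> P x}"
  using card_Int_Diff[OF assms, of "Collect P"] by (simp add: Int_def set_diff_eq)

text \<open>
  These numbers are the bounds in the rank conditions for the two blocks of columns.
\<close>
definition beyond :: "bool \<Rightarrow> clan \<Rightarrow> nat \<Rightarrow> nat" where
  "beyond T \<gamma> i = card {v \<in> side T \<gamma>. i < hi \<gamma> v}"

context pq_clan
begin

lemma side_in_V: "v \<in> side T \<gamma> \<Longrightarrow> v \<in> V"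
  using side_subset by (rule subsetD)

lemma beyond_plus_count: "p - plus_count \<gamma> i = beyond True \<gamma> i"
proof -
  let ?S = "{(s, t) \<in> m. s \<le> i \<and> t \<le> i}" and ?P = "{k \<in> plus_signs \<gamma>. k \<le> i}"
  have "inj_on fst ?S"
  proof (rule inj_onI)
    fix x y assume "x \<in> ?S" "y \<in> ?S" "fst x = fst y"
    then show "x = y" using matching_left_unique by (cases x; cases y) simp
  qed
  then have c: "card (fst ` ?S) = card ?S" by (rule card_image)
  have fin: "finite ?S" "finite ?P"
    by (rule finite_subset[OF _ finite_matchings], fast) (rule finite_subset[OF _ finite_parts(1)], fast)
  have "{v \<in> side True \<gamma>. \<not> i < hi \<gamma> v} = fst ` ?S \<union> ?P"
  proof (intro equalityI subsetI)
    fix v assume v: "v \<in> {v \<in> side True \<gamma>. \<not> i < hi \<gamma> v}"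
    then have "v \<in> V" using side_in_V by blast
    then show "v \<in> fst ` ?S \<union> ?P"
    proof (cases rule: vertex_cases)
      case (left b)
      then have "(v, b) \<in> ?S" using v by simp
      then have "fst (v, b) \<in> fst ` ?S" by (rule imageI)
      then show ?thesis by simp
    qed (use v in \<open>simp_all add: side_def\<close>)
  next
    fix v assume "v \<in> fst ` ?S \<union> ?P"
    then consider b where "(v, b) \<in> m" "b \<le> i" "v \<le> i" | "v \<in> plus_signs \<gamma>" "v \<le> i" by auto
    then show "v \<in> {v \<in> side True \<gamma>. \<not> i < hi \<gamma> v}"
    proof cases
      case (1 b)
      then show ?thesis using left_side[OF 1(1), of True] partner_left[OF 1(1)] by (simp add: hi_def)
    next
      case 2
      then show ?thesis using partner_sign[of v] by (simp add: side_def hi_def)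
    qed
  qed
  moreover have "fst ` ?S \<inter> ?P = {}"
  proof (rule equals0I)
    fix v assume "v \<in> fst ` ?S \<inter> ?P"
    then obtain b where "(v, b) \<in> m" "v \<in> plus_signs \<gamma>" by auto
    then show False using left_notin by simp
  qed
  ultimately have "card {v \<in> side True \<gamma>. \<not> i < hi \<gamma> v} = plus_count \<gamma> i"
    unfolding plus_count_def using fin by (simp add: card_Un_disjoint c)
  moreover note card_filter_split[OF finite_side[of True], of "\<lambda>v. i < hi \<gamma> v"]
  ultimately show ?thesis using card_side[of True] by (simp add: beyond_def)
qed

lemma beyond_minus_count: "q - minus_count \<gamma> i = beyond False \<gamma> i"
proof -
  let ?S = "{(s, t) \<in> m. s \<le> i \<and> t \<le> i}" and ?P = "{k \<in> minus_signs \<gamma>. k \<le> i}"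
  have "inj_on snd ?S"
  proof (rule inj_onI)
    fix x y assume "x \<in> ?S" "y \<in> ?S" "snd x = snd y"
    then show "x = y" using matching_right_unique by (cases x; cases y) simp
  qed
  then have c: "card (snd ` ?S) = card ?S" by (rule card_image)
  have fin: "finite ?S" "finite ?P"
    by (rule finite_subset[OF _ finite_matchings], fast) (rule finite_subset[OF _ finite_parts(2)], fast)
  have "{v \<in> side False \<gamma>. \<not> i < hi \<gamma> v} = snd ` ?S \<union> ?P"
  proof (intro equalityI subsetI)
    fix v assume v: "v \<in> {v \<in> side False \<gamma>. \<not> i < hi \<gamma> v}"
    then have "v \<in> V" using side_in_V by blast
    then show "v \<in> snd ` ?S \<union> ?P"
    proof (cases rule: vertex_cases)
      case (right b)
      then have "(b, v) \<in> ?S" using v by simp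
      then have "snd (b, v) \<in> snd ` ?S" by (rule imageI)
      then show ?thesis by simp
    qed (use v in \<open>simp_all add: side_def\<close>)
  next
    fix v assume "v \<in> snd ` ?S \<union> ?P"
    then consider b where "(b, v) \<in> m" "b \<le> i" "v \<le> i" | "v \<in> minus_signs \<gamma>" "v \<le> i" by auto
    then show "v \<in> {v \<in> side False \<gamma>. \<not> i < hi \<gamma> v}"
    proof cases
      case (1 b)
      then show ?thesis using right_side[OF 1(1), of False] partner_right[OF 1(1)] by (simp add: hi_def)
    next
      case 2
      then show ?thesis using partner_sign[of v] by (simp add: side_def hi_def)
    qed
  qed
  moreover have "snd ` ?S \<inter> ?P = {}"
  proof (rule equals0I)
    fix v assume "v \<in> snd ` ?S \<inter> ?P"
    then obtain b where "(b, v) \<in> m" "v \<in> minus_signs \<gamma>" by auto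
    then show False using right_notin by simp
  qed
  ultimately have "card {v \<in> side False \<gamma>. \<not> i < hi \<gamma> v} = minus_count \<gamma> i"
    unfolding minus_count_def using fin by (simp add: card_Un_disjoint c)
  moreover note card_filter_split[OF finite_side[of False], of "\<lambda>v. i < hi \<gamma> v"]
  ultimately show ?thesis using card_side[of False] by (simp add: beyond_def)
qed

lemma crossing_count_vertices:
  assumes "i \<le> j" shows "crossing_count \<gamma> i j = card {c \<in> V. c \<le> i \<and> j < \<tau> c}"
proof -
  have "inj_on fst {(s, t) \<in> m. s \<le> i \<and> j < t}"
  proof (rule inj_onI)
    fix x y assume "x \<in> {(s, t) \<in> m. s \<le> i \<and> j < t}" "y \<in> {(s, t) \<in> m. s \<le> i \<and> j < t}" "fst x = fst y"
    then show "x = y" using matching_left_unique by (cases x; cases y) simp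
  qed
  then have "card (fst ` {(s, t) \<in> m. s \<le> i \<and> j < t}) = crossing_count \<gamma> i j"
    unfolding crossing_count_def by (rule card_image)
  moreover have "fst ` {(s, t) \<in> m. s \<le> i \<and> j < t} = {c \<in> V. c \<le> i \<and> j < \<tau> c}"
  proof (intro equalityI subsetI)
    fix c assume "c \<in> fst ` {(s, t) \<in> m. s \<le> i \<and> j < t}"
    then obtain t where t: "(c, t) \<in> m" "c \<le> i" "j < t" by auto
    then show "c \<in> {c \<in> V. c \<le> i \<and> j < \<tau> c}" using matching_in_V[OF t(1)] partner_left[OF t(1)] by simp
  next
    fix c assume c: "c \<in> {c \<in> V. c \<le> i \<and> j < \<tau> c}"
    then have "c \<in> V" by simp
    then show "c \<in> fst ` {(s, t) \<in> m. s \<le> i \<and> j < t}"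
    proof (cases rule: vertex_cases)
      case (left b)
      then show ?thesis using c by (intro image_eqI[of _ _ "(c, b)"]) auto
    qed (use c assms in auto)
  qed
  ultimately show ?thesis by simp
qed

text \<open>
  Both sides count the vertices whose component ends after \<open>i\<close>: all vertices after \<open>i\<close>, and the left
  ends of the arcs over the gap after \<open>i\<close>.
\<close>
lemma beyond_sum:
  assumes "i \<le> p + q"
  shows "beyond True \<gamma> i + beyond False \<gamma> i = p + q - i + crossing_count \<gamma> i i"
proof -
  have "beyond True \<gamma> i + beyond False \<gamma> i = card ({v \<in> side True \<gamma>. i < hi \<gamma> v} \<union> {v \<in> side False \<gamma>. i < hi \<gamma> v})"
    unfolding beyond_def using finite_side side_disjoint[of _ True] by (subst card_Un_disjoint) auto
  also have "{v \<in> side True \<gamma>. i < hi \<gamma> v} \<union> {v \<in> side False \<gamma>. i < hi \<gamma> v} = {v \<in> V. i < hi \<gamma> v}"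
    using side_cover by auto
  also have "\<dots> = {i<..p + q} \<union> {c \<in> V. c \<le> i \<and> i < \<tau> c}"
    unfolding hi_def by auto
  also have "card \<dots> = card {i<..p + q} + card {c \<in> V. c \<le> i \<and> i < \<tau> c}"
    by (rule card_Un_disjoint) auto
  also have "\<dots> = p + q - i + crossing_count \<gamma> i i" using crossing_count_vertices[of i i] by simp
  finally show ?thesis .
qed

end

text \<open>
  In contrast to the definition of the variety, \<open>i = 0\<close> and \<open>i = j\<close> are admitted. Two different
  positions of a big clan may have the same embedded vertices to their left, so this closure is
  needed to compare the conditions for two clans.
\<close>
definition rank_conds :: "nat \<Rightarrow> clan \<Rightarrow> clan \<Rightarrow> (nat \<Rightarrow> nat \<Rightarrow> complex) \<Rightarrow> (nat \<Rightarrow> nat \<Rightarrow> complex) \<Rightarrow> bool" where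
  "rank_conds n \<theta> \<gamma> X Q \<longleftrightarrow>
     (\<forall>T. \<forall>i\<le>n. rank_at_most {i<..n} (side T \<gamma>) X (beyond T \<theta> i)) \<and>
     (\<forall>i j. i \<le> j \<longrightarrow> j \<le> n \<longrightarrow> rank_at_most {j<..n} {1..i} Q (crossing_count \<theta> i j))"

context slice_point
begin

text \<open>
  The projections onto the spans of the columns on one side.
\<close>
definition P :: "bool \<Rightarrow> nat \<Rightarrow> nat \<Rightarrow> complex" where
  "P T u c = (\<Sum>v\<in>V. if v \<in> side T \<gamma> then X u v * G v c else 0)"

lemma P_Q:
  assumes "u \<in> V" "c \<in> V"
  shows "P True u c + P False u c = (if u = c then 1 else 0)" "P True u c - P False u c = Q u c"
proof -
  have "P True u c + P False u c = (\<Sum>v\<in>V. X u v * G v c)"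
    unfolding P_def sum.distrib[symmetric] using side_other[of _ True] by (intro sum.cong) auto
  then show "P True u c + P False u c = (if u = c then 1 else 0)" using XG assms by simp
  show "P True u c - P False u c = Q u c"
    unfolding P_def Q_def sum_subtractf[symmetric] sg_def using side_other[of _ True] by (intro sum.cong) auto
qed

text \<open>
  Put the two blocks of columns of \<open>X\<close> below each other, as a block diagonal matrix, and multiply by
  the inverse of \<open>X\<close>: the result consists of the two projections, restricted to the rows after \<open>i\<close>.
  They add up to the identity, so the columns after \<open>i\<close> are independent even together with any
  columns up to \<open>i\<close> that are independent for the difference \<open>Q\<close>.
\<close>
lemma diagonal_block_rank:
  assumes i: "i \<le> p + q" and R: "\<And>T. rank_at_most {i<..p + q} (side T \<gamma>) X (k T)"
    and sum: "k True + k False = p + q - i + l"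
  shows "rank_at_most {i<..p + q} {1..i} Q l"
proof -
  define Y :: "bool \<times> nat \<Rightarrow> nat \<Rightarrow> complex" where
    "Y = (\<lambda>(T, u) v. if v \<in> side T \<gamma> then X u v else 0)"
  let ?R = "UNIV \<times> {i<..p + q} :: (bool \<times> nat) set"
  have "rank_at_most ?R V Y (p + q - i + l)"
    unfolding rank_at_most_def
  proof (intro allI impI)
    fix D assume D: "D \<subseteq> V" and ind: "indep_cols ?R Y D"
    have fD: "finite D" using D finite_subset by blast
    have le: "card (D \<inter> side T \<gamma>) \<le> k T" for T
    proof (rule rank_at_mostD[OF R])
      show "indep_cols {i<..p + q} X (D \<inter> side T \<gamma>)"
      proof (rule indep_colsI)
        fix a d assume z: "\<And>u. u \<in> {i<..p + q} \<Longrightarrow> (\<Sum>d\<in>D \<inter> side T \<gamma>. a d * X u d) = 0" and d: "d \<in> D \<inter> side T \<gamma>"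
        have "(\<Sum>d\<in>D. (if d \<in> side T \<gamma> then a d else 0) * Y x d) = 0" if x: "x \<in> ?R" for x
        proof -
          obtain S u where su: "x = (S, u)" "u \<in> {i<..p + q}" using x by auto
          show ?thesis
          proof (cases "S = T")
            case True
            have "(\<Sum>d\<in>D. (if d \<in> side T \<gamma> then a d else 0) * Y x d) = (\<Sum>d\<in>D \<inter> side T \<gamma>. a d * X u d)"
              using fD su True by (intro sum.mono_neutral_cong_right) (auto simp: Y_def)
            then show ?thesis using z su by simp
          next
            case False
            have "(if d \<in> side T \<gamma> then a d else 0) * Y x d = 0" for d
              using side_disjoint[of d T] False su by (cases S; cases T) (auto simp: Y_def)
            then show ?thesis by (simp add: sum.neutral)
          qed
        qed
        from indep_colsD[OF ind this, of d] show "a d = 0" using d by auto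
      qed
    qed auto
    have "card D = card (D \<inter> side True \<gamma>) + card (D - side True \<gamma>)" by (rule card_Int_Diff[OF fD])
    also have "D - side True \<gamma> = D \<inter> side False \<gamma>" using D side_other[of _ True] side_disjoint[of _ True] by auto
    finally show "card D \<le> p + q - i + l" using le[of True] le[of False] sum by linarith
  qed
  then have "rank_at_most ?R V (\<lambda>x c. \<Sum>v\<in>V. Y x v * G v c) (p + q - i + l)"
    by (rule rank_at_most_col_ops[OF _ _ _ refl, rotated 2]) auto
  moreover have YP: "(\<Sum>v\<in>V. Y (T, u) v * G v c) = P T u c" for T u c
    unfolding P_def Y_def by (intro sum.cong) auto
  ultimately have rk: "rank_at_most ?R V (\<lambda>x c. P (fst x) (snd x) c) (p + q - i + l)"
    by (simp add: split_beta Y_def P_def if_distrib[of "\<lambda>x. x * _"] cong: if_cong)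
  show ?thesis
    unfolding rank_at_most_def
  proof (intro allI impI)
    fix D assume D: "D \<subseteq> {1..i}" and ind: "indep_cols {i<..p + q} Q D"
    have fD: "finite D" using D finite_subset by blast
    have dis: "D \<inter> {i<..p + q} = {}" using D by auto
    have "indep_cols ?R (\<lambda>x c. P (fst x) (snd x) c) (D \<union> {i<..p + q})"
    proof (rule indep_colsI)
      fix a d assume z: "\<And>x. x \<in> ?R \<Longrightarrow> (\<Sum>d\<in>D \<union> {i<..p + q}. a d * P (fst x) (snd x) d) = 0"
        and d: "d \<in> D \<union> {i<..p + q}"
      have sub: "D \<union> {i<..p + q} \<subseteq> V" using D i by auto
      have zT: "(\<Sum>d\<in>D \<union> {i<..p + q}. a d * P T u d) = 0" if "u \<in> {i<..p + q}" for T u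
        using z[of "(T, u)"] that by simp
      \<comment> \<open>The sum of the two projections reads off the coefficients of the columns after \<open>i\<close>.\<close>
      have a0: "a u = 0" if u: "u \<in> {i<..p + q}" for u
      proof -
        have "(\<Sum>d\<in>D \<union> {i<..p + q}. a d * P True u d) + (\<Sum>d\<in>D \<union> {i<..p + q}. a d * P False u d)
            = (\<Sum>d\<in>D \<union> {i<..p + q}. if d = u then a d else 0)"
          unfolding sum.distrib[symmetric] distrib_left[symmetric]
          using P_Q(1)[of u] sub u by (intro sum.cong) auto
        also have "\<dots> = a u" using u fD by simp
        finally show ?thesis using zT[OF u] by simp
      qed
      \<comment> \<open>The difference of the two projections is then a relation between the columns of \<open>Q\<close> in \<open>D\<close>.\<close>
      have "(\<Sum>d\<in>D. a d * Q u d) = 0" if u: "u \<in> {i<..p + q}" for u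
      proof -
        have "0 = (\<Sum>d\<in>D \<union> {i<..p + q}. a d * P True u d) - (\<Sum>d\<in>D \<union> {i<..p + q}. a d * P False u d)"
          using zT[OF u] by simp
        also have "\<dots> = (\<Sum>d\<in>D \<union> {i<..p + q}. a d * Q u d)"
          unfolding sum_subtractf[symmetric] right_diff_distrib[symmetric]
          using P_Q(2)[of u] sub u by (intro sum.cong) auto
        also have "\<dots> = (\<Sum>d\<in>D. a d * Q u d)"
          using fD a0 dis by (simp add: sum.union_disjoint sum.neutral)
        finally show ?thesis by simp
      qed
      from indep_colsD[OF ind this] show "a d = 0" using a0 d by auto
    qed
    then have "card (D \<union> {i<..p + q}) \<le> p + q - i + l" using D i by (intro rank_at_mostD[OF rk]) auto
    then show "card D \<le> l" using fD dis by (simp add: card_Un_disjoint)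
  qed
qed

end

context pq_clan
begin

lemma southwest_rank_iff:
  assumes i: "i \<le> p + q"
  shows "vec_space.rank (p + q - i) (southwest p q i A) \<le> k \<longleftrightarrow>
    rank_at_most {i<..p + q} (side True \<gamma>) (by_vertices p \<gamma> A) k"
proof -
  have "rank_at_most {i<..p + q} (side True \<gamma>) (by_vertices p \<gamma> A) k \<longleftrightarrow>
      rank_at_most {..<p + q - i} {..<p} (\<lambda>r c. A $$ (i + r, c)) k"
  proof (rule rank_at_most_reindex)
    have "bij_betw (\<lambda>c. c - 1) {1..p} {..<p}" by (rule bij_betwI[where g=Suc]) auto
    from bij_betw_trans[OF perm_bij_side[of True, unfolded if_True] this]
    show "bij_betw (\<lambda>v. w v - 1) (side True \<gamma>) {..<p}" by (simp add: comp_def)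
    show "(\<lambda>u. u - i - 1) ` {i<..p + q} = {..<p + q - i}"
    proof (intro equalityI subsetI)
      fix r assume "r \<in> {..<p + q - i}"
      then show "r \<in> (\<lambda>u. u - i - 1) ` {i<..p + q}" by (intro image_eqI[of _ _ "r + i + 1"]) auto
    qed auto
    fix u d assume "u \<in> {i<..p + q}"
    then have "i + (u - i - 1) = u - 1" by simp
    then show "by_vertices p \<gamma> A u d = A $$ (i + (u - i - 1), w d - 1)" by (simp only: by_vertices_def)
  qed
  then show ?thesis unfolding southwest_def mat_rank_le_iff by simp
qed

lemma southeast_rank_iff:
  assumes i: "i \<le> p + q"
  shows "vec_space.rank (p + q - i) (southeast p q i A) \<le> k \<longleftrightarrow>
    rank_at_most {i<..p + q} (side False \<gamma>) (by_vertices p \<gamma> A) k"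
proof -
  have b: "bij_betw w (side False \<gamma>) {p + 1..p + q}" using perm_bij_side[of False] by simp
  have "rank_at_most {i<..p + q} (side False \<gamma>) (by_vertices p \<gamma> A) k \<longleftrightarrow>
      rank_at_most {..<p + q - i} {..<q} (\<lambda>r c. A $$ (i + r, p + c)) k"
  proof (rule rank_at_most_reindex)
    have "bij_betw (\<lambda>c. c - p - 1) {p + 1..p + q} {..<q}" by (rule bij_betwI[where g="\<lambda>c. c + p + 1"]) auto
    from bij_betw_trans[OF b this]
    show "bij_betw (\<lambda>v. w v - p - 1) (side False \<gamma>) {..<q}" by (simp add: comp_def)
    show "(\<lambda>u. u - i - 1) ` {i<..p + q} = {..<p + q - i}"
    proof (intro equalityI subsetI)
      fix r assume "r \<in> {..<p + q - i}"
      then show "r \<in> (\<lambda>u. u - i - 1) ` {i<..p + q}" by (intro image_eqI[of _ _ "r + i + 1"]) auto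
    qed auto
    fix u d assume "u \<in> {i<..p + q}" and d: "d \<in> side False \<gamma>"
    then have "i + (u - i - 1) = u - 1" by simp
    moreover have "w d \<in> {p + 1..p + q}" using bij_betwE[OF b] d by simp
    then have "p + (w d - p - 1) = w d - 1" by simp
    ultimately show "by_vertices p \<gamma> A u d = A $$ (i + (u - i - 1), p + (w d - p - 1))" by (simp only: by_vertices_def)
  qed
  then show ?thesis unfolding southeast_def mat_rank_le_iff by simp
qed

end

context slice_point
begin

lemma G_X_apply: "v \<in> V \<Longrightarrow> (\<Sum>u\<in>V. G v u * (\<Sum>k\<in>V. X u k * h k)) = h v"
proof -
  assume v: "v \<in> V"
  have "(\<Sum>u\<in>V. G v u * (\<Sum>k\<in>V. X u k * h k)) = (\<Sum>k\<in>V. (\<Sum>u\<in>V. G v u * X u k) * h k)"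
    unfolding sum_distrib_left sum_distrib_right by (subst sum.swap) (simp add: mult_ac)
  also have "\<dots> = (\<Sum>k\<in>V. if k = v then h k else 0)" using GX v by (intro sum.cong) simp_all
  also have "\<dots> = h v" using v by simp
  finally show ?thesis .
qed

text \<open>
  Multiplication by \<open>X\<close> turns the second half of the columns into unit vectors and the first half
  into columns of the projection.
\<close>
lemma bracket_rank_iff:
  assumes ij: "i \<le> j" "j \<le> p + q"
  defines "Y \<equiv> \<lambda>v. case_sum (\<lambda>c. if v \<in> side True \<gamma> then G v c else 0) (G v)"
  shows "rank_at_most V ({1..i} <+> {1..j}) Y (j + k) \<longleftrightarrow> rank_at_most {j<..p + q} {1..i} (P True) k"
proof -
  define Z where "Z u = case_sum (P True u) (\<lambda>x. if u = x then 1 else 0)" for u :: nat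
  have ZY: "Z u d = (\<Sum>v\<in>V. X u v * Y v d)" if u: "u \<in> V" and d: "d \<in> {1..i} <+> {1..j}" for u d
  proof (cases d)
    case (Inl c)
    then show ?thesis by (simp add: Z_def Y_def P_def if_distrib[of "\<lambda>x. X u _ * x"] cong: if_cong)
  next
    case (Inr x)
    then have "x \<in> V" using d ij by auto
    then show ?thesis using XG[OF u, of x] Inr by (simp add: Z_def Y_def)
  qed
  have YZ: "Y v d = (\<Sum>u\<in>V. G v u * Z u d)" if v: "v \<in> V" and d: "d \<in> {1..i} <+> {1..j}" for v d
  proof -
    have "(\<Sum>u\<in>V. G v u * Z u d) = (\<Sum>u\<in>V. G v u * (\<Sum>k\<in>V. X u k * Y k d))"
      using ZY d by (intro sum.cong) simp_all
    also have "\<dots> = Y v d" by (rule G_X_apply[OF v])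
    finally show ?thesis by simp
  qed
  have "indep_cols V Y D \<longleftrightarrow> indep_cols V Z D" if D: "D \<subseteq> {1..i} <+> {1..j}" for D
  proof
    assume a: "indep_cols V Y D"
    show "indep_cols V Z D"
      by (rule indep_cols_left_mult[OF finite_atLeastAtMost a, where h=G]) (use YZ D in blast)
  next
    assume a: "indep_cols V Z D"
    show "indep_cols V Y D"
      by (rule indep_cols_left_mult[OF finite_atLeastAtMost a, where h=X]) (use ZY D in blast)
  qed
  then have "rank_at_most V ({1..i} <+> {1..j}) Y (j + k) \<longleftrightarrow> rank_at_most V ({1..i} <+> {1..j}) Z (j + k)"
    unfolding rank_at_most_def by simp
  also have "\<dots> \<longleftrightarrow> rank_at_most {j<..p + q} {1..i} (P True) k"
    using rank_at_most_append_units[OF ij(2), of "{1..i}" "P True" k] unfolding Z_def by simp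
  finally show ?thesis .
qed

text \<open>
  Off the diagonal the involution is twice the projection.
\<close>
lemma P_block_iff_Q_block:
  assumes ij: "i \<le> j" "j \<le> p + q"
  shows "rank_at_most {j<..p + q} {1..i} (P True) k \<longleftrightarrow> rank_at_most {j<..p + q} {1..i} Q k"
proof -
  have "rank_at_most {j<..p + q} {1..i} (P True) k \<longleftrightarrow> rank_at_most {j<..p + q} {1..i} (\<lambda>u c. (1 / 2) * Q u c) k"
  proof (rule rank_at_most_cong)
    fix u c assume u: "u \<in> {j<..p + q}" and c: "c \<in> {1..i}"
    have V: "u \<in> V" "c \<in> V" and ne: "u \<noteq> c" using u c ij by auto
    have "P True u c + P False u c = 0" "P True u c - P False u c = Q u c" using P_Q[OF V] ne by simp_all
    then have "2 * P True u c = Q u c" by (simp add: algebra_simps eq_neg_iff_add_eq_0)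
    from arg_cong[OF this, of "\<lambda>z. (1 / 2) * z"] show "P True u c = (1 / 2) * Q u c" by simp
  qed
  also have "\<dots> \<longleftrightarrow> rank_at_most {j<..p + q} {1..i} Q k" by (rule rank_at_most_scale) simp
  finally show ?thesis .
qed

end

context pq_clan
begin

definition involution :: "complex mat \<Rightarrow> nat \<Rightarrow> nat \<Rightarrow> complex" where
  "involution A = slice_point.Q p q \<gamma> (by_vertices p \<gamma> A) (inverse_by_vertices A)"

lemma slice_point_of:
  assumes A: "A \<in> slice p q \<gamma>" shows "slice_point p q \<gamma> (by_vertices p \<gamma> A) (inverse_by_vertices A)"
proof unfold_locales
  show "in_slice (p + q) \<gamma> (by_vertices p \<gamma> A)" using A slice_iff by simp
qed (use inverse_by_vertices[OF A] in simp_all)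

lemma bracket_matrix_rank_iff:
  assumes A: "A \<in> slice p q \<gamma>" and ij: "i \<le> j" "j \<le> p + q"
  shows "vec_space.rank (p + q) (bracket_matrix p q i j A) \<le> j + k \<longleftrightarrow>
    rank_at_most {j<..p + q} {1..i} (involution A) k"
proof -
  let ?G = "inverse_by_vertices A"
  interpret S: slice_point p q \<gamma> "by_vertices p \<gamma> A" ?G by (rule slice_point_of[OF A])
  define Y0 where "Y0 r c = (if c < i then (if r < p then inverse_mat A $$ (r, c) else 0) else inverse_mat A $$ (r, c - i))"
    for r c
  let ?Y = "\<lambda>v. case_sum (\<lambda>c. if v \<in> side True \<gamma> then ?G v c else 0) (?G v)"
  have "rank_at_most V ({1..i} <+> {1..j}) ?Y (j + k) \<longleftrightarrow> rank_at_most {..<p + q} {..<i + j} Y0 (j + k)"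
  proof (rule rank_at_most_reindex)
    show "bij_betw (case_sum (\<lambda>c. c - 1) (\<lambda>x. i + (x - 1))) ({1..i} <+> {1..j}) {..<i + j}"
      by (rule bij_betwI[where g="\<lambda>c. if c < i then Inl (c + 1) else Inr (c - i + 1)"]) (auto split: sum.splits)
    show "(\<lambda>v. w v - 1) ` V = {..<p + q}" by (rule bij_betw_imp_surj_on[OF perm_index_bij])
    fix v d assume v: "v \<in> V" and d: "d \<in> {1..i} <+> {1..j}"
    have wp: "w v - 1 < p \<longleftrightarrow> v \<in> side True \<gamma>" using perm_side[OF v] perm_in_V[OF v] by auto
    show "?Y v d = Y0 (w v - 1) (case_sum (\<lambda>c. c - 1) (\<lambda>x. i + (x - 1)) d)"
    proof (cases d)
      case (Inl c)
      then have "c - 1 < i" using d by auto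
      then show ?thesis using Inl wp by (simp add: Y0_def inverse_by_vertices_def)
    next
      case (Inr x)
      then show ?thesis by (simp add: Y0_def inverse_by_vertices_def)
    qed
  qed
  moreover have "vec_space.rank (p + q) (bracket_matrix p q i j A) \<le> j + k \<longleftrightarrow>
      rank_at_most {..<p + q} {..<i + j} Y0 (j + k)"
    unfolding bracket_matrix_def mat_rank_le_iff[symmetric] Y0_def by simp
  ultimately show ?thesis
    using S.bracket_rank_iff[OF ij, of k] S.P_block_iff_Q_block[OF ij, of k] unfolding involution_def by simp
qed

lemma beyond_zero: "beyond T \<gamma> 0 = (if T then p else q)"
proof -
  have "0 < hi \<gamma> v" if "v \<in> side T \<gamma>" for v using side_in_V[OF that] hi_ge[of v] by (simp add: Suc_le_eq)
  then have "{v \<in> side T \<gamma>. 0 < hi \<gamma> v} = side T \<gamma>" by auto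
  then show ?thesis using card_side by (simp add: beyond_def)
qed

text \<open>
  The conditions at \<open>i = 0\<close> hold for trivial reasons, those on the diagonal \<open>i = j\<close> by
  \<open>diagonal_block_rank\<close>.
\<close>
lemma mars_springer_iff:
  assumes \<theta>: "\<theta> \<in> Clans p q"
  shows "A \<in> mars_springer p q \<theta> \<gamma> \<longleftrightarrow>
    A \<in> slice p q \<gamma> \<and> rank_conds (p + q) \<theta> \<gamma> (by_vertices p \<gamma> A) (involution A)"
proof -
  interpret \<theta>: pq_clan p q \<theta> by unfold_locales (rule \<theta>)
  let ?n = "p + q" let ?X = "by_vertices p \<gamma> A"
  have SW: "vec_space.rank (?n - i) (southwest p q i A) \<le> p - plus_count \<theta> i \<longleftrightarrow>
      rank_at_most {i<..?n} (side True \<gamma>) ?X (beyond True \<theta> i)" if "i \<le> ?n" for i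
    unfolding southwest_rank_iff[OF that] \<theta>.beyond_plus_count ..
  have SE: "vec_space.rank (?n - i) (southeast p q i A) \<le> q - minus_count \<theta> i \<longleftrightarrow>
      rank_at_most {i<..?n} (side False \<gamma>) ?X (beyond False \<theta> i)" if "i \<le> ?n" for i
    unfolding southeast_rank_iff[OF that] \<theta>.beyond_minus_count ..
  show ?thesis
  proof (cases "A \<in> slice p q \<gamma>")
    case True
    interpret S: slice_point p q \<gamma> ?X "inverse_by_vertices A" by (rule slice_point_of[OF True])
    note B = bracket_matrix_rank_iff[OF True]
    show ?thesis
    proof
      assume L: "A \<in> mars_springer p q \<theta> \<gamma>"
      have R: "rank_at_most {i<..?n} (side T \<gamma>) ?X (beyond T \<theta> i)" if i: "i \<le> ?n" for T i
      proof (cases "i = 0")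
        case True
        then show ?thesis using \<theta>.beyond_zero[of T] card_side[of T] by (intro rank_at_most_card[OF finite_side]) simp
      next
        case False
        then show ?thesis using L i SW[OF i] SE[OF i] unfolding mars_springer_def by (cases T) simp_all
      qed
      moreover have "rank_at_most {j<..?n} {1..i} (involution A) (crossing_count \<theta> i j)" if ij: "i \<le> j" "j \<le> ?n" for i j
      proof -
        consider "i = 0" | "i = j" | "1 \<le> i" "i < j" using ij by linarith
        then show ?thesis
        proof cases
          case 1
          then show ?thesis by (simp add: rank_at_most_empty_cols)
        next
          case 2
          then show ?thesis
            using S.diagonal_block_rank[OF ij(2) R[OF ij(2)] \<theta>.beyond_sum[OF ij(2)]] unfolding involution_def by simp
        next
          case 3
          from L have "\<forall>i j. 1 \<le> i \<and> i < j \<and> j \<le> ?n \<longrightarrow>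
              vec_space.rank ?n (bracket_matrix p q i j A) \<le> j + crossing_count \<theta> i j"
            unfolding mars_springer_def by simp
          from this[rule_format, of i j] show ?thesis using 3 ij B[OF ij, of "crossing_count \<theta> i j"] by simp
        qed
      qed
      ultimately show "A \<in> slice p q \<gamma> \<and> rank_conds ?n \<theta> \<gamma> ?X (involution A)"
        using True unfolding rank_conds_def by simp
    next
      assume R: "A \<in> slice p q \<gamma> \<and> rank_conds ?n \<theta> \<gamma> ?X (involution A)"
      then have R1: "rank_at_most {i<..?n} (side T \<gamma>) ?X (beyond T \<theta> i)" if "i \<le> ?n" for T i
        using that unfolding rank_conds_def by simp
      have R3: "rank_at_most {j<..?n} {1..i} (involution A) (crossing_count \<theta> i j)" if "i \<le> j" "j \<le> ?n" for i j
        using R that unfolding rank_conds_def by simp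
      show "A \<in> mars_springer p q \<theta> \<gamma>"
        unfolding mars_springer_def
      proof (intro CollectI conjI ballI allI impI)
        fix i assume "i \<in> {1..?n}"
        then have i: "i \<le> ?n" by simp
        show "vec_space.rank (?n - i) (southwest p q i A) \<le> p - plus_count \<theta> i" using SW[OF i] R1[OF i, of True] by simp
        show "vec_space.rank (?n - i) (southeast p q i A) \<le> q - minus_count \<theta> i" using SE[OF i] R1[OF i, of False] by simp
      next
        fix i j assume "1 \<le> i \<and> i < j \<and> j \<le> ?n"
        then have ij: "i \<le> j" "j \<le> ?n" by simp_all
        show "vec_space.rank ?n (bracket_matrix p q i j A) \<le> j + crossing_count \<theta> i j" using B[OF ij] R3[OF ij] by simp
      qed (rule True)
    qed
  next
    case False
    then show ?thesis unfolding mars_springer_def by simp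
  qed
qed

end

section \<open>Lower bounds for the ranks, and what equality forces\<close>

context slice_point
begin

abbreviation "row_of i d \<equiv> (if i < lo \<gamma> d then lo \<gamma> d else hi \<gamma> d)"

lemma lo_hi_component: "d \<in> V \<Longrightarrow> r = lo \<gamma> d \<or> r = hi \<gamma> d \<Longrightarrow> r \<in> V \<and> lo \<gamma> r = lo \<gamma> d \<and> hi \<gamma> r = hi \<gamma> d \<and> X r d \<noteq> 0"
proof -
  assume d: "d \<in> V" and r: "r = lo \<gamma> d \<or> r = hi \<gamma> d"
  show ?thesis using d
  proof (cases rule: vertex_cases)
    case (left b)
    then show ?thesis using r d in_slice_diag[OF slice d] in_slice_arc[OF slice left(1)]
        lo_partner[OF d] hi_partner[OF d] by auto
  next
    case (right a)
    then show ?thesis using r d in_slice_diag[OF slice d] in_slice_arc[OF slice right(1)]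
        lo_partner[OF d] hi_partner[OF d] by auto
  qed (use r d in_slice_diag[OF slice d] in auto)
qed

text \<open>
  A free entry in a row of the component of \<open>d\<close> lies in the column of a component that starts earlier,
  and within one block of columns a pivot row has no free entries.
\<close>
lemma component_row_entry:
  assumes d: "d \<in> side T \<gamma>" and e: "e \<in> side T \<gamma>" and ne: "d \<noteq> e" and r: "r = lo \<gamma> d \<or> r = hi \<gamma> d" and nz: "X r e \<noteq> 0"
  shows "lo \<gamma> e < lo \<gamma> d" "r \<noteq> lo \<gamma> d"
proof -
  have V: "d \<in> V" "e \<in> V" using d e side_in_V by auto
  have rc: "r \<in> V" "lo \<gamma> r = lo \<gamma> d" using lo_hi_component[OF V(1) r] by auto
  have "lo \<gamma> d \<noteq> lo \<gamma> e" using lo_inj_on_side[OF d e] ne by auto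
  then have "r \<noteq> e" "r \<noteq> \<tau> e" using rc lo_partner[OF V(2)] by auto
  then have f: "free_entry \<gamma> r e" using in_slice_nonzero[OF slice rc(1) V(2) nz] by simp
  then show "lo \<gamma> e < lo \<gamma> d" using rc free_entryD[OF f] by simp
  show "r \<noteq> lo \<gamma> d"
  proof
    assume rl: "r = lo \<gamma> d"
    show False using V(1)
    proof (cases rule: vertex_cases)
      case plus
      then show False using f rl d e by (cases T) (simp_all add: free_entry_def side_def)
    next
      case minus
      then show False using f rl d e by (cases T) (simp_all add: free_entry_def side_def)
    next
      case (left b)
      then show False using f rl by (simp add: free_entry_def)
    next
      case (right a)
      then show False using f rl left_endsI[OF right(1)] by (simp add: free_entry_def)
    qed
  qed
qed

text \<open>
  For a component that starts after \<open>i\<close> use its pivot row, for a component over the gap after \<open>i\<close>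
  the row of its right end.
\<close>
lemma beyond_system:
  fixes i T defines "D \<equiv> {v \<in> side T \<gamma>. i < hi \<gamma> v}"
  shows "finite D" "D \<subseteq> side T \<gamma>" "\<And>d. d \<in> D \<Longrightarrow> row_of i d \<in> {i<..p + q}" "\<And>d. d \<in> D \<Longrightarrow> X (row_of i d) d \<noteq> 0"
    "\<And>d e. d \<in> D \<Longrightarrow> e \<in> D \<Longrightarrow> d \<noteq> e \<Longrightarrow> X (row_of i d) e \<noteq> 0 \<Longrightarrow> lo \<gamma> e < lo \<gamma> d"
proof -
  show "finite D" "D \<subseteq> side T \<gamma>" using finite_side unfolding D_def by auto
  fix d assume d: "d \<in> D"
  then have dV: "d \<in> V" and ds: "d \<in> side T \<gamma>" and dh: "i < hi \<gamma> d" unfolding D_def using side_in_V by auto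
  show "row_of i d \<in> {i<..p + q}" using dh lo_hi_in_V[OF dV] by simp
  have r: "row_of i d = lo \<gamma> d \<or> row_of i d = hi \<gamma> d" by simp
  then show "X (row_of i d) d \<noteq> 0" using lo_hi_component[OF dV] by blast
  fix e assume "e \<in> D" "d \<noteq> e" "X (row_of i d) e \<noteq> 0"
  then show "lo \<gamma> e < lo \<gamma> d" using component_row_entry(1)[OF ds _ _ r] unfolding D_def by simp
qed

lemma beyond_le:
  assumes "rank_at_most {i<..p + q} (side T \<gamma>) X k" shows "beyond T \<gamma> i \<le> k"
  unfolding beyond_def
proof (rule rank_at_mostD[OF assms])
  show "indep_cols {i<..p + q} X {v \<in> side T \<gamma>. i < hi \<gamma> v}"
    by (rule indep_cols_triangular[where \<rho>="row_of i" and f="lo \<gamma>"]) (fact beyond_system)+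
qed (rule beyond_system)

text \<open>
  The inequalities satisfied by the support of \<open>Q\<close> make the positions \<open>(\<tau> c, c)\<close> triangular.
\<close>
lemma crossing_system:
  fixes i j assumes ij: "i \<le> j" defines "D \<equiv> {c \<in> V. c \<le> i \<and> j < \<tau> c}"
  shows "finite D" "D \<subseteq> {1..i}" "\<And>d. d \<in> D \<Longrightarrow> \<tau> d \<in> {j<..p + q}" "\<And>d. d \<in> D \<Longrightarrow> Q (\<tau> d) d \<noteq> 0"
    "\<And>d e. d \<in> D \<Longrightarrow> e \<in> D \<Longrightarrow> d \<noteq> e \<Longrightarrow> Q (\<tau> d) e \<noteq> 0 \<Longrightarrow> e < d"
proof -
  show "finite D" "D \<subseteq> {1..i}" unfolding D_def by auto
  fix d assume d: "d \<in> D"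
  then have dV: "d \<in> V" "j < \<tau> d" "d \<le> i" unfolding D_def by auto
  have \<tau>d: "\<tau> d \<in> V" "\<tau> (\<tau> d) = d" using partner_in_V[OF dV(1)] partner_partner[OF dV(1)] by auto
  show "\<tau> d \<in> {j<..p + q}" using dV \<tau>d by simp
  have "\<tau> d \<noteq> d" using dV ij by simp
  then show "Q (\<tau> d) d \<noteq> 0" using Q_partner[OF \<tau>d(1)] \<tau>d by (simp add: eps_def)
  fix e assume e: "e \<in> D" "d \<noteq> e" "Q (\<tau> d) e \<noteq> 0"
  then have "e \<in> V" unfolding D_def by simp
  from Q_support[OF \<tau>d(1) this e(3)] show "e < d" using e(2) \<tau>d by simp
qed

lemma crossing_le:
  assumes ij: "i \<le> j" and rk: "rank_at_most {j<..p + q} {1..i} Q k" shows "crossing_count \<gamma> i j \<le> k"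
  unfolding crossing_count_vertices[OF ij]
proof (rule rank_at_mostD[OF rk])
  show "indep_cols {j<..p + q} Q {c \<in> V. c \<le> i \<and> j < \<tau> c}"
    by (rule indep_cols_triangular[where \<rho>=\<tau> and f="\<lambda>d. d"]) (fact crossing_system[OF ij])+
qed (rule crossing_system[OF ij])

text \<open>
  The column of \<open>x\<close> vanishes on the triangular system at position \<open>x\<close>, to which it does not belong.
  The row of \<open>x\<close> has a free entry only in the other block of columns, and it vanishes on the
  triangular system of that block at position \<open>x - 1\<close>.
\<close>
lemma sign_row_column_trivial:
  assumes x: "x \<in> V" and sx: "\<tau> x = x"
    and rk: "\<And>T. rank_at_most {x<..p + q} (side T \<gamma>) X (beyond T \<gamma> x)"
    and rk': "\<And>T. rank_at_most {x - 1<..p + q} (side T \<gamma>) X (beyond T \<gamma> (x - 1))"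
    and u: "u \<in> V" "u \<noteq> x"
  shows "X u x = 0" "X x u = 0"
proof -
  have lh: "lo \<gamma> x = x" "hi \<gamma> x = x" using sx by (simp_all add: lo_def hi_def)
  obtain T where T: "x \<in> side T \<gamma>" using x side_cover by blast
  show "X u x = 0"
  proof (cases "x < u")
    case True
    show ?thesis
    proof (rule triangular_full_rank_zero_col[where \<rho>="row_of x" and f="lo \<gamma>"])
      show "rank_at_most {x<..p + q} (side T \<gamma>) X (card {v \<in> side T \<gamma>. x < hi \<gamma> v})"
        using rk by (simp add: beyond_def)
      show "X (row_of x d) x = 0" if d: "d \<in> {v \<in> side T \<gamma>. x < hi \<gamma> v}" for d
      proof (rule ccontr)
        assume nz: "X (row_of x d) x \<noteq> 0"
        have ds: "d \<in> side T \<gamma>" "d \<noteq> x" using d lh by auto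
        have "lo \<gamma> x < lo \<gamma> d" "row_of x d \<noteq> lo \<gamma> d"
          using component_row_entry[OF ds(1) T ds(2) _ nz] by auto
        then show False using lh by (simp split: if_splits)
      qed
    qed (use T lh u True beyond_system[where T=T and i=x] in \<open>simp_all\<close>)
  next
    case False
    show ?thesis
    proof (rule ccontr)
      assume "X u x \<noteq> 0"
      then have "free_entry \<gamma> u x" using in_slice_nonzero[OF slice u(1) x] u sx by simp
      then show False using free_entryD[of u x] lh lo_le[of u] False u by simp
    qed
  qed
  show "X x u = 0"
  proof (cases "x - 1 < hi \<gamma> u")
    case True
    show ?thesis
    proof (rule ccontr)
      assume nz: "X x u \<noteq> 0"
      have "x \<noteq> \<tau> u" using sx u partner_partner[OF u(1)] by auto
      then have "free_entry \<gamma> x u" using in_slice_nonzero[OF slice x u(1) nz] u by simp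
      then have "hi \<gamma> u < hi \<gamma> x" using free_entryD by blast
      then show False using lh True by linarith
    qed
  next
    case False
    show ?thesis
    proof (cases "u \<in> side T \<gamma>")
      case True
      then show ?thesis using component_row_entry(2)[OF T True, of x] u lh by auto
    next
      case uT: False
      have S: "u \<in> side (\<not> T) \<gamma>" using side_other[OF u(1), of T] uT by simp
      have "1 \<le> hi \<gamma> u" using lo_hi_in_V[OF u(1)] by simp
      show ?thesis
      proof (rule triangular_full_rank_zero_row[where \<rho>="row_of (x - 1)" and f="lo \<gamma>"])
        show "rank_at_most {x - 1<..p + q} (side (\<not> T) \<gamma>) X (card {v \<in> side (\<not> T) \<gamma>. x - 1 < hi \<gamma> v})"
          using rk' by (simp add: beyond_def)
        show "X x d = 0" if d: "d \<in> {v \<in> side (\<not> T) \<gamma>. x - 1 < hi \<gamma> v}" for d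
        proof (rule ccontr)
          assume nz: "X x d \<noteq> 0"
          have dV: "d \<in> V" and dx: "x - 1 < hi \<gamma> d" using d side_in_V by auto
          have "d \<noteq> x" using d side_disjoint[OF T] by auto
          moreover have "x \<noteq> \<tau> d" using sx partner_partner[OF dV] \<open>d \<noteq> x\<close> by auto
          ultimately have "free_entry \<gamma> x d" using in_slice_nonzero[OF slice x dV nz] by simp
          then have "hi \<gamma> d < hi \<gamma> x" using free_entryD by blast
          then show False using lh dx by linarith
        qed
        show "x \<in> {x - 1<..p + q}" using x by auto
        show "u \<in> side (\<not> T) \<gamma>" by (rule S)
      qed (fact beyond_system[where T="\<not> T" and i="x - 1"])+
    qed
  qed
qed

lemma lo_row_entry:
  assumes "d \<in> side T \<gamma>" "v \<in> side T \<gamma>" shows "X (lo \<gamma> d) v = (if v = d then 1 else 0)"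
proof (cases "v = d")
  case True
  have wV: "d \<in> V" using assms side_in_V by simp
  then show ?thesis
  proof (cases rule: vertex_cases)
    case (left b)
    then show ?thesis using True in_slice_diag[OF slice wV] by simp
  next
    case (right a)
    then show ?thesis using True in_slice_arc[OF slice right(1)] by simp
  qed (use True in_slice_diag[OF slice wV] in simp_all)
next
  case False
  then show ?thesis using component_row_entry(2)[OF assms, of "lo \<gamma> d"] by auto
qed

text \<open>
  Equality at \<open>(x - 1, y - 1)\<close> kills row \<open>y\<close> of \<open>Q\<close> apart from its entry \<open>-1\<close> in column \<open>x\<close>, and
  equality at \<open>(x, y)\<close> does the same for column \<open>x\<close>. Rows: row \<open>y\<close> of \<open>QX = X\<sigma>\<close> expresses row \<open>y\<close>
  of \<open>X\<close> by row \<open>x\<close>, which has no free entries. Columns: the unit vectors satisfy \<open>Q e\<^sub>x = - e\<^sub>y\<close>,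
  so \<open>e\<^sub>x - e\<^sub>y\<close> and \<open>e\<^sub>x + e\<^sub>y\<close> lie in the spans of the two blocks of columns, and pivot rows
  identify them as columns of \<open>X\<close>.
\<close>
lemma arc_trivial:
  assumes xy: "(x, y) \<in> m"
    and rk: "rank_at_most {y<..p + q} {1..x} Q (crossing_count \<gamma> x y)"
    and rk': "rank_at_most {y - 1<..p + q} {1..x - 1} Q (crossing_count \<gamma> (x - 1) (y - 1))"
    and u: "u \<in> V"
  shows "X x u = base_entry \<gamma> x u" "X y u = base_entry \<gamma> y u" "X u x = base_entry \<gamma> u x" "X u y = base_entry \<gamma> u y"
proof -
  have V: "x \<in> V" "y \<in> V" and lt: "x < y" and \<tau>: "\<tau> x = y" "\<tau> y = x"
    using matching_in_V[OF xy] matching_bounds[OF xy] partner_left[OF xy] partner_right[OF xy] by auto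
  have sgxy: "sg x = 1" "sg y = - 1" using left_side[OF xy, of True] right_side[OF xy, of True] by (simp_all add: sg_def)
  have sides: "x \<in> side True \<gamma>" "y \<in> side False \<gamma>" using left_side[OF xy, of True] right_side[OF xy, of False] by simp_all
  have le: "x \<le> y" "x - 1 \<le> y - 1" using lt by simp_all
  have Qyx: "Q y x = - 1" using Q_partner[OF V(2)] \<tau> lt by (simp add: eps_def)
  have Qy: "Q y c = 0" if c: "c \<in> V" "c \<noteq> x" for c
  proof (cases "c < x")
    case True
    show ?thesis
    proof (rule triangular_full_rank_zero_row[where \<rho>=\<tau> and f="\<lambda>d. d"])
      show "rank_at_most {y - 1<..p + q} {1..x - 1} Q (card {c \<in> V. c \<le> x - 1 \<and> y - 1 < \<tau> c})"
        using rk' crossing_count_vertices[OF le(2)] by simp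
      show "Q y d = 0" if d: "d \<in> {c \<in> V. c \<le> x - 1 \<and> y - 1 < \<tau> c}" for d
      proof (rule ccontr)
        assume "Q y d \<noteq> 0"
        then have "\<tau> d = y" using Q_support[OF V(2), of d] d lt by auto
        then have "d = x" using partner_partner[of d] d \<tau> by auto
        then show False using d V by auto
      qed
      show "y \<in> {y - 1<..p + q}" "c \<in> {1..x - 1}" using V c True lt by auto
    qed (fact crossing_system[OF le(2)])+
  next
    case False
    then show ?thesis using Q_support[OF V(2) c(1)] c \<tau> by auto
  qed
  have Qx: "Q k x = 0" if k: "k \<in> V" "k \<noteq> y" for k
  proof (cases "y < k")
    case True
    show ?thesis
    proof (rule triangular_full_rank_zero_col[where \<rho>=\<tau> and f="\<lambda>d. d"])
      show "rank_at_most {y<..p + q} {1..x} Q (card {c \<in> V. c \<le> x \<and> y < \<tau> c})"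
        using rk crossing_count_vertices[OF le(1)] by simp
      show "Q (\<tau> d) x = 0" if d: "d \<in> {c \<in> V. c \<le> x \<and> y < \<tau> c}" for d
      proof (rule ccontr)
        assume "Q (\<tau> d) x \<noteq> 0"
        then have "x \<le> \<tau> (\<tau> d)" using Q_support[OF partner_in_V[of d] V(1)] d by auto
        then have "d = x" using d partner_partner[of d] by auto
        then show False using d \<tau> by auto
      qed
      show "x \<in> {1..x}" "x \<notin> {c \<in> V. c \<le> x \<and> y < \<tau> c}" "k \<in> {y<..p + q}" using V k True \<tau> by auto
    qed (fact crossing_system[OF le(1)])+
  next
    case False
    then show ?thesis using Q_support[OF k(1) V(1)] k \<tau> by auto
  qed
  have mx: "(x, v) \<in> m \<longleftrightarrow> v = y" "(v, x) \<notin> m" for v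
    using matched_left_iff[OF V(1), of v] matched_right_iff[OF V(1), of v] left_notin[OF xy] \<tau> by simp_all
  have my: "(v, y) \<in> m \<longleftrightarrow> v = x" "(y, v) \<notin> m" for v
    using matched_right_iff[OF V(2), of v] matched_left_iff[OF V(2), of v] right_notin[OF xy] \<tau> by simp_all
  have base_x: "base_entry \<gamma> x v = (if v = x \<or> v = y then 1 else 0)" for v
    unfolding base_entry_def mx by (simp add: mx eq_commute[of x])
  have base_y: "base_entry \<gamma> y v = (if v = x then - 1 else if v = y then 1 else 0)" for v
    unfolding base_entry_def using lt by (simp add: my eq_commute[of y])
  have base_x': "base_entry \<gamma> v x = (if v = x then 1 else if v = y then - 1 else 0)" for v
    unfolding base_entry_def using lt by (simp add: mx)
  have base_y': "base_entry \<gamma> v y = (if v = x \<or> v = y then 1 else 0)" for v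
    unfolding base_entry_def by (simp add: my disj_commute)
  show Xx: "X x u = base_entry \<gamma> x u"
    using left_notin[OF xy] by (intro in_slice_base[OF slice V(1) u]) (simp add: free_entry_def)
  have "(\<Sum>k\<in>V. Q y k * X k u) = Q y x * X x u"
    using sum.remove[OF finite_atLeastAtMost V(1), of "\<lambda>k. Q y k * X k u"] Qy by (simp add: sum.neutral)
  then have e: "- X x u = X y u * sg u" using QX[OF u, of y] Qyx by simp
  show "X y u = base_entry \<gamma> y u"
  proof (cases "u = x \<or> u = y")
    case True
    then show ?thesis using e Xx sgxy unfolding base_x base_y by auto
  next
    case False
    then have "X y u * sg u = 0" using e Xx unfolding base_x by simp
    then show ?thesis using False unfolding base_y sg_def by (auto split: if_splits)
  qed
  \<comment> \<open>This is the equation \<open>Q e\<^sub>x = - e\<^sub>y\<close> multiplied by the inverse \<open>G\<close> of \<open>X\<close>.\<close>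
  have Gy: "G v y = - (sg v * G v x)" if v: "v \<in> V" for v
  proof -
    have "(\<Sum>k\<in>V. G v k * Q k x) = G v y * Q y x"
      using sum.remove[OF finite_atLeastAtMost V(2), of "\<lambda>k. G v k * Q k x"] Qx by (simp add: sum.neutral)
    then have e: "- G v y = sg v * G v x" using GQ[OF v, of x] Qyx by simp
    show ?thesis unfolding e[symmetric] by simp
  qed
  \<comment> \<open>For \<open>c = 1\<close> and \<open>c = -1\<close> the factor \<open>1 + c * sg v\<close> selects one block of columns.\<close>
  have key: "(\<Sum>v\<in>V. X r v * ((1 + c * sg v) * G v x)) = (if r = x then 1 else 0) - c * (if r = y then 1 else 0)"
    if r: "r \<in> V" for r c
  proof -
    have "(\<Sum>v\<in>V. X r v * ((1 + c * sg v) * G v x)) = (\<Sum>v\<in>V. X r v * G v x - c * (X r v * G v y))"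
      using Gy by (intro sum.cong) (simp_all add: algebra_simps)
    also have "\<dots> = (\<Sum>v\<in>V. X r v * G v x) - c * (\<Sum>v\<in>V. X r v * G v y)"
      by (simp add: sum_subtractf sum_distrib_left)
    finally show ?thesis using XG[OF r V(1)] XG[OF r V(2)] by simp
  qed
  have col: "X r z = (if r = x then 1 else 0) - c * (if r = y then 1 else 0)"
    if r: "r \<in> V" and z: "z \<in> side T \<gamma>" and c: "c = (if T then 1 else - 1)"
      and lz: "\<And>d. d \<in> side T \<gamma> \<Longrightarrow> (if lo \<gamma> d = x then 1 else 0) - c * (if lo \<gamma> d = y then 1 else 0) = (if d = z then 1 else (0::complex))"
    for r z c T
  proof -
    have zero: "1 + c * sg v = 0" if "v \<in> V" "v \<notin> side T \<gamma>" for v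
      using that side_other[OF that(1), of T] side_disjoint[of v "\<not> T"] c unfolding sg_def by (cases T) auto
    \<comment> \<open>In the pivot row of \<open>d\<close> the matrix \<open>X\<close> has a single nonzero entry on this side, so \<open>key\<close> gives the coefficient itself.\<close>
    have h: "(1 + c * sg d) * G d x = (if d = z then 1 else 0)" if d: "d \<in> V" for d
    proof (cases "d \<in> side T \<gamma>")
      case True
      have lw: "lo \<gamma> d \<in> V" using lo_hi_in_V[OF d] by simp
      have "(\<Sum>v\<in>V. X (lo \<gamma> d) v * ((1 + c * sg v) * G v x)) = (\<Sum>v\<in>V. if v = d then (1 + c * sg v) * G v x else 0)"
      proof (rule sum.cong)
        fix v assume "v \<in> V"
        then show "X (lo \<gamma> d) v * ((1 + c * sg v) * G v x) = (if v = d then (1 + c * sg v) * G v x else 0)"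
          using lo_row_entry[OF True, of v] zero[of v] True by (cases "v \<in> side T \<gamma>") auto
      qed simp
      also have "\<dots> = (1 + c * sg d) * G d x" using d by simp
      finally show ?thesis using key[OF lw, of c] lz[OF True] by simp
    next
      case False
      then show ?thesis using zero[OF d] z by auto
    qed
    have "(\<Sum>v\<in>V. X r v * ((1 + c * sg v) * G v x)) = (\<Sum>v\<in>V. if v = z then X r v else 0)"
      using h by (intro sum.cong) simp_all
    also have "\<dots> = X r z" using side_in_V[OF z] by simp
    finally show ?thesis using key[OF r, of c] by simp
  qed
  have lo_y: "lo \<gamma> d \<noteq> y" if d: "d \<in> V" for d
    using d by (cases rule: vertex_cases) (use right_notin[OF xy] left_notin in auto)
  have lo_x: "lo \<gamma> x = x" "lo \<gamma> y = x" using \<tau> lt by (simp_all add: lo_def)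
  have "X u x = (if u = x then 1 else 0) - 1 * (if u = y then 1 else 0)"
  proof (rule col[OF u sides(1)])
    fix d assume d: "d \<in> side True \<gamma>"
    have "lo \<gamma> d = x \<longleftrightarrow> d = x" using lo_inj_on_side[OF d sides(1)] lo_x by auto
    then show "(if lo \<gamma> d = x then 1 else 0) - 1 * (if lo \<gamma> d = y then 1 else 0) = (if d = x then 1 else (0::complex))"
      using lo_y[OF side_in_V[OF d]] by simp
  qed simp
  then show "X u x = base_entry \<gamma> u x" unfolding base_x' using lt by simp
  have "X u y = (if u = x then 1 else 0) - (- 1) * (if u = y then 1 else 0)"
  proof (rule col[OF u sides(2)])
    fix d assume d: "d \<in> side False \<gamma>"
    have "lo \<gamma> d = x \<longleftrightarrow> d = y" using lo_inj_on_side[OF d sides(2)] lo_x by auto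
    then show "(if lo \<gamma> d = x then 1 else 0) - (- 1) * (if lo \<gamma> d = y then 1 else 0) = (if d = y then 1 else (0::complex))"
      using lo_y[OF side_in_V[OF d]] by simp
  qed simp
  then show "X u y = base_entry \<gamma> u y" unfolding base_y' using lt by simp
qed

end

section \<open>Embedded clans\<close>

locale clan_embedding = small: pq_clan p q \<alpha> + big: pq_clan r s \<beta>
  for p q \<alpha> r s \<beta> +
  fixes \<iota> :: "nat \<Rightarrow> nat"
  assumes witness: "witnesses p q r s \<iota> \<beta> \<alpha>"
begin

abbreviation "W \<equiv> {1..r + s}"
abbreviation "V \<equiv> {1..p + q}"
abbreviation "I \<equiv> \<iota> ` {1..p + q}"

lemma embed_less:
  assumes u: "u \<in> V" and v: "v \<in> V" shows "\<iota> u < \<iota> v \<longleftrightarrow> u < v"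
proof -
  have sm: "strict_mono_on V \<iota>" using witness unfolding witnesses_def by simp
  note l = strict_mono_onD[OF sm u v] strict_mono_onD[OF sm v u]
  consider "u < v" | "u = v" | "v < u" by linarith
  then show ?thesis by cases (use l in auto)
qed

lemma embed_eq: "u \<in> V \<Longrightarrow> v \<in> V \<Longrightarrow> \<iota> u = \<iota> v \<longleftrightarrow> u = v"
  using embed_less[of u v] embed_less[of v u] by (metis linorder_neq_iff)

lemma embed_le: "u \<in> V \<Longrightarrow> v \<in> V \<Longrightarrow> \<iota> u \<le> \<iota> v \<longleftrightarrow> u \<le> v"
  using embed_less[of v u] by (simp add: not_less[symmetric])

lemma inj_embed: "inj_on \<iota> V"
  by (rule inj_onI) (simp only: embed_eq)

lemma embed_in: "u \<in> V \<Longrightarrow> \<iota> u \<in> W"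
  using witness unfolding witnesses_def by blast

lemma embed_plus: "u \<in> plus_signs \<alpha> \<Longrightarrow> \<iota> u \<in> plus_signs \<beta>"
  and embed_minus: "u \<in> minus_signs \<alpha> \<Longrightarrow> \<iota> u \<in> minus_signs \<beta>"
  using witness unfolding witnesses_def by simp_all

lemma embed_matching: "(u, v) \<in> matchings \<alpha> \<Longrightarrow> (\<iota> u, \<iota> v) \<in> matchings \<beta>"
proof -
  assume uv: "(u, v) \<in> matchings \<alpha>"
  have "\<forall>(k, l) \<in> matchings \<alpha>. (\<iota> k, \<iota> l) \<in> matchings \<beta>" using witness unfolding witnesses_def by simp
  from bspec[OF this uv] show ?thesis by simp
qed

lemma embed_partner: assumes u: "u \<in> V" shows "partner \<beta> (\<iota> u) = \<iota> (partner \<alpha> u)"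
  using u
proof (cases rule: small.vertex_cases)
  case plus
  then show ?thesis using embed_plus[of u] big.partner_sign[of "\<iota> u"] by simp
next
  case minus
  then show ?thesis using embed_minus[of u] big.partner_sign[of "\<iota> u"] by simp
next
  case (left b)
  then show ?thesis using big.partner_left[OF embed_matching[OF left(1)]] by simp
next
  case (right a)
  then show ?thesis using big.partner_right[OF embed_matching[OF right(1)]] by simp
qed

lemma embed_kind_conj:
  assumes u: "u \<in> V"
  shows "(\<iota> u \<in> plus_signs \<beta> \<longleftrightarrow> u \<in> plus_signs \<alpha>) \<and> (\<iota> u \<in> minus_signs \<beta> \<longleftrightarrow> u \<in> minus_signs \<alpha>) \<and>
    (\<iota> u \<in> left_ends \<beta> \<longleftrightarrow> u \<in> left_ends \<alpha>) \<and> (\<iota> u \<in> right_ends \<beta> \<longleftrightarrow> u \<in> right_ends \<alpha>)"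
  using u
proof (cases rule: small.vertex_cases)
  case plus
  from embed_in[OF u] show ?thesis by (cases rule: big.vertex_cases) (use embed_plus[OF plus(1)] plus in simp_all)
next
  case minus
  from embed_in[OF u] show ?thesis by (cases rule: big.vertex_cases) (use embed_minus[OF minus(1)] minus in simp_all)
next
  case (left b)
  from big.left_notin[OF embed_matching[OF left(1)]] left show ?thesis by simp
next
  case (right a)
  from big.right_notin[OF embed_matching[OF right(1)]] right show ?thesis by simp
qed

lemma embed_kind:
  assumes u: "u \<in> V"
  shows "\<iota> u \<in> plus_signs \<beta> \<longleftrightarrow> u \<in> plus_signs \<alpha>" "\<iota> u \<in> minus_signs \<beta> \<longleftrightarrow> u \<in> minus_signs \<alpha>"
    "\<iota> u \<in> left_ends \<beta> \<longleftrightarrow> u \<in> left_ends \<alpha>" "\<iota> u \<in> right_ends \<beta> \<longleftrightarrow> u \<in> right_ends \<alpha>"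
  using embed_kind_conj[OF u] by simp_all

lemma embed_side: "u \<in> V \<Longrightarrow> \<iota> u \<in> side T \<beta> \<longleftrightarrow> u \<in> side T \<alpha>"
  using embed_kind[of u] by (cases T) (simp_all add: side_def)

lemma embed_lo_hi:
  assumes u: "u \<in> V" shows "lo \<beta> (\<iota> u) = \<iota> (lo \<alpha> u)" "hi \<beta> (\<iota> u) = \<iota> (hi \<alpha> u)"
  using embed_le[OF u small.partner_in_V[OF u]] embed_le[OF small.partner_in_V[OF u] u] embed_partner[OF u]
  by (auto simp: lo_def hi_def min_def max_def)

lemma embed_matching_iff:
  assumes u: "u \<in> V" and v: "v \<in> V" shows "(\<iota> u, \<iota> v) \<in> matchings \<beta> \<longleftrightarrow> (u, v) \<in> matchings \<alpha>"
proof
  assume L: "(\<iota> u, \<iota> v) \<in> matchings \<beta>"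
  then have "u \<in> left_ends \<alpha>" using embed_kind(3)[OF u] big.left_endsI[OF L] by simp
  then obtain b where b: "(u, b) \<in> matchings \<alpha>" by (rule small.left_endsE)
  have "\<iota> b = \<iota> v" using big.matching_left_unique[OF embed_matching[OF b] L] .
  then have "b = v" using embed_eq[of b v] small.matching_in_V[OF b] v by simp
  then show "(u, v) \<in> matchings \<alpha>" using b by simp
qed (rule embed_matching)

lemma partner_image: "x \<in> I \<Longrightarrow> partner \<beta> x \<in> I"
proof -
  assume "x \<in> I"
  then obtain u where u: "u \<in> V" "x = \<iota> u" by auto
  then have "partner \<beta> x = \<iota> (partner \<alpha> u)" using embed_partner by simp
  then show ?thesis using small.partner_in_V[OF u(1)] by blast
qed

lemma partner_image_iff: "x \<in> W \<Longrightarrow> partner \<beta> x \<in> I \<longleftrightarrow> x \<in> I"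
  using partner_image[of x] partner_image[of "partner \<beta> x"] big.partner_partner[of x] by auto

lemma matching_image_iff: "(x, y) \<in> matchings \<beta> \<Longrightarrow> x \<in> I \<longleftrightarrow> y \<in> I"
  using partner_image_iff[of x] big.partner_left[of x y] big.matching_in_V[of x y] by auto

lemma embed_free: "u \<in> V \<Longrightarrow> v \<in> V \<Longrightarrow> free_entry \<beta> (\<iota> u) (\<iota> v) \<longleftrightarrow> free_entry \<alpha> u v"
  using embed_less[of "lo \<alpha> v" "lo \<alpha> u"] embed_less[of "hi \<alpha> v" "hi \<alpha> u"] small.lo_hi_in_V[of u] small.lo_hi_in_V[of v]
  unfolding free_entry_def by (simp only: embed_lo_hi embed_kind embed_side)

lemma embed_base: "u \<in> V \<Longrightarrow> v \<in> V \<Longrightarrow> base_entry \<beta> (\<iota> u) (\<iota> v) = base_entry \<alpha> u v"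
  unfolding base_entry_def by (simp only: embed_matching_iff embed_eq)

lemma base_mixed: "u \<in> W \<Longrightarrow> v \<in> W \<Longrightarrow> (u \<in> I) \<noteq> (v \<in> I) \<Longrightarrow> base_entry \<beta> u v = 0"
  using matching_image_iff[of u v] matching_image_iff[of v u] by (auto simp: base_entry_def)

subsection \<open>Counting embedded vertices\<close>

text \<open>
  Translates positions in the big clan to positions in the small one.
\<close>
definition low :: "nat \<Rightarrow> nat" where "low i = card {k \<in> V. \<iota> k \<le> i}"

text \<open>
  The embedded vertices up to \<open>i\<close> form an initial segment.
\<close>
lemma low_set: "{k \<in> V. \<iota> k \<le> i} = {1..low i}"
proof -
  let ?S = "{k \<in> V. \<iota> k \<le> i}"
  have fin: "finite ?S" by simp
  have down: "k \<in> ?S" if "l \<in> ?S" "1 \<le> k" "k \<le> l" for k l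
    using that embed_le[of k l] by auto
  show ?thesis
  proof (cases "?S = {}")
    case True
    then show ?thesis unfolding low_def by simp
  next
    case False
    have M: "Max ?S \<in> ?S" using Max_in[OF fin False] .
    have "?S = {1..Max ?S}"
    proof (intro equalityI subsetI)
      fix k assume k: "k \<in> ?S"
      then show "k \<in> {1..Max ?S}" using Max_ge[OF fin k] by simp
    next
      fix k assume "k \<in> {1..Max ?S}"
      then show "k \<in> ?S" using down[OF M, of k] by simp
    qed
    then have "low i = Max ?S" unfolding low_def by (metis card_atLeastAtMost diff_Suc_1)
    then show ?thesis using \<open>?S = {1..Max ?S}\<close> by simp
  qed
qed

lemma embed_le_iff_low: "k \<in> V \<Longrightarrow> \<iota> k \<le> i \<longleftrightarrow> k \<le> low i"
proof -
  assume k: "k \<in> V"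
  have "k \<in> {k \<in> V. \<iota> k \<le> i} \<longleftrightarrow> k \<in> {1..low i}" unfolding low_set ..
  then show ?thesis using k by simp
qed

lemma less_embed_iff_low: "k \<in> V \<Longrightarrow> i < \<iota> k \<longleftrightarrow> low i < k"
  using embed_le_iff_low[of k i] by (simp add: not_le[symmetric])

lemma low_mono: "i \<le> j \<Longrightarrow> low i \<le> low j"
  unfolding low_def by (rule card_mono) auto

lemma low_le: "low i \<le> p + q"
proof -
  have "card {k \<in> V. \<iota> k \<le> i} \<le> card V" by (rule card_mono) auto
  then show ?thesis unfolding low_def by simp
qed

lemma low_embed: "k \<in> V \<Longrightarrow> low (\<iota> k) = k"
proof -
  assume k: "k \<in> V"
  have "{l \<in> V. \<iota> l \<le> \<iota> k} = {1..k}" using embed_le[OF _ k] k by auto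
  then show ?thesis unfolding low_def by simp
qed

lemma low_zero: "low 0 = 0"
proof -
  have "{k \<in> V. \<iota> k \<le> 0} = {}" using embed_in by force
  then show ?thesis unfolding low_def by simp
qed

lemma low_pred: "x \<notin> I \<Longrightarrow> low (x - 1) = low x"
proof -
  assume x: "x \<notin> I"
  have "\<iota> k \<le> x - 1 \<longleftrightarrow> \<iota> k \<le> x" if "k \<in> V" for k
    using x that by (cases "\<iota> k = x") auto
  then have "{k \<in> V. \<iota> k \<le> x - 1} = {k \<in> V. \<iota> k \<le> x}" by auto
  then show ?thesis unfolding low_def by simp
qed

lemma beyond_split: "beyond T \<beta> i = beyond T \<alpha> (low i) + card {v \<in> side T \<beta> - I. i < hi \<beta> v}"
proof -
  have iff: "i < hi \<beta> (\<iota> v) \<longleftrightarrow> low i < hi \<alpha> v" if "v \<in> V" for v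
    using less_embed_iff_low[of "hi \<alpha> v" i] small.lo_hi_in_V[OF that] embed_lo_hi[OF that] by simp
  have "{v \<in> side T \<beta>. i < hi \<beta> v} = \<iota> ` {v \<in> side T \<alpha>. low i < hi \<alpha> v} \<union> {v \<in> side T \<beta> - I. i < hi \<beta> v}"
  proof (intro equalityI subsetI)
    fix x assume x: "x \<in> {v \<in> side T \<beta>. i < hi \<beta> v}"
    show "x \<in> \<iota> ` {v \<in> side T \<alpha>. low i < hi \<alpha> v} \<union> {v \<in> side T \<beta> - I. i < hi \<beta> v}"
    proof (cases "x \<in> I")
      case True
      then obtain v where v: "v \<in> V" "x = \<iota> v" by auto
      then have "v \<in> {v \<in> side T \<alpha>. low i < hi \<alpha> v}" using x iff[OF v(1)] embed_side[OF v(1)] by simp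
      then show ?thesis using v by blast
    qed (use x in simp)
  next
    fix x assume "x \<in> \<iota> ` {v \<in> side T \<alpha>. low i < hi \<alpha> v} \<union> {v \<in> side T \<beta> - I. i < hi \<beta> v}"
    then show "x \<in> {v \<in> side T \<beta>. i < hi \<beta> v}"
    proof
      assume "x \<in> \<iota> ` {v \<in> side T \<alpha>. low i < hi \<alpha> v}"
      then obtain v where v: "v \<in> side T \<alpha>" "low i < hi \<alpha> v" "x = \<iota> v" by auto
      then show ?thesis using iff embed_side small.side_in_V by simp
    qed simp
  qed
  moreover have "card (\<iota> ` {v \<in> side T \<alpha>. low i < hi \<alpha> v}) = beyond T \<alpha> (low i)"
    unfolding beyond_def
  proof (rule card_image, rule inj_on_subset[OF inj_embed])
    show "{v \<in> side T \<alpha>. low i < hi \<alpha> v} \<subseteq> V" using small.side_in_V by blast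
  qed
  moreover have "card (\<iota> ` {v \<in> side T \<alpha>. low i < hi \<alpha> v} \<union> {v \<in> side T \<beta> - I. i < hi \<beta> v})
      = card (\<iota> ` {v \<in> side T \<alpha>. low i < hi \<alpha> v}) + card {v \<in> side T \<beta> - I. i < hi \<beta> v}"
  proof (rule card_Un_disjoint)
    show "\<iota> ` {v \<in> side T \<alpha>. low i < hi \<alpha> v} \<inter> {v \<in> side T \<beta> - I. i < hi \<beta> v} = {}"
      using small.side_in_V by blast
  qed (use small.finite_side big.finite_side in auto)
  ultimately show ?thesis by (simp add: beyond_def)
qed

lemma crossing_split:
  assumes ij: "i \<le> j"
  shows "crossing_count \<beta> i j = crossing_count \<alpha> (low i) (low j) + card {c \<in> W - I. c \<le> i \<and> j < partner \<beta> c}"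
proof -
  let ?A = "{c \<in> V. c \<le> low i \<and> low j < partner \<alpha> c}" and ?B = "{c \<in> W - I. c \<le> i \<and> j < partner \<beta> c}"
  have iff: "\<iota> v \<le> i \<and> j < partner \<beta> (\<iota> v) \<longleftrightarrow> v \<le> low i \<and> low j < partner \<alpha> v" if "v \<in> V" for v
    using less_embed_iff_low[of "partner \<alpha> v" j] small.partner_in_V[OF that] embed_partner[OF that]
      embed_le_iff_low[OF that] by simp
  have "{c \<in> W. c \<le> i \<and> j < partner \<beta> c} = \<iota> ` ?A \<union> ?B"
  proof (intro equalityI subsetI)
    fix x assume x: "x \<in> {c \<in> W. c \<le> i \<and> j < partner \<beta> c}"
    show "x \<in> \<iota> ` ?A \<union> ?B"
    proof (cases "x \<in> I")
      case True
      then obtain v where v: "v \<in> V" "x = \<iota> v" by auto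
      then have "v \<in> ?A" using x iff[OF v(1)] by simp
      then show ?thesis using v by blast
    qed (use x in simp)
  next
    fix x assume "x \<in> \<iota> ` ?A \<union> ?B"
    then show "x \<in> {c \<in> W. c \<le> i \<and> j < partner \<beta> c}"
    proof
      assume "x \<in> \<iota> ` ?A"
      then obtain v where v: "v \<in> V" "v \<le> low i \<and> low j < partner \<alpha> v" "x = \<iota> v" by auto
      then show ?thesis using iff embed_in by simp
    qed simp
  qed
  moreover have "card (\<iota> ` ?A) = card ?A"
    by (rule card_image, rule inj_on_subset[OF inj_embed]) auto
  moreover have "card (\<iota> ` ?A \<union> ?B) = card (\<iota> ` ?A) + card ?B"
    by (rule card_Un_disjoint) auto
  ultimately show ?thesis
    using big.crossing_count_vertices[OF ij] small.crossing_count_vertices[OF low_mono[OF ij]] by simp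
qed

end

subsection \<open>The length of a clan containing another one\<close>

text \<open>
  The half-open interval is chosen such that the sum over all vertices is the length of the arc.
\<close>
definition covers :: "nat \<Rightarrow> nat \<times> nat \<Rightarrow> int" where
  "covers k A = of_bool (fst A < k \<and> k \<le> snd A)"

definition crosses :: "nat \<times> nat \<Rightarrow> nat \<times> nat \<Rightarrow> int" where
  "crosses B A = of_bool (fst B < fst A \<and> fst A < snd B \<and> snd B < snd A)"

text \<open>
  The length of a clan is the case in which \<open>M\<close> and \<open>M'\<close> are its arcs and \<open>K\<close> its vertices; the
  formula is additive in all three sets.
\<close>
definition partial_length :: "(nat \<times> nat) set \<Rightarrow> nat set \<Rightarrow> (nat \<times> nat) set \<Rightarrow> int" where
  "partial_length M K M' = (\<Sum>A\<in>M. (\<Sum>k\<in>K. covers k A) - (\<Sum>B\<in>M'. crosses B A))"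

text \<open>
  The six relative positions of two intervals without common end points. Only nesting of the second
  interval in the first survives.
\<close>
lemma covers_crosses_intervals:
  assumes "i < j" "x < y" "x \<noteq> i" "x \<noteq> j" "y \<noteq> i" "y \<noteq> j"
  shows "covers (fst (x, y)) (i, j) + covers (snd (x, y)) (i, j) - crosses (x, y) (i, j) - crosses (i, j) (x, y)
    = 2 * of_bool (fst (i, j) \<le> fst (x, y) \<and> snd (x, y) < snd (i, j))"
proof -
  consider "y < i" | "j < x" | "i < x" "y < j" | "x < i" "j < y" | "x < i" "i < y" "y < j" | "i < x" "x < j" "j < y"
    using assms by linarith
  then show ?thesis by cases (use assms in \<open>simp_all add: covers_def crosses_def\<close>)
qed

lemma int_card_filter: "finite A \<Longrightarrow> int (card {x \<in> A. P x}) = (\<Sum>x\<in>A. of_bool (P x))"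
  by (simp add: of_bool_def sum.inter_filter[symmetric])

context pq_clan
begin

lemma clan_length_partial: "clan_length \<gamma> = partial_length m V m"
  unfolding clan_length_def partial_length_def
proof (rule sum.cong)
  fix A assume A: "A \<in> m"
  obtain i j where ij: "A = (i, j)" by (cases A)
  have b: "1 \<le> i" "i < j" "j \<le> p + q" using matching_bounds A ij by auto
  have "(\<Sum>k\<in>V. covers k A) = int (card {k \<in> V. i < k \<and> k \<le> j})"
    using int_card_filter[of V "\<lambda>k. i < k \<and> k \<le> j"] by (simp add: covers_def ij)
  also have "{k \<in> V. i < k \<and> k \<le> j} = {i<..j}" using b by auto
  finally have 1: "(\<Sum>k\<in>V. covers k A) = int j - int i" using b by simp
  have "(\<Sum>B\<in>m. crosses B A) = int (card {B \<in> m. fst B < i \<and> i < snd B \<and> snd B < j})"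
    using int_card_filter[OF finite_matchings, of "\<lambda>B. fst B < i \<and> i < snd B \<and> snd B < j"] by (simp add: crosses_def ij)
  also have "{B \<in> m. fst B < i \<and> i < snd B \<and> snd B < j} = {(s, t) \<in> m. s < i \<and> i < t \<and> t < j}" by auto
  finally show "(case A of (i, j) \<Rightarrow> int j - int i - int (card {(s, t) \<in> m. s < i \<and> i < t \<and> t < j}))
      = (\<Sum>k\<in>V. covers k A) - (\<Sum>B\<in>m. crosses B A)" using 1 ij by simp
qed simp

end

context clan_embedding
begin

text \<open>
  One end outside suffices, because embedded vertices are only matched with each other.
\<close>
definition outer :: "(nat \<times> nat) set" where "outer = {(k, l) \<in> matchings \<beta>. k \<notin> I \<or> l \<notin> I}"

abbreviation "inner \<equiv> map_prod \<iota> \<iota> ` matchings \<alpha>"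

definition outer_signs :: "nat set" where "outer_signs = (plus_signs \<beta> \<union> minus_signs \<beta>) - I"

lemma outerD: "(x, y) \<in> outer \<Longrightarrow> (x, y) \<in> matchings \<beta> \<and> x \<notin> I \<and> y \<notin> I"
  using matching_image_iff[of x y] unfolding outer_def by auto

lemma matchings_split: "matchings \<beta> = inner \<union> outer" "inner \<inter> outer = {}"
proof -
  show "matchings \<beta> = inner \<union> outer"
  proof (intro equalityI subsetI)
    fix A assume A: "A \<in> matchings \<beta>"
    obtain x y where xy: "A = (x, y)" by (cases A)
    show "A \<in> inner \<union> outer"
    proof (cases "x \<in> I")
      case True
      then obtain u v where uv: "u \<in> V" "x = \<iota> u" "v \<in> V" "y = \<iota> v"
        using matching_image_iff[of x y] A xy by auto
      then have "(u, v) \<in> matchings \<alpha>" using embed_matching_iff A xy by simp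
      then have "map_prod \<iota> \<iota> (u, v) \<in> inner" by (rule imageI)
      then show ?thesis using uv xy by simp
    next
      case False
      then show ?thesis using A xy unfolding outer_def by simp
    qed
  next
    fix A assume "A \<in> inner \<union> outer"
    then show "A \<in> matchings \<beta>"
    proof
      assume "A \<in> inner"
      then obtain u v where "(u, v) \<in> matchings \<alpha>" "A = (\<iota> u, \<iota> v)" by auto
      then show ?thesis using embed_matching by simp
    next
      assume "A \<in> outer"
      then show ?thesis unfolding outer_def by auto
    qed
  qed
  show "inner \<inter> outer = {}"
  proof (rule equals0I)
    fix A assume "A \<in> inner \<inter> outer"
    then obtain u v where uv: "(u, v) \<in> matchings \<alpha>" "(\<iota> u, \<iota> v) \<in> outer" by auto
    then show False using outerD[OF uv(2)] small.matching_in_V[OF uv(1)] by simp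
  qed
qed

lemma finite_inner: "finite inner" and finite_outer: "finite outer"
  using big.finite_matchings unfolding matchings_split(1) by simp_all

lemma inj_inner: "inj_on (map_prod \<iota> \<iota>) (matchings \<alpha>)"
proof (rule inj_onI)
  fix A B assume "A \<in> matchings \<alpha>" "B \<in> matchings \<alpha>" "map_prod \<iota> \<iota> A = map_prod \<iota> \<iota> B"
  then show "A = B"
    using embed_eq small.matching_in_V[of "fst A" "snd A"] small.matching_in_V[of "fst B" "snd B"]
    by (cases A; cases B) simp
qed

lemma inner_length: "partial_length inner I inner = clan_length \<alpha>"
proof -
  have c: "covers (\<iota> k) (map_prod \<iota> \<iota> A) = covers k A" if "A \<in> matchings \<alpha>" "k \<in> V" for A k
    using that embed_less embed_le small.matching_in_V[of "fst A" "snd A"] by (cases A) (simp add: covers_def)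
  have x: "crosses (map_prod \<iota> \<iota> B) (map_prod \<iota> \<iota> A) = crosses B A" if "A \<in> matchings \<alpha>" "B \<in> matchings \<alpha>" for A B
    using that embed_less small.matching_in_V[of "fst A" "snd A"] small.matching_in_V[of "fst B" "snd B"]
    by (cases A; cases B) (simp add: crosses_def)
  have ri: "(\<Sum>A\<in>inner. g A) = (\<Sum>A\<in>matchings \<alpha>. g (map_prod \<iota> \<iota> A))" for g :: "nat \<times> nat \<Rightarrow> int"
    by (simp add: sum.reindex[OF inj_inner])
  have rk: "(\<Sum>k\<in>I. g k) = (\<Sum>k\<in>V. g (\<iota> k))" for g :: "nat \<Rightarrow> int"
    using sum.reindex[OF inj_embed, of g] by simp
  show ?thesis
    unfolding small.clan_length_partial partial_length_def ri rk
  proof (intro sum.cong refl arg_cong2[where f="(-)"])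
    fix A k assume "A \<in> matchings \<alpha>" "k \<in> V"
    then show "covers (\<iota> k) (map_prod \<iota> \<iota> A) = covers k A" by (rule c)
  next
    fix A B assume "A \<in> matchings \<alpha>" "B \<in> matchings \<alpha>"
    then show "crosses (map_prod \<iota> \<iota> B) (map_prod \<iota> \<iota> A) = crosses B A" by (rule x)
  qed
qed

lemma outer_vertices: "W - I = outer_signs \<union> (fst ` outer \<union> snd ` outer)"
  "outer_signs \<inter> (fst ` outer \<union> snd ` outer) = {}" "fst ` outer \<inter> snd ` outer = {}"
proof -
  show "W - I = outer_signs \<union> (fst ` outer \<union> snd ` outer)"
  proof (intro equalityI subsetI)
    fix x assume x: "x \<in> W - I"
    then have "x \<in> W" by simp
    then show "x \<in> outer_signs \<union> (fst ` outer \<union> snd ` outer)"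
    proof (cases rule: big.vertex_cases)
      case (left b)
      then have "(x, b) \<in> outer" using x unfolding outer_def by simp
      then have "fst (x, b) \<in> fst ` outer" by (rule imageI)
      then show ?thesis by simp
    next
      case (right a)
      then have "(a, x) \<in> outer" using x unfolding outer_def by simp
      then have "snd (a, x) \<in> snd ` outer" by (rule imageI)
      then show ?thesis by simp
    qed (use x in \<open>simp_all add: outer_signs_def\<close>)
  next
    fix x assume "x \<in> outer_signs \<union> (fst ` outer \<union> snd ` outer)"
    then consider "x \<in> outer_signs" | y where "(x, y) \<in> outer" | y where "(y, x) \<in> outer" by auto
    then show "x \<in> W - I"
    proof cases
      case 1
      then show ?thesis using equalityD1[OF big.signs_eq] unfolding outer_signs_def by auto
    next
      case (2 y)
      from outerD[OF 2] show ?thesis using big.matching_in_V[of x y] by simp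
    next
      case (3 y)
      from outerD[OF 3] show ?thesis using big.matching_in_V[of y x] by simp
    qed
  qed
  show "outer_signs \<inter> (fst ` outer \<union> snd ` outer) = {}"
  proof (rule equals0I)
    fix x assume "x \<in> outer_signs \<inter> (fst ` outer \<union> snd ` outer)"
    then have s: "x \<in> plus_signs \<beta> \<union> minus_signs \<beta>" and "(\<exists>y. (x, y) \<in> outer) \<or> (\<exists>y. (y, x) \<in> outer)"
      unfolding outer_signs_def by auto
    then obtain y where "(x, y) \<in> matchings \<beta> \<or> (y, x) \<in> matchings \<beta>" using outerD by auto
    then show False using s big.left_notin[of x y] big.right_notin[of y x] by auto
  qed
  show "fst ` outer \<inter> snd ` outer = {}"
  proof (rule equals0I)
    fix x assume "x \<in> fst ` outer \<inter> snd ` outer"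
    then obtain y z where "(x, y) \<in> outer" "(z, x) \<in> outer" by auto
    then show False using outerD big.matching_not_chained[of z x y] by simp
  qed
qed

lemma sum_outer_vertices: "(\<Sum>k\<in>W - I. f k) = (\<Sum>k\<in>outer_signs. f k) + (\<Sum>B\<in>outer. f (fst B) + f (snd B))"
  for f :: "nat \<Rightarrow> int"
proof -
  have fin: "finite outer_signs" "finite (fst ` outer)" "finite (snd ` outer)"
    using finite_outer big.finite_parts unfolding outer_signs_def by auto
  have i1: "inj_on fst outer"
  proof (rule inj_onI)
    fix A B assume AB: "A \<in> outer" "B \<in> outer" "fst A = fst B"
    have "(fst A, snd A) \<in> outer" "(fst B, snd B) \<in> outer" using AB(1,2) by simp_all
    then have "(fst A, snd A) \<in> matchings \<beta>" "(fst A, snd B) \<in> matchings \<beta>"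
      unfolding AB(3) using outerD[of "fst B" "snd A"] outerD[of "fst B" "snd B"] by simp_all
    then have "snd A = snd B" by (rule big.matching_left_unique)
    then show "A = B" using AB(3) by (rule prod_eqI[rotated])
  qed
  have i2: "inj_on snd outer"
  proof (rule inj_onI)
    fix A B assume AB: "A \<in> outer" "B \<in> outer" "snd A = snd B"
    have "(fst A, snd A) \<in> outer" "(fst B, snd B) \<in> outer" using AB(1,2) by simp_all
    then have "(fst A, snd A) \<in> matchings \<beta>" "(fst B, snd A) \<in> matchings \<beta>"
      unfolding AB(3) using outerD[of "fst A" "snd B"] outerD[of "fst B" "snd B"] by simp_all
    then have "fst A = fst B" by (rule big.matching_right_unique)
    then show "A = B" using AB(3) by (rule prod_eqI)
  qed
  have "(\<Sum>k\<in>W - I. f k) = (\<Sum>k\<in>outer_signs. f k) + ((\<Sum>k\<in>fst ` outer. f k) + (\<Sum>k\<in>snd ` outer. f k))"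
    unfolding outer_vertices(1)
    by (subst sum.union_disjoint[OF fin(1) _ outer_vertices(2)], use fin in simp,
        subst sum.union_disjoint[OF fin(2,3) outer_vertices(3)]) simp
  then show ?thesis by (simp add: sum.reindex[OF i1] sum.reindex[OF i2] sum.distrib)
qed

lemma covers_crosses:
  assumes A: "A \<in> inner" and B: "B \<in> outer"
  shows "covers (fst B) A + covers (snd B) A - crosses B A - crosses A B = 2 * of_bool (fst A \<le> fst B \<and> snd B < snd A)"
proof -
  obtain u v where uv: "(u, v) \<in> matchings \<alpha>" "A = (\<iota> u, \<iota> v)" using A by auto
  obtain x y where xy: "B = (x, y)" by (cases B)
  have o: "(x, y) \<in> matchings \<beta>" "x \<notin> I" "y \<notin> I" using outerD B xy by simp_all
  have i: "\<iota> u \<in> I" "\<iota> v \<in> I" using small.matching_in_V[OF uv(1)] by simp_all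
  have "x \<noteq> \<iota> u \<and> x \<noteq> \<iota> v \<and> y \<noteq> \<iota> u \<and> y \<noteq> \<iota> v"
  proof (intro conjI notI)
    assume "x = \<iota> u" then show False using o(2) i(1) by simp
  next
    assume "x = \<iota> v" then show False using o(2) i(2) by simp
  next
    assume "y = \<iota> u" then show False using o(3) i(1) by simp
  next
    assume "y = \<iota> v" then show False using o(3) i(2) by simp
  qed
  moreover have "x < y" "\<iota> u < \<iota> v" using big.matching_bounds[OF o(1)] big.matching_bounds[OF embed_matching[OF uv(1)]] by simp_all
  ultimately show ?thesis unfolding uv(2) xy by (intro covers_crosses_intervals) simp_all
qed

lemma inner_over: "(\<Sum>A\<in>inner. of_bool (fst A \<le> i \<and> j < snd A)) = int (crossing_count \<alpha> (low i) (low j))"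
proof -
  have "(\<Sum>A\<in>inner. of_bool (fst A \<le> i \<and> j < snd A)) = (\<Sum>A\<in>matchings \<alpha>. of_bool (\<iota> (fst A) \<le> i \<and> j < \<iota> (snd A)) :: int)"
    by (simp add: sum.reindex[OF inj_inner])
  also have "\<dots> = (\<Sum>A\<in>matchings \<alpha>. of_bool (fst A \<le> low i \<and> low j < snd A))"
  proof (rule sum.cong[OF refl])
    fix A assume "A \<in> matchings \<alpha>"
    then have V: "fst A \<in> V" "snd A \<in> V" using small.matching_in_V[of "fst A" "snd A"] by simp_all
    show "of_bool (\<iota> (fst A) \<le> i \<and> j < \<iota> (snd A)) = (of_bool (fst A \<le> low i \<and> low j < snd A) :: int)"
      unfolding embed_le_iff_low[OF V(1)] less_embed_iff_low[OF V(2)] by (rule refl)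
  qed
  also have "\<dots> = int (card {A \<in> matchings \<alpha>. fst A \<le> low i \<and> low j < snd A})"
    by (rule int_card_filter[symmetric]) (rule small.finite_matchings)
  also have "{A \<in> matchings \<alpha>. fst A \<le> low i \<and> low j < snd A} = {(s, t) \<in> matchings \<alpha>. s \<le> low i \<and> low j < t}" by auto
  finally show ?thesis unfolding crossing_count_def .
qed

text \<open>
  Split arcs and vertices into embedded and outer ones. In the mixed terms, the vertices of an outer arc
  are covered by an embedded arc as often as the two cross, up to nesting, by \<open>covers_crosses\<close>.
  What remains of the embedded clan are its arcs over outer signs and over outer arcs.
\<close>
lemma clan_length_split:
  "clan_length \<beta> = clan_length \<alpha> + partial_length outer (W - I) outer + (\<Sum>B\<in>outer. \<Sum>k\<in>I. covers k B)
    + (\<Sum>k\<in>outer_signs. int (crossing_count \<alpha> (low k) (low k)))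
    + 2 * (\<Sum>B\<in>outer. int (crossing_count \<alpha> (low (fst B)) (low (snd B))))"
proof -
  have W: "W = I \<union> (W - I)" "I \<inter> (W - I) = {}" using embed_in by auto
  have covW: "(\<Sum>k\<in>W. covers k A) = (\<Sum>k\<in>I. covers k A) + (\<Sum>k\<in>W - I. covers k A)" for A
    by (subst W(1), rule sum.union_disjoint) auto
  have crm: "(\<Sum>B\<in>matchings \<beta>. crosses B A) = (\<Sum>B\<in>inner. crosses B A) + (\<Sum>B\<in>outer. crosses B A)" for A
    unfolding matchings_split(1) by (rule sum.union_disjoint[OF finite_inner finite_outer matchings_split(2)])
  have "clan_length \<beta> = (\<Sum>A\<in>inner. (\<Sum>k\<in>W. covers k A) - (\<Sum>B\<in>matchings \<beta>. crosses B A))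
      + (\<Sum>A\<in>outer. (\<Sum>k\<in>W. covers k A) - (\<Sum>B\<in>matchings \<beta>. crosses B A))"
    unfolding big.clan_length_partial partial_length_def
    by (subst (1) matchings_split(1), rule sum.union_disjoint[OF finite_inner finite_outer matchings_split(2)])
  also have "\<dots> = partial_length inner I inner + partial_length outer (W - I) outer
      + (\<Sum>B\<in>outer. \<Sum>k\<in>I. covers k B)
      + ((\<Sum>A\<in>inner. \<Sum>k\<in>W - I. covers k A) - (\<Sum>A\<in>inner. \<Sum>B\<in>outer. crosses B A) - (\<Sum>B\<in>outer. \<Sum>A\<in>inner. crosses A B))"
    unfolding covW crm partial_length_def sum.distrib sum_subtractf by (simp only: algebra_simps)
  finally have total: "clan_length \<beta> = partial_length inner I inner + partial_length outer (W - I) outer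
      + (\<Sum>B\<in>outer. \<Sum>k\<in>I. covers k B)
      + ((\<Sum>A\<in>inner. \<Sum>k\<in>W - I. covers k A) - (\<Sum>A\<in>inner. \<Sum>B\<in>outer. crosses B A) - (\<Sum>B\<in>outer. \<Sum>A\<in>inner. crosses A B))" .
  have swap: "(\<Sum>B\<in>outer. \<Sum>A\<in>inner. crosses A B) = (\<Sum>A\<in>inner. \<Sum>B\<in>outer. crosses A B)"
    by (rule sum.swap)
  have "(\<Sum>A\<in>inner. \<Sum>k\<in>W - I. covers k A) - (\<Sum>A\<in>inner. \<Sum>B\<in>outer. crosses B A) - (\<Sum>B\<in>outer. \<Sum>A\<in>inner. crosses A B)
      = (\<Sum>A\<in>inner. (\<Sum>k\<in>outer_signs. covers k A)
          + (\<Sum>B\<in>outer. covers (fst B) A + covers (snd B) A - crosses B A - crosses A B))"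
    unfolding swap sum_outer_vertices sum_subtractf sum.distrib by (simp only: algebra_simps)
  also have "\<dots> = (\<Sum>A\<in>inner. (\<Sum>k\<in>outer_signs. of_bool (fst A \<le> k \<and> k < snd A))
          + (\<Sum>B\<in>outer. 2 * of_bool (fst A \<le> fst B \<and> snd B < snd A)))"
  proof (intro sum.cong arg_cong2[where f="(+)"])
    fix A k assume A: "A \<in> inner" and k: "k \<in> outer_signs"
    have "fst A \<in> I" "snd A \<in> I" using A small.matching_in_V by auto
    then have "fst A \<noteq> k" "snd A \<noteq> k" using k unfolding outer_signs_def by auto
    then show "covers k A = of_bool (fst A \<le> k \<and> k < snd A)" unfolding covers_def by auto
  next
    fix A B assume "A \<in> inner" "B \<in> outer"
    then show "covers (fst B) A + covers (snd B) A - crosses B A - crosses A B = 2 * of_bool (fst A \<le> fst B \<and> snd B < snd A)"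
      by (rule covers_crosses)
  qed simp_all
  also have "\<dots> = (\<Sum>k\<in>outer_signs. \<Sum>A\<in>inner. of_bool (fst A \<le> k \<and> k < snd A))
          + 2 * (\<Sum>B\<in>outer. \<Sum>A\<in>inner. of_bool (fst A \<le> fst B \<and> snd B < snd A))"
    unfolding sum.distrib sum_distrib_left[symmetric] by (simp only: sum.swap[of _ inner])
  also have "\<dots> = (\<Sum>k\<in>outer_signs. int (crossing_count \<alpha> (low k) (low k)))
    + 2 * (\<Sum>B\<in>outer. int (crossing_count \<alpha> (low (fst B)) (low (snd B))))"
  proof (intro arg_cong2[where f="(+)"] arg_cong2[where f="(*)"] sum.cong refl)
    fix k
    show "(\<Sum>A\<in>inner. of_bool (fst A \<le> k \<and> k < snd A)) = int (crossing_count \<alpha> (low k) (low k))"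
      by (rule inner_over)
  next
    fix B :: "nat \<times> nat"
    show "(\<Sum>A\<in>inner. of_bool (fst A \<le> fst B \<and> snd B < snd A)) = int (crossing_count \<alpha> (low (fst B)) (low (snd B)))"
      by (rule inner_over)
  qed
  finally show ?thesis using total unfolding inner_length by simp
qed

end

section \<open>Matrices that are trivial outside an embedded clan\<close>

context clan_embedding
begin

definition trivial_outside :: "(nat \<Rightarrow> nat \<Rightarrow> complex) \<Rightarrow> bool" where
  "trivial_outside X \<longleftrightarrow> (\<forall>u\<in>W. \<forall>v\<in>W. u \<notin> I \<or> v \<notin> I \<longrightarrow> X u v = base_entry \<beta> u v)"

definition restricts :: "(nat \<Rightarrow> nat \<Rightarrow> complex) \<Rightarrow> (nat \<Rightarrow> nat \<Rightarrow> complex) \<Rightarrow> bool" where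
  "restricts X Y \<longleftrightarrow> (\<forall>u\<in>V. \<forall>v\<in>V. Y u v = X (\<iota> u) (\<iota> v))"

lemma restrictsD: "restricts X Y \<Longrightarrow> u \<in> V \<Longrightarrow> v \<in> V \<Longrightarrow> Y u v = X (\<iota> u) (\<iota> v)"
  unfolding restricts_def by simp

lemma trivial_outsideD: "trivial_outside X \<Longrightarrow> u \<in> W \<Longrightarrow> v \<in> W \<Longrightarrow> u \<notin> I \<or> v \<notin> I \<Longrightarrow> X u v = base_entry \<beta> u v"
  unfolding trivial_outside_def by blast

lemma trivial_outside_mixed:
  "trivial_outside X \<Longrightarrow> u \<in> W \<Longrightarrow> v \<in> W \<Longrightarrow> (u \<in> I) \<noteq> (v \<in> I) \<Longrightarrow> X u v = 0"
  using trivial_outsideD[of X u v] base_mixed[of u v] by auto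

lemma in_slice_restrict:
  assumes X: "in_slice (r + s) \<beta> X" and Y: "restricts X Y" shows "in_slice (p + q) \<alpha> Y"
  unfolding in_slice_def
proof (intro conjI ballI allI impI)
  fix u v assume V: "u \<in> V" "v \<in> V" and n: "\<not> free_entry \<alpha> u v"
  have "X (\<iota> u) (\<iota> v) = base_entry \<beta> (\<iota> u) (\<iota> v)"
    by (rule big.in_slice_base[OF X embed_in[OF V(1)] embed_in[OF V(2)]]) (use n V embed_free in simp)
  then show "Y u v = base_entry \<alpha> u v" using restrictsD[OF Y V] embed_base[OF V] by simp
next
  fix i j k l assume m: "(i, k) \<in> matchings \<alpha>" "(j, l) \<in> matchings \<alpha>" and o: "i < j" "j < k" "k < l"
  have V: "i \<in> V" "j \<in> V" "k \<in> V" "l \<in> V" using small.matching_in_V[OF m(1)] small.matching_in_V[OF m(2)] by simp_all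
  have "X (\<iota> l) (\<iota> k) = - X (\<iota> l) (\<iota> i)"
    using X embed_matching[OF m(1)] embed_matching[OF m(2)] embed_less V o unfolding in_slice_def by auto
  then show "Y l k = - Y l i" using restrictsD[OF Y] V by simp
qed

text \<open>
  An arc outside the embedded clan satisfies the ties because both entries of the base point vanish.
\<close>
lemma in_slice_extend:
  assumes Yin: "in_slice (p + q) \<alpha> Y" and Y: "restricts X Y" and triv: "trivial_outside X"
  shows "in_slice (r + s) \<beta> X"
  unfolding in_slice_def
proof (intro conjI ballI allI impI)
  fix u v assume uv: "u \<in> W" "v \<in> W" and n: "\<not> free_entry \<beta> u v"
  show "X u v = base_entry \<beta> u v"
  proof (cases "u \<in> I \<and> v \<in> I")
    case True
    then obtain a b where ab: "a \<in> V" "b \<in> V" "u = \<iota> a" "v = \<iota> b" by auto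
    have "Y a b = base_entry \<alpha> a b"
      by (rule small.in_slice_base[OF Yin ab(1,2)]) (use n ab embed_free in simp)
    then show ?thesis using restrictsD[OF Y ab(1,2)] embed_base[OF ab(1,2)] ab by simp
  next
    case False
    then show ?thesis using trivial_outsideD[OF triv uv] by simp
  qed
next
  fix i j k l assume m: "(i, k) \<in> matchings \<beta>" "(j, l) \<in> matchings \<beta>" and o: "i < j" "j < k" "k < l"
  have ik: "i \<in> I \<longleftrightarrow> k \<in> I" and jl: "j \<in> I \<longleftrightarrow> l \<in> I" using matching_image_iff m by simp_all
  have V: "i \<in> W" "k \<in> W" "l \<in> W" using big.matching_in_V[OF m(1)] big.matching_in_V[OF m(2)] by simp_all
  show "X l k = - X l i"
  proof (cases "l \<in> I \<and> k \<in> I")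
    case True
    then have "i \<in> I" "j \<in> I" using ik jl by simp_all
    then obtain a b c d where abcd: "a \<in> V" "b \<in> V" "c \<in> V" "d \<in> V" "i = \<iota> a" "j = \<iota> b" "k = \<iota> c" "l = \<iota> d"
      using True by auto
    have ac: "(a, c) \<in> matchings \<alpha>" and bd: "(b, d) \<in> matchings \<alpha>" using m embed_matching_iff abcd by simp_all
    have "a < b" "b < c" "c < d" using o embed_less abcd by simp_all
    then have "Y d c = - Y d a" using Yin ac bd unfolding in_slice_def by simp
    then show ?thesis using restrictsD[OF Y] abcd by simp
  next
    case False
    have "X l k = base_entry \<beta> l k" "X l i = base_entry \<beta> l i"
      using trivial_outsideD[OF triv V(3,2)] trivial_outsideD[OF triv V(3,1)] False ik by auto
    moreover have "base_entry \<beta> l k = 0" "base_entry \<beta> l i = 0"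
      using big.base_entry_nonzero[of l k] big.base_entry_nonzero[of l i] o big.partner_left[OF m(1)] big.partner_right[OF m(1)]
      by auto
    ultimately show ?thesis by simp
  qed
qed

lemma image_greater: "{low i<..p + q} \<subseteq> V" "\<iota> ` {low i<..p + q} = {i<..r + s} \<inter> I"
proof -
  show "{low i<..p + q} \<subseteq> V" by auto
  show "\<iota> ` {low i<..p + q} = {i<..r + s} \<inter> I"
  proof (intro equalityI subsetI)
    fix x assume "x \<in> \<iota> ` {low i<..p + q}"
    then obtain k where k: "k \<in> {low i<..p + q}" "x = \<iota> k" by auto
    then have "k \<in> V" by auto
    then show "x \<in> {i<..r + s} \<inter> I" using k less_embed_iff_low[of k i] embed_in[of k] by simp
  next
    fix x assume x: "x \<in> {i<..r + s} \<inter> I"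
    then obtain k where k: "k \<in> V" "x = \<iota> k" by auto
    then have "k \<in> {low i<..p + q}" using x less_embed_iff_low[of k i] by simp
    then show "x \<in> \<iota> ` {low i<..p + q}" using k by simp
  qed
qed

lemma image_upto: "{1..low i} \<subseteq> V" "\<iota> ` {1..low i} = {1..i} \<inter> I"
proof -
  show "{1..low i} \<subseteq> V" using low_le[of i] by auto
  show "\<iota> ` {1..low i} = {1..i} \<inter> I"
  proof (intro equalityI subsetI)
    fix x assume "x \<in> \<iota> ` {1..low i}"
    then obtain k where k: "k \<in> {1..low i}" "x = \<iota> k" by auto
    then have "k \<in> V" using low_le[of i] by auto
    then show "x \<in> {1..i} \<inter> I" using k embed_le_iff_low[of k i] embed_in[of k] by simp
  next
    fix x assume x: "x \<in> {1..i} \<inter> I"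
    then obtain k where k: "k \<in> V" "x = \<iota> k" by auto
    then have "k \<in> {1..low i}" using x embed_le_iff_low[of k i] by simp
    then show "x \<in> \<iota> ` {1..low i}" using k by simp
  qed
qed

text \<open>
  A matrix that is trivial outside is a direct sum. The outer part has a nonzero column exactly for
  each component that ends after \<open>i\<close>, and the row of this end belongs to it alone.
\<close>
lemma side_rank_iff:
  assumes Y: "restricts X Y" and triv: "trivial_outside X"
  shows "rank_at_most {i<..r + s} (side T \<beta>) X (k + card {v \<in> side T \<beta> - I. i < hi \<beta> v}) \<longleftrightarrow>
    rank_at_most {low i<..p + q} (side T \<alpha>) Y k"
proof -
  let ?R = "{i<..r + s}" and ?C = "side T \<beta>"
  let ?E = "{v \<in> side T \<beta> - I. i < hi \<beta> v}"
  have RW: "?R \<subseteq> W" and CW: "?C \<subseteq> W" using big.side_in_V by auto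
  have split: "?R \<inter> I \<union> (?R - I) = ?R" "?C \<inter> I \<union> (?C - I) = ?C" by auto
  have hiW: "hi \<beta> c \<in> W" "hi \<beta> c \<in> I \<longleftrightarrow> c \<in> I" if "c \<in> W" for c
    using big.lo_hi_in_V[OF that] partner_image_iff[OF that] by (simp, auto simp: hi_def max_def)
  have "rank_at_most ?R ?C X (k + card ?E) \<longleftrightarrow>
      rank_at_most (?R \<inter> I \<union> (?R - I)) (?C \<inter> I \<union> (?C - I)) X (k + card ?E)"
    unfolding split ..
  also have "\<dots> \<longleftrightarrow> rank_at_most (?R \<inter> I) (?C \<inter> I) X k"
  proof (rule rank_at_most_direct_sum[where E="?E" and \<rho>="hi \<beta>"])
    show "finite (?C \<inter> I)" "finite (?C - I)" using big.finite_side by simp_all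
    show "X u c = 0" if "u \<in> ?R \<inter> I" "c \<in> ?C - I" for u c
      using trivial_outside_mixed[OF triv, of u c] that RW CW by blast
    show "X u c = 0" if "u \<in> ?R - I" "c \<in> ?C \<inter> I" for u c
      using trivial_outside_mixed[OF triv, of u c] that RW CW by blast
    show "X u c = 0" if u: "u \<in> ?R - I" and c: "c \<in> ?C - I - ?E" for u c
    proof -
      have V: "u \<in> W" "c \<in> W" using u c RW CW by auto
      have "X u c = base_entry \<beta> u c" using trivial_outsideD[OF triv V] u by simp
      moreover have "hi \<beta> c < u" using u c by auto
      then have "u \<noteq> c" "u \<noteq> partner \<beta> c" by (auto simp: hi_def)
      ultimately show ?thesis using big.base_entry_nonzero[of u c] by auto
    qed
    fix c assume c: "c \<in> ?E"
    then have cW: "c \<in> W" and cs: "c \<in> side T \<beta>" using CW by auto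
    show "hi \<beta> c \<in> ?R - I" using c hiW[OF cW] by auto
    have Xb: "X (hi \<beta> c) e = base_entry \<beta> (hi \<beta> c) e" if "e \<in> W" for e
      using trivial_outsideD[OF triv hiW(1)[OF cW] that] c hiW(2)[OF cW] by simp
    show "X (hi \<beta> c) c \<noteq> 0" unfolding Xb[OF cW] using cW
    proof (cases rule: big.vertex_cases)
      case (left b)
      then show "base_entry \<beta> (hi \<beta> c) c \<noteq> 0" by (simp add: base_entry_def)
    qed (simp_all add: base_entry_def)
    fix e assume e: "e \<in> ?E" "c \<noteq> e"
    then have eW: "e \<in> W" and es: "e \<in> side T \<beta>" using CW by auto
    show "X (hi \<beta> c) e = 0"
    proof (rule ccontr)
      assume "X (hi \<beta> c) e \<noteq> 0"
      then have "hi \<beta> c = e \<or> hi \<beta> c = partner \<beta> e" unfolding Xb[OF eW] by (rule big.base_entry_nonzero)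
      then have "lo \<beta> (hi \<beta> c) = lo \<beta> e" using big.lo_partner[OF eW] by auto
      moreover have "lo \<beta> (hi \<beta> c) = lo \<beta> c" using big.lo_partner[OF cW] by (auto simp: hi_def max_def)
      ultimately have "c = e" using big.lo_inj_on_side[OF cs es] by simp
      then show False using e by simp
    qed
  qed auto
  also have "\<dots> \<longleftrightarrow> rank_at_most {low i<..p + q} (side T \<alpha>) Y k"
  proof (rule rank_at_most_reindex[symmetric])
    have "\<iota> ` side T \<alpha> = ?C \<inter> I"
    proof (intro equalityI subsetI)
      fix x assume "x \<in> \<iota> ` side T \<alpha>"
      then show "x \<in> ?C \<inter> I" using embed_side small.side_in_V by auto
    next
      fix x assume x: "x \<in> ?C \<inter> I"
      then obtain k where k: "k \<in> V" "x = \<iota> k" by auto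
      then show "x \<in> \<iota> ` side T \<alpha>" using x embed_side[OF k(1)] by simp
    qed
    moreover have "inj_on \<iota> (side T \<alpha>)" by (rule inj_on_subset[OF inj_embed small.side_subset])
    ultimately show "bij_betw \<iota> (side T \<alpha>) (?C \<inter> I)" by (simp add: bij_betw_def)
    show "\<iota> ` {low i<..p + q} = ?R \<inter> I" by (rule image_greater)
    fix u d assume "u \<in> {low i<..p + q}" "d \<in> side T \<alpha>"
    then show "Y u d = X (\<iota> u) (\<iota> d)" using restrictsD[OF Y] small.side_in_V image_greater(1) by blast
  qed
  finally show ?thesis .
qed

text \<open>
  The direct sum \<open>Q'\<close> of the involution of the restriction and of the involution of the base point
  satisfies \<open>Q'X = X\<sigma>\<close>, which determines it because \<open>X\<close> is invertible.
\<close>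
lemma involution_blocks:
  assumes SX: "slice_point r s \<beta> X GX" and SY: "slice_point p q \<alpha> Y GY"
    and Y: "restricts X Y" and triv: "trivial_outside X"
  defines "QX \<equiv> slice_point.Q r s \<beta> X GX" and "QY \<equiv> slice_point.Q p q \<alpha> Y GY"
  shows "\<And>u v. u \<in> V \<Longrightarrow> v \<in> V \<Longrightarrow> QX (\<iota> u) (\<iota> v) = QY u v"
    "\<And>u v. u \<in> W \<Longrightarrow> v \<in> W \<Longrightarrow> (u \<in> I) \<noteq> (v \<in> I) \<Longrightarrow> QX u v = 0"
    "\<And>u v. u \<in> W \<Longrightarrow> v \<in> W \<Longrightarrow> u \<notin> I \<Longrightarrow> v \<notin> I \<Longrightarrow> QX u v \<noteq> 0 \<longleftrightarrow> v = partner \<beta> u"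
proof -
  interpret SX: slice_point r s \<beta> X GX by (rule SX)
  interpret SY: slice_point p q \<alpha> Y GY by (rule SY)
  let ?pre = "the_inv_into V \<iota>"
  have pre: "?pre (\<iota> u) = u" if "u \<in> V" for u
    by (rule the_inv_into_f_f[OF inj_embed that])
  \<comment> \<open>Outside, row \<open>u\<close> of the involution of the base point has its only entry, \<open>eps u\<close>, in column \<open>\<tau> u\<close>.\<close>
  define Q' where "Q' u v = (if u \<in> I then if v \<in> I then QY (?pre u) (?pre v) else 0
      else if v = partner \<beta> u then SX.eps u else 0)" for u v
  have sgI: "SY.sg v = SX.sg (\<iota> v)" if "v \<in> V" for v
    using embed_side[OF that, of True] by (simp add: SX.sg_def SY.sg_def)
  have W: "W = I \<union> (W - I)" "I \<inter> (W - I) = {}" using embed_in by auto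
  have main: "(\<Sum>k\<in>W. Q' u k * X k v) = X u v * SX.sg v" if u: "u \<in> W" and v: "v \<in> W" for u v
  proof (cases "u \<in> I")
    case True
    then obtain a where a: "a \<in> V" "u = \<iota> a" by auto
    have "(\<Sum>k\<in>W. Q' u k * X k v) = (\<Sum>k\<in>I. Q' u k * X k v) + (\<Sum>k\<in>W - I. Q' u k * X k v)"
      by (subst W(1), rule sum.union_disjoint[OF _ _ W(2)]) simp_all
    also have "(\<Sum>k\<in>W - I. Q' u k * X k v) = 0" using True by (intro sum.neutral) (simp add: Q'_def)
    also have "(\<Sum>k\<in>I. Q' u k * X k v) = (\<Sum>k\<in>V. Q' u (\<iota> k) * X (\<iota> k) v)"
      using sum.reindex[OF inj_embed, of "\<lambda>k. Q' u k * X k v"] by simp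
    also have "\<dots> = (\<Sum>k\<in>V. QY a k * X (\<iota> k) v)"
    proof (rule sum.cong[OF refl])
      fix k assume k: "k \<in> V"
      then have "\<iota> k \<in> I" by simp
      then have "Q' u (\<iota> k) = QY (?pre u) (?pre (\<iota> k))" unfolding Q'_def using True by simp
      also have "\<dots> = QY a k" unfolding a(2) pre[OF a(1)] pre[OF k] ..
      finally show "Q' u (\<iota> k) * X (\<iota> k) v = QY a k * X (\<iota> k) v" by simp
    qed
    finally have e: "(\<Sum>k\<in>W. Q' u k * X k v) = (\<Sum>k\<in>V. QY a k * X (\<iota> k) v)" by simp
    show ?thesis
    proof (cases "v \<in> I")
      case True
      then obtain b where b: "b \<in> V" "v = \<iota> b" by auto
      have "(\<Sum>k\<in>V. QY a k * X (\<iota> k) v) = (\<Sum>k\<in>V. QY a k * Y k b)"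
        using restrictsD[OF Y _ b(1)] b by (intro sum.cong) simp_all
      also have "\<dots> = Y a b * SY.sg b" unfolding QY_def by (rule SY.QX[OF b(1)])
      also have "\<dots> = X u v * SX.sg v" using restrictsD[OF Y a(1) b(1)] a b sgI by simp
      finally show ?thesis using e by simp
    next
      case False
      have "(\<Sum>k\<in>V. QY a k * X (\<iota> k) v) = 0"
        using trivial_outside_mixed[OF triv _ v] embed_in False by (intro sum.neutral) simp
      moreover have "X u v = 0" using trivial_outside_mixed[OF triv u v] True False by simp
      ultimately show ?thesis using e by simp
    qed
  next
    case False
    have \<tau>u: "partner \<beta> u \<in> W" "partner \<beta> u \<notin> I" "partner \<beta> (partner \<beta> u) = u"
      using big.partner_in_V[OF u] partner_image_iff[OF u] False big.partner_partner[OF u] by simp_all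
    have "(\<Sum>k\<in>W. Q' u k * X k v) = (\<Sum>k\<in>W. if k = partner \<beta> u then SX.eps u * X k v else 0)"
      using False by (intro sum.cong) (simp_all add: Q'_def)
    also have "\<dots> = SX.eps u * X (partner \<beta> u) v" using \<tau>u by simp
    also have "\<dots> = SX.eps u * base_entry \<beta> (partner \<beta> u) v" using trivial_outsideD[OF triv \<tau>u(1) v] \<tau>u by simp
    also have "\<dots> = base_entry \<beta> u v * SX.sg v"
    proof (cases "v = u \<or> v = partner \<beta> u")
      case True
      show ?thesis using u
      proof (cases rule: big.vertex_cases)
        case (left b)
        have sg: "SX.sg u = 1" "SX.sg b = - 1"
          using big.left_side[OF left(1), of True] big.right_side[OF left(1), of True] by (simp_all add: SX.sg_def)
        have "(b, u) \<notin> big.m" using big.matching_bounds[of b u] left(2) by auto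
        then have base: "base_entry \<beta> b u = - 1" "base_entry \<beta> u u = 1" "base_entry \<beta> b b = 1" "base_entry \<beta> u b = 1"
          using left(1,2) by (simp_all add: base_entry_def)
        have "SX.eps u = - 1" using left(2,8) by (simp add: SX.eps_def)
        then show ?thesis using True sg base unfolding left(8) by (elim disjE) simp_all
      next
        case (right a)
        have sg: "SX.sg a = 1" "SX.sg u = - 1"
          using big.left_side[OF right(1), of True] big.right_side[OF right(1), of True] by (simp_all add: SX.sg_def)
        have "(u, a) \<notin> big.m" using big.matching_bounds[of u a] right(2) by auto
        then have base: "base_entry \<beta> a u = 1" "base_entry \<beta> u u = 1" "base_entry \<beta> a a = 1" "base_entry \<beta> u a = - 1"
          using right(1,2) by (simp_all add: base_entry_def)
        have "SX.eps u = - 1" using right(2,8) by (simp add: SX.eps_def)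
        then show ?thesis using True sg base unfolding right(8) by (elim disjE) simp_all
      next
        case plus
        then show ?thesis using True by (simp add: SX.eps_def base_entry_def)
      next
        case minus
        then show ?thesis using True by (simp add: SX.eps_def base_entry_def)
      qed
    next
      case False
      have "base_entry \<beta> u v = 0"
      proof (rule ccontr)
        assume "base_entry \<beta> u v \<noteq> 0"
        then have "u = v \<or> u = partner \<beta> v" by (rule big.base_entry_nonzero)
        then show False using False big.partner_partner[OF v] by (elim disjE) simp_all
      qed
      moreover have "base_entry \<beta> (partner \<beta> u) v = 0"
      proof (rule ccontr)
        assume "base_entry \<beta> (partner \<beta> u) v \<noteq> 0"
        then have c: "partner \<beta> u = v \<or> partner \<beta> u = partner \<beta> v" by (rule big.base_entry_nonzero)
        have "partner \<beta> u \<noteq> partner \<beta> v"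
        proof
          assume "partner \<beta> u = partner \<beta> v"
          from arg_cong[OF this, of "partner \<beta>"] show False using False \<tau>u(3) big.partner_partner[OF v] by simp
        qed
        then show False using False c by simp
      qed
      ultimately show ?thesis by simp
    qed
    also have "\<dots> = X u v * SX.sg v" using trivial_outsideD[OF triv u v] False by simp
    finally show ?thesis .
  qed
  have QX_eq: "QX u c = Q' u c" if u: "u \<in> W" and c: "c \<in> W" for u c
  proof -
    have "QX u c = (\<Sum>v\<in>W. (\<Sum>k\<in>W. Q' u k * X k v) * GX v c)"
      unfolding QX_def SX.Q_def using main[OF u] by (intro sum.cong) simp_all
    also have "\<dots> = (\<Sum>k\<in>W. Q' u k * (\<Sum>v\<in>W. X k v * GX v c))"
      unfolding sum_distrib_left sum_distrib_right by (subst sum.swap) (simp add: mult_ac)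
    also have "\<dots> = (\<Sum>k\<in>W. if k = c then Q' u k else 0)"
      using SX.XG[OF _ c] by (intro sum.cong) simp_all
    also have "\<dots> = Q' u c" using c by simp
    finally show ?thesis .
  qed
  show "QX (\<iota> u) (\<iota> v) = QY u v" if "u \<in> V" "v \<in> V" for u v
  proof -
    have "\<iota> u \<in> I" "\<iota> v \<in> I" using that by simp_all
    then have "Q' (\<iota> u) (\<iota> v) = QY (?pre (\<iota> u)) (?pre (\<iota> v))" unfolding Q'_def by simp
    also have "\<dots> = QY u v" unfolding pre[OF that(1)] pre[OF that(2)] ..
    finally show ?thesis using QX_eq[OF embed_in[OF that(1)] embed_in[OF that(2)]] by simp
  qed
  show "QX u v = 0" if "u \<in> W" "v \<in> W" "(u \<in> I) \<noteq> (v \<in> I)" for u v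
  proof (cases "u \<in> I")
    case True
    then show ?thesis using QX_eq[OF that(1,2)] that(3) by (simp add: Q'_def)
  next
    case False
    then have vI: "v \<in> I" and \<tau>u: "partner \<beta> u \<notin> I" using that(3) partner_image_iff[OF that(1)] by simp_all
    have "v \<noteq> partner \<beta> u"
    proof
      assume "v = partner \<beta> u"
      then show False using vI \<tau>u by simp
    qed
    then show ?thesis using QX_eq[OF that(1,2)] False by (simp add: Q'_def)
  qed
  show "QX u v \<noteq> 0 \<longleftrightarrow> v = partner \<beta> u" if "u \<in> W" "v \<in> W" "u \<notin> I" "v \<notin> I" for u v
    using QX_eq[OF that(1,2)] that(3) by (simp add: Q'_def SX.eps_def SX.sg_def)
qed

text \<open>
  The outer part of \<open>Q\<close> is monomial with support \<open>(\<tau> c, c)\<close>, so an outer column is nonzero in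
  the block exactly if its partner lies after \<open>j\<close>.
\<close>
lemma block_rank_iff:
  assumes SX: "slice_point r s \<beta> X GX" and SY: "slice_point p q \<alpha> Y GY"
    and Y: "restricts X Y" and triv: "trivial_outside X" and ij: "i \<le> j" "j \<le> r + s"
  defines "QX \<equiv> slice_point.Q r s \<beta> X GX" and "QY \<equiv> slice_point.Q p q \<alpha> Y GY"
  shows "rank_at_most {j<..r + s} {1..i} QX (k + card {c \<in> W - I. c \<le> i \<and> j < partner \<beta> c}) \<longleftrightarrow>
    rank_at_most {low j<..p + q} {1..low i} QY k"
proof -
  note blocks = involution_blocks[OF SX SY Y triv, folded QX_def QY_def]
  let ?R = "{j<..r + s}" and ?C = "{1..i}"
  let ?E = "{c \<in> W - I. c \<le> i \<and> j < partner \<beta> c}"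
  have RW: "?R \<subseteq> W" and CW: "?C \<subseteq> W" using ij by auto
  have split: "?R \<inter> I \<union> (?R - I) = ?R" "?C \<inter> I \<union> (?C - I) = ?C" by auto
  have "rank_at_most ?R ?C QX (k + card ?E) \<longleftrightarrow>
      rank_at_most (?R \<inter> I \<union> (?R - I)) (?C \<inter> I \<union> (?C - I)) QX (k + card ?E)"
    unfolding split ..
  also have "\<dots> \<longleftrightarrow> rank_at_most (?R \<inter> I) (?C \<inter> I) QX k"
  proof (rule rank_at_most_direct_sum[where E="?E" and \<rho>="partner \<beta>"])
    show "QX u c = 0" if "u \<in> ?R \<inter> I" "c \<in> ?C - I" for u c
      using blocks(2)[of u c] that RW CW by blast
    show "QX u c = 0" if "u \<in> ?R - I" "c \<in> ?C \<inter> I" for u c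
      using blocks(2)[of u c] that RW CW by blast
    show "QX u c = 0" if u: "u \<in> ?R - I" and c: "c \<in> ?C - I - ?E" for u c
    proof (rule ccontr)
      have V: "u \<in> W" "c \<in> W" using u c RW CW by auto
      assume "QX u c \<noteq> 0"
      then have "c = partner \<beta> u" using blocks(3)[OF V] u c by simp
      then have "partner \<beta> c = u" using big.partner_partner[OF V(1)] by simp
      then show False using u c V by auto
    qed
    show "?E \<subseteq> ?C - I" by auto
    fix c assume c: "c \<in> ?E"
    then have cW: "c \<in> W" "c \<notin> I" by auto
    have \<tau>c: "partner \<beta> c \<in> W" "partner \<beta> c \<notin> I" "partner \<beta> (partner \<beta> c) = c"
      using big.partner_in_V[OF cW(1)] partner_image_iff[OF cW(1)] cW big.partner_partner[OF cW(1)] by simp_all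
    show "partner \<beta> c \<in> ?R - I" using c \<tau>c by simp
    show "QX (partner \<beta> c) c \<noteq> 0" using blocks(3)[OF \<tau>c(1) cW(1) \<tau>c(2) cW(2)] \<tau>c(3) by simp
    fix e assume e: "e \<in> ?E" "c \<noteq> e"
    then have eW: "e \<in> W" "e \<notin> I" by auto
    show "QX (partner \<beta> c) e = 0" using blocks(3)[OF \<tau>c(1) eW(1) \<tau>c(2) eW(2)] \<tau>c(3) e(2) by auto
  qed auto
  also have "\<dots> \<longleftrightarrow> rank_at_most {low j<..p + q} {1..low i} QY k"
  proof (rule rank_at_most_reindex[symmetric])
    have "inj_on \<iota> {1..low i}" by (rule inj_on_subset[OF inj_embed image_upto(1)])
    then show "bij_betw \<iota> {1..low i} (?C \<inter> I)" using image_upto(2) by (simp add: bij_betw_def)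
    show "\<iota> ` {low j<..p + q} = ?R \<inter> I" by (rule image_greater)
    fix u d assume "u \<in> {low j<..p + q}" "d \<in> {1..low i}"
    then have "u \<in> V" "d \<in> V" using image_greater(1) image_upto(1) by blast+
    then show "QY u d = QX (\<iota> u) (\<iota> d)" using blocks(1) by simp
  qed
  finally show ?thesis .
qed

end

section \<open>Interval pattern containment\<close>

context pq_clan
begin

text \<open>
  The vertex whose column is the column \<open>c\<close> of the matrix.
\<close>
definition vertex_at :: "nat \<Rightarrow> nat" where "vertex_at c = the_inv_into V w c"

lemma vertex_at_perm: "v \<in> V \<Longrightarrow> vertex_at (w v) = v"
  unfolding vertex_at_def by (rule the_inv_into_f_f[OF bij_betw_imp_inj_on[OF perm_bij]])

lemma vertex_at:
  assumes c: "c \<in> V" shows "vertex_at c \<in> V" "w (vertex_at c) = c"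
proof -
  have "c \<in> w ` V" using c bij_betw_imp_surj_on[OF perm_bij] by simp
  then obtain v where v: "v \<in> V" "c = w v" by auto
  then show "vertex_at c \<in> V" "w (vertex_at c) = c" using vertex_at_perm by simp_all
qed

lemma mat_eq_by_vertices:
  assumes "A \<in> carrier_mat (p + q) (p + q)" "B \<in> carrier_mat (p + q) (p + q)"
    and e: "\<And>u v. u \<in> V \<Longrightarrow> v \<in> V \<Longrightarrow> by_vertices p \<gamma> A u v = by_vertices p \<gamma> B u v"
  shows "A = B"
proof (rule eq_matI)
  fix i j assume "i < dim_row B" "j < dim_col B"
  then have V: "i + 1 \<in> V" "j + 1 \<in> V" using assms(2) by auto
  show "A $$ (i, j) = B $$ (i, j)"
    using e[OF V(1) vertex_at(1)[OF V(2)]] vertex_at(2)[OF V(2)] by (simp add: by_vertices_def)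
qed (use assms in auto)

lemma by_vertices_mat:
  assumes "u \<in> V" "v \<in> V"
  shows "by_vertices p \<gamma> (mat (p + q) (p + q) (\<lambda>(i, j). f (i + 1) (vertex_at (j + 1)))) u v = f u v"
proof -
  have "w v \<in> V" using perm_in_V[OF assms(2)] .
  then have "u - 1 < p + q" "w v - 1 < p + q" "u - 1 + 1 = u" "w v - 1 + 1 = w v" using assms(1) by auto
  then show ?thesis using vertex_at_perm[OF assms(2)] by (simp add: by_vertices_def)
qed

end

locale interval_embedding = lower: clan_embedding p q \<alpha> r s \<beta> \<iota> + upper: clan_embedding p q \<gamma> r s \<theta> \<iota>
  for p q \<alpha> \<gamma> r s \<beta> \<theta> \<iota> +
  assumes agree: "agree_outside (\<iota> ` {1..p + q}) \<theta> \<beta>"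
    and length_eq: "clan_length \<theta> - clan_length \<beta> = clan_length \<gamma> - clan_length \<alpha>"
begin

abbreviation "W \<equiv> {1..r + s}"
abbreviation "V \<equiv> {1..p + q}"
abbreviation "I \<equiv> \<iota> ` {1..p + q}"

lemma outer_eq: "upper.outer = lower.outer"
  using agree unfolding agree_outside_def lower.outer_def upper.outer_def by simp

lemma outer_signs_eq: "upper.outer_signs = lower.outer_signs"
  using agree unfolding agree_outside_def lower.outer_signs_def upper.outer_signs_def by (simp only: Un_Diff)

lemma matchings_outside: "x \<notin> I \<or> y \<notin> I \<Longrightarrow> (x, y) \<in> matchings \<theta> \<longleftrightarrow> (x, y) \<in> matchings \<beta>"
proof -
  assume o: "x \<notin> I \<or> y \<notin> I"
  have "(x, y) \<in> upper.outer \<longleftrightarrow> (x, y) \<in> lower.outer" unfolding outer_eq ..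
  then show ?thesis using o unfolding lower.outer_def upper.outer_def by simp
qed

lemma signs_outside:
  assumes "x \<notin> I" shows "x \<in> plus_signs \<theta> \<longleftrightarrow> x \<in> plus_signs \<beta>" "x \<in> minus_signs \<theta> \<longleftrightarrow> x \<in> minus_signs \<beta>"
proof -
  have "x \<in> plus_signs \<theta> - I \<longleftrightarrow> x \<in> plus_signs \<beta> - I" "x \<in> minus_signs \<theta> - I \<longleftrightarrow> x \<in> minus_signs \<beta> - I"
    using agree unfolding agree_outside_def by simp_all
  then show "x \<in> plus_signs \<theta> \<longleftrightarrow> x \<in> plus_signs \<beta>" "x \<in> minus_signs \<theta> \<longleftrightarrow> x \<in> minus_signs \<beta>"
    using assms by simp_all
qed

lemma ends_outside:
  assumes "x \<notin> I" shows "x \<in> left_ends \<theta> \<longleftrightarrow> x \<in> left_ends \<beta>" "x \<in> right_ends \<theta> \<longleftrightarrow> x \<in> right_ends \<beta>"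
proof -
  have "x \<in> left_ends \<theta> \<longleftrightarrow> (\<exists>y. (x, y) \<in> matchings \<theta>)" "x \<in> left_ends \<beta> \<longleftrightarrow> (\<exists>y. (x, y) \<in> matchings \<beta>)"
    by (auto intro: lower.big.left_endsI upper.big.left_endsI elim: lower.big.left_endsE upper.big.left_endsE)
  then show "x \<in> left_ends \<theta> \<longleftrightarrow> x \<in> left_ends \<beta>" using matchings_outside assms by simp
  have "x \<in> right_ends \<theta> \<longleftrightarrow> (\<exists>y. (y, x) \<in> matchings \<theta>)" "x \<in> right_ends \<beta> \<longleftrightarrow> (\<exists>y. (y, x) \<in> matchings \<beta>)"
    by (auto intro: lower.big.right_endsI upper.big.right_endsI elim: lower.big.right_endsE upper.big.right_endsE)
  then show "x \<in> right_ends \<theta> \<longleftrightarrow> x \<in> right_ends \<beta>" using matchings_outside assms by simp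
qed

lemma side_outside: "x \<notin> I \<Longrightarrow> x \<in> side T \<theta> \<longleftrightarrow> x \<in> side T \<beta>"
  using signs_outside[of x] ends_outside[of x] by (cases T) (simp_all add: side_def)

lemma partner_outside:
  assumes x: "x \<in> W" "x \<notin> I" shows "partner \<theta> x = partner \<beta> x"
  using x(1)
proof (cases rule: lower.big.vertex_cases)
  case plus
  then show ?thesis using upper.big.partner_sign[of x] signs_outside[OF x(2)] by simp
next
  case minus
  then show ?thesis using upper.big.partner_sign[of x] signs_outside[OF x(2)] by simp
next
  case (left b)
  then have "(x, b) \<in> matchings \<theta>" using matchings_outside[of x b] x(2) by simp
  then show ?thesis using upper.big.partner_left left by simp
next
  case (right a)
  then have "(a, x) \<in> matchings \<theta>" using matchings_outside[of a x] x(2) by simp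
  then show ?thesis using upper.big.partner_right right by simp
qed

lemma beyond_outside: "{v \<in> side T \<theta> - I. i < hi \<theta> v} = {v \<in> side T \<beta> - I. i < hi \<beta> v}"
proof (rule Collect_cong)
  fix v
  show "v \<in> side T \<theta> - I \<and> i < hi \<theta> v \<longleftrightarrow> v \<in> side T \<beta> - I \<and> i < hi \<beta> v"
  proof (cases "v \<in> side T \<beta> - I")
    case True
    then have vs: "v \<in> side T \<beta>" "v \<notin> I" by simp_all
    have "v \<in> W" by (rule lower.big.side_in_V[OF vs(1)])
    then show ?thesis using True side_outside[OF vs(2), of T] partner_outside[OF _ vs(2)] by (simp add: hi_def)
  next
    case False
    then show ?thesis using side_outside by auto
  qed
qed

lemma crossing_outside: "{c \<in> W - I. c \<le> i \<and> j < partner \<theta> c} = {c \<in> W - I. c \<le> i \<and> j < partner \<beta> c}"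
  using partner_outside by auto

lemma beyond_shift:
  "beyond T \<theta> i = beyond T \<gamma> (lower.low i) + card {v \<in> side T \<beta> - I. i < hi \<beta> v}"
  using upper.beyond_split[of T i] unfolding beyond_outside .

lemma crossing_shift:
  "i \<le> j \<Longrightarrow> crossing_count \<theta> i j = crossing_count \<gamma> (lower.low i) (lower.low j) + card {c \<in> W - I. c \<le> i \<and> j < partner \<beta> c}"
  using upper.crossing_split[of i j] unfolding crossing_outside .

text \<open>
  A section of \<open>low\<close>: it chooses for each position of the small clan one of the big clan.
\<close>
definition up :: "nat \<Rightarrow> nat" where "up i = (if i = 0 then 0 else \<iota> i)"

lemma up: "i \<le> p + q \<Longrightarrow> lower.low (up i) = i \<and> up i \<le> r + s"
  using lower.low_zero lower.low_embed[of i] lower.embed_in[of i] by (auto simp: up_def)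

lemma up_mono: "i \<le> j \<Longrightarrow> j \<le> p + q \<Longrightarrow> up i \<le> up j"
  using lower.embed_le[of i j] by (auto simp: up_def)

text \<open>
  The combinatorial form of the Bruhat order between \<open>\<alpha>\<close> and \<open>\<gamma>\<close>.
\<close>
definition dominated :: bool where
  "dominated \<longleftrightarrow> (\<forall>T. \<forall>i\<le>p + q. beyond T \<alpha> i \<le> beyond T \<gamma> i) \<and>
     (\<forall>i j. i \<le> j \<longrightarrow> j \<le> p + q \<longrightarrow> crossing_count \<alpha> i j \<le> crossing_count \<gamma> i j)"

text \<open>
  The lower bounds from the slice of \<open>\<beta>\<close> meet the upper bounds from \<open>\<theta>\<close>; both pairs of clans have
  the same outside contribution, so it cancels.
\<close>
lemma dominated_if_nonempty:
  assumes A: "A \<in> mars_springer r s \<theta> \<beta>" shows dominated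
proof -
  have sl: "A \<in> slice r s \<beta>" and R: "rank_conds (r + s) \<theta> \<beta> (by_vertices r \<beta> A) (lower.big.involution A)"
    using A lower.big.mars_springer_iff[OF upper.big.clan] by simp_all
  interpret S: slice_point r s \<beta> "by_vertices r \<beta> A" "lower.big.inverse_by_vertices A"
    by (rule lower.big.slice_point_of[OF sl])
  show ?thesis
    unfolding dominated_def
  proof (intro conjI allI impI)
    fix T i assume "i \<le> p + q"
    then have u: "lower.low (up i) = i" "up i \<le> r + s" using up by simp_all
    have "beyond T \<beta> (up i) \<le> beyond T \<theta> (up i)" using R u unfolding rank_conds_def by (intro S.beyond_le) simp
    then show "beyond T \<alpha> i \<le> beyond T \<gamma> i"
      using beyond_shift[of T "up i"] lower.beyond_split[of T "up i"] u by simp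
  next
    fix i j assume ij: "i \<le> j" "j \<le> p + q"
    then have u: "lower.low (up i) = i" "lower.low (up j) = j" "up j \<le> r + s" "up i \<le> up j" using up up_mono by simp_all
    have "crossing_count \<beta> (up i) (up j) \<le> crossing_count \<theta> (up i) (up j)"
      using R u unfolding rank_conds_def lower.big.involution_def by (intro S.crossing_le[OF u(4)]) simp
    then show "crossing_count \<alpha> i j \<le> crossing_count \<gamma> i j"
      using crossing_shift[OF u(4)] lower.crossing_split[OF u(4)] u by simp
  qed
qed

text \<open>
  The two length formulas have the same constant, so the hypothesis on lengths says that the sum of
  the differences of the counts is zero; each difference is nonnegative.
\<close>
lemma crossing_equal:
  assumes dom: dominated
  shows "\<And>k. k \<in> lower.outer_signs \<Longrightarrow>
      crossing_count \<gamma> (lower.low k) (lower.low k) = crossing_count \<alpha> (lower.low k) (lower.low k)"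
    "\<And>B. B \<in> lower.outer \<Longrightarrow>
      crossing_count \<gamma> (lower.low (fst B)) (lower.low (snd B)) = crossing_count \<alpha> (lower.low (fst B)) (lower.low (snd B))"
proof -
  define f where "f i j = int (crossing_count \<gamma> (lower.low i) (lower.low j)) - int (crossing_count \<alpha> (lower.low i) (lower.low j))" for i j
  have f0: "0 \<le> f i j" if "i \<le> j" for i j
    using dom lower.low_mono[OF that] lower.low_le[of j] unfolding dominated_def f_def by simp
  have fin: "finite lower.outer_signs" "finite lower.outer"
    using lower.finite_outer lower.big.finite_parts unfolding lower.outer_signs_def by simp_all
  have le: "fst B \<le> snd B" if "B \<in> lower.outer" for B
    using lower.outerD[of "fst B" "snd B"] lower.big.matching_bounds[of "fst B" "snd B"] that by simp
  have "(\<Sum>k\<in>lower.outer_signs. f k k) + 2 * (\<Sum>B\<in>lower.outer. f (fst B) (snd B)) = 0"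
    using upper.clan_length_split lower.clan_length_split length_eq
    unfolding outer_eq outer_signs_eq f_def sum_subtractf by simp
  moreover have "0 \<le> (\<Sum>k\<in>lower.outer_signs. f k k)" "0 \<le> (\<Sum>B\<in>lower.outer. f (fst B) (snd B))"
    using f0 le by (simp_all add: sum_nonneg)
  ultimately have z: "(\<Sum>k\<in>lower.outer_signs. f k k) = 0" "(\<Sum>B\<in>lower.outer. f (fst B) (snd B)) = 0" by simp_all
  show "crossing_count \<gamma> (lower.low k) (lower.low k) = crossing_count \<alpha> (lower.low k) (lower.low k)"
    if "k \<in> lower.outer_signs" for k
  proof -
    have "f k k = 0" using z(1) sum_nonneg_eq_0_iff[OF fin(1), of "\<lambda>k. f k k"] f0 that by simp
    then show ?thesis by (simp add: f_def)
  qed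
  show "crossing_count \<gamma> (lower.low (fst B)) (lower.low (snd B)) = crossing_count \<alpha> (lower.low (fst B)) (lower.low (snd B))"
    if "B \<in> lower.outer" for B
  proof -
    have "f (fst B) (snd B) = 0" using z(2) sum_nonneg_eq_0_iff[OF fin(2), of "\<lambda>B. f (fst B) (snd B)"] f0 le that by simp
    then show ?thesis by (simp add: f_def)
  qed
qed

text \<open>
  By \<open>beyond_sum\<close> the counts on the two sides add up to a crossing count and a constant. At an outer
  sign the crossing counts agree, and neither count is smaller for \<open>\<theta>\<close> than for \<open>\<beta>\<close>, so neither
  differs. The position \<open>k - 1\<close> has the same embedded vertices to its left as \<open>k\<close>.
\<close>
lemma beyond_equal_sign:
  assumes dom: dominated and k: "k \<in> lower.outer_signs" and i: "i = k \<or> i = k - 1"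
  shows "beyond T \<theta> i = beyond T \<beta> i"
proof -
  have kI: "k \<notin> I" "k \<in> W" using k lower.outer_vertices(1) by auto
  have low: "lower.low i = lower.low k" using i lower.low_pred[OF kI(1)] by auto
  have le: "i \<le> r + s" "lower.low i \<le> p + q" using i kI lower.low_le by auto
  have cr: "crossing_count \<gamma> (lower.low i) (lower.low i) = crossing_count \<alpha> (lower.low i) (lower.low i)"
    using crossing_equal(1)[OF dom k] low by simp
  have d: "beyond T \<alpha> (lower.low i) \<le> beyond T \<gamma> (lower.low i)" for T
    using dom le unfolding dominated_def by simp
  have "beyond True \<gamma> (lower.low i) + beyond False \<gamma> (lower.low i) = beyond True \<alpha> (lower.low i) + beyond False \<alpha> (lower.low i)"
    using upper.small.beyond_sum[OF le(2)] lower.small.beyond_sum[OF le(2)] cr by simp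
  then have "beyond T \<gamma> (lower.low i) = beyond T \<alpha> (lower.low i)" using d[of True] d[of False] by (cases T) simp_all
  then show ?thesis using beyond_shift[of T i] lower.beyond_split[of T i] by simp
qed

lemma crossing_equal_arc:
  assumes dom: dominated and xy: "(x, y) \<in> lower.outer"
  shows "crossing_count \<theta> x y = crossing_count \<beta> x y"
    "crossing_count \<theta> (x - 1) (y - 1) = crossing_count \<beta> (x - 1) (y - 1)"
proof -
  have o: "x \<notin> I" "y \<notin> I" "(x, y) \<in> matchings \<beta>" using lower.outerD[OF xy] by simp_all
  have "x < y" using lower.big.matching_bounds[OF o(3)] by simp
  then have le: "x \<le> y" "x - 1 \<le> y - 1" by linarith+
  note e = crossing_equal(2)[OF dom xy, unfolded fst_conv snd_conv]
  show "crossing_count \<theta> x y = crossing_count \<beta> x y"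
    using crossing_shift[OF le(1)] lower.crossing_split[OF le(1)] e by simp
  show "crossing_count \<theta> (x - 1) (y - 1) = crossing_count \<beta> (x - 1) (y - 1)"
    using crossing_shift[OF le(2)] lower.crossing_split[OF le(2)] e lower.low_pred[OF o(1)] lower.low_pred[OF o(2)] by simp
qed

text \<open>
  The counts agree at every outside vertex, so the rank conditions of \<open>\<theta>\<close> there are the equality
  cases for \<open>\<beta>\<close>, which make the row and the column of that vertex trivial.
\<close>
lemma trivial_outside_point:
  assumes dom: dominated and A: "A \<in> mars_springer r s \<theta> \<beta>"
  shows "lower.trivial_outside (by_vertices r \<beta> A)"
proof -
  let ?X = "by_vertices r \<beta> A"
  have sl: "A \<in> slice r s \<beta>" and R: "rank_conds (r + s) \<theta> \<beta> ?X (lower.big.involution A)"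
    using A lower.big.mars_springer_iff[OF upper.big.clan] by simp_all
  interpret S: slice_point r s \<beta> ?X "lower.big.inverse_by_vertices A"
    by (rule lower.big.slice_point_of[OF sl])
  have R1: "rank_at_most {i<..r + s} (side T \<beta>) ?X (beyond T \<theta> i)" if "i \<le> r + s" for T i
    using R that unfolding rank_conds_def by simp
  have R3: "rank_at_most {j<..r + s} {1..i} S.Q (crossing_count \<theta> i j)" if "i \<le> j" "j \<le> r + s" for i j
    using R that unfolding rank_conds_def lower.big.involution_def by simp
  have main: "?X x u = base_entry \<beta> x u \<and> ?X u x = base_entry \<beta> u x" if x: "x \<in> W - I" and u: "u \<in> W" for x u
  proof -
    have "x \<in> lower.outer_signs \<union> (fst ` lower.outer \<union> snd ` lower.outer)"
      unfolding lower.outer_vertices(1)[symmetric] by (rule x)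
    then consider "x \<in> lower.outer_signs" | y where "(x, y) \<in> lower.outer" | y where "(y, x) \<in> lower.outer" by auto
    then show ?thesis
    proof cases
      case 1
      have xW: "x \<in> W" using x by simp
      have sx: "partner \<beta> x = x" using 1 lower.big.partner_sign[of x] unfolding lower.outer_signs_def by simp
      show ?thesis
      proof (cases "u = x")
        case True
        then show ?thesis using lower.big.in_slice_diag[OF S.slice xW] by (simp add: base_entry_def)
      next
        case False
        have le: "x \<le> r + s" "x - 1 \<le> r + s" using xW by auto
        have rk: "rank_at_most {x<..r + s} (side T \<beta>) ?X (beyond T \<beta> x)"
          "rank_at_most {x - 1<..r + s} (side T \<beta>) ?X (beyond T \<beta> (x - 1))" for T
          using R1[OF le(1), of T] R1[OF le(2), of T] beyond_equal_sign[OF dom 1, of x T]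
            beyond_equal_sign[OF dom 1, of "x - 1" T] by simp_all
        have ne: "x \<noteq> partner \<beta> u"
        proof
          assume "x = partner \<beta> u"
          then have "partner \<beta> x = u" using lower.big.partner_partner[OF u] by simp
          then show False using sx False by simp
        qed
        have "?X u x = 0" "?X x u = 0" using S.sign_row_column_trivial[OF xW sx rk u False] by simp_all
        moreover have "base_entry \<beta> u x = 0" "base_entry \<beta> x u = 0"
          using lower.big.base_entry_nonzero[of u x] lower.big.base_entry_nonzero[of x u] False sx ne by auto
        ultimately show ?thesis by simp
      qed
    next
      case (2 y)
      have xy: "(x, y) \<in> matchings \<beta>" using lower.outerD[OF 2] by simp
      have b: "x \<le> y" "x - 1 \<le> y - 1" "y \<le> r + s" "y - 1 \<le> r + s" using lower.big.matching_bounds[OF xy] by auto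
      note S.arc_trivial[OF xy R3[OF b(1,3), unfolded crossing_equal_arc(1)[OF dom 2]]
          R3[OF b(2,4), unfolded crossing_equal_arc(2)[OF dom 2]] u]
      then show ?thesis by simp
    next
      case (3 y)
      have xy: "(y, x) \<in> matchings \<beta>" using lower.outerD[OF 3] by simp
      have b: "y \<le> x" "y - 1 \<le> x - 1" "x \<le> r + s" "x - 1 \<le> r + s" using lower.big.matching_bounds[OF xy] by auto
      note S.arc_trivial[OF xy R3[OF b(1,3), unfolded crossing_equal_arc(1)[OF dom 3]]
          R3[OF b(2,4), unfolded crossing_equal_arc(2)[OF dom 3]] u]
      then show ?thesis by simp
    qed
  qed
  show ?thesis
    unfolding lower.trivial_outside_def
  proof (intro ballI impI)
    fix u v assume "u \<in> W" "v \<in> W" "u \<notin> I \<or> v \<notin> I"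
    then show "?X u v = base_entry \<beta> u v" using main[of u v] main[of v u] by auto
  qed
qed

lemma rank_conds_iff:
  assumes SX: "slice_point r s \<beta> X GX" and SY: "slice_point p q \<alpha> Y GY"
    and Y: "lower.restricts X Y" and triv: "lower.trivial_outside X"
  shows "rank_conds (r + s) \<theta> \<beta> X (slice_point.Q r s \<beta> X GX) \<longleftrightarrow>
    rank_conds (p + q) \<gamma> \<alpha> Y (slice_point.Q p q \<alpha> Y GY)"
proof -
  let ?QX = "slice_point.Q r s \<beta> X GX" and ?QY = "slice_point.Q p q \<alpha> Y GY"
  have 1: "rank_at_most {i<..r + s} (side T \<beta>) X (beyond T \<theta> i) \<longleftrightarrow>
      rank_at_most {lower.low i<..p + q} (side T \<alpha>) Y (beyond T \<gamma> (lower.low i))" for T i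
    unfolding beyond_shift by (rule lower.side_rank_iff[OF Y triv])
  have 2: "rank_at_most {j<..r + s} {1..i} ?QX (crossing_count \<theta> i j) \<longleftrightarrow>
      rank_at_most {lower.low j<..p + q} {1..lower.low i} ?QY (crossing_count \<gamma> (lower.low i) (lower.low j))"
    if ij: "i \<le> j" "j \<le> r + s" for i j
    unfolding crossing_shift[OF ij(1)] by (rule lower.block_rank_iff[OF SX SY Y triv ij])
  show ?thesis
  proof
    assume L: "rank_conds (r + s) \<theta> \<beta> X ?QX"
    show "rank_conds (p + q) \<gamma> \<alpha> Y ?QY"
      unfolding rank_conds_def
    proof (intro conjI allI impI)
      fix T i assume "i \<le> p + q"
      then have u: "lower.low (up i) = i" "up i \<le> r + s" using up by simp_all
      have "rank_at_most {up i<..r + s} (side T \<beta>) X (beyond T \<theta> (up i))" using L u(2) unfolding rank_conds_def by simp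
      then show "rank_at_most {i<..p + q} (side T \<alpha>) Y (beyond T \<gamma> i)" unfolding 1 u(1) .
    next
      fix i j assume ij: "i \<le> j" "j \<le> p + q"
      then have u: "lower.low (up i) = i" "lower.low (up j) = j" "up j \<le> r + s" "up i \<le> up j" using up up_mono by simp_all
      have "rank_at_most {up j<..r + s} {1..up i} ?QX (crossing_count \<theta> (up i) (up j))"
        using L u(3,4) unfolding rank_conds_def by simp
      then show "rank_at_most {j<..p + q} {1..i} ?QY (crossing_count \<gamma> i j)" unfolding 2[OF u(4,3)] u(1,2) .
    qed
  next
    assume R: "rank_conds (p + q) \<gamma> \<alpha> Y ?QY"
    show "rank_conds (r + s) \<theta> \<beta> X ?QX"
      unfolding rank_conds_def
    proof (intro conjI allI impI)
      fix T i
      show "rank_at_most {i<..r + s} (side T \<beta>) X (beyond T \<theta> i)"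
        unfolding 1 using R lower.low_le unfolding rank_conds_def by simp
    next
      fix i j assume ij: "i \<le> j" "j \<le> r + s"
      show "rank_at_most {j<..r + s} {1..i} ?QX (crossing_count \<theta> i j)"
        unfolding 2[OF ij] using R lower.low_le lower.low_mono[OF ij(1)] unfolding rank_conds_def by simp
    qed
  qed
qed

text \<open>
  Membership in the slice and the rank conditions both transfer between a matrix that is trivial
  outside and its restriction.
\<close>
lemma mars_springer_transfer:
  assumes A: "A \<in> carrier_mat (r + s) (r + s)" and B: "B \<in> carrier_mat (p + q) (p + q)"
    and Y: "lower.restricts (by_vertices r \<beta> A) (by_vertices p \<alpha> B)" and triv: "lower.trivial_outside (by_vertices r \<beta> A)"
  shows "A \<in> mars_springer r s \<theta> \<beta> \<longleftrightarrow> B \<in> mars_springer p q \<gamma> \<alpha>"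
proof -
  have sl: "A \<in> slice r s \<beta> \<longleftrightarrow> B \<in> slice p q \<alpha>"
    unfolding lower.big.slice_iff lower.small.slice_iff
    using A B lower.in_slice_restrict[OF _ Y] lower.in_slice_extend[OF _ Y triv] by blast
  show ?thesis
  proof (cases "A \<in> slice r s \<beta>")
    case True
    then have T: "B \<in> slice p q \<alpha>" using sl by simp
    show ?thesis
      unfolding lower.big.mars_springer_iff[OF upper.big.clan] lower.small.mars_springer_iff[OF upper.small.clan]
        lower.big.involution_def lower.small.involution_def
      using rank_conds_iff[OF lower.big.slice_point_of[OF True] lower.small.slice_point_of[OF T] Y triv] True T by simp
  next
    case False
    then show ?thesis using sl unfolding mars_springer_def by simp
  qed
qed

definition restriction :: "complex mat \<Rightarrow> complex mat" where
  "restriction A = mat (p + q) (p + q) (\<lambda>(i, j). by_vertices r \<beta> A (\<iota> (i + 1)) (\<iota> (lower.small.vertex_at (j + 1))))"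

definition extension :: "complex mat \<Rightarrow> complex mat" where
  "extension B = mat (r + s) (r + s) (\<lambda>(i, j). (\<lambda>u v.
     if u \<in> I \<and> v \<in> I then by_vertices p \<alpha> B (the_inv_into V \<iota> u) (the_inv_into V \<iota> v) else base_entry \<beta> u v)
     (i + 1) (lower.big.vertex_at (j + 1)))"

lemma restriction_carrier: "restriction A \<in> carrier_mat (p + q) (p + q)" unfolding restriction_def by simp
lemma extension_carrier: "extension B \<in> carrier_mat (r + s) (r + s)" unfolding extension_def by simp

lemma restricts_restriction: "lower.restricts (by_vertices r \<beta> A) (by_vertices p \<alpha> (restriction A))"
  unfolding lower.restricts_def restriction_def
proof (intro ballI)
  fix u v assume "u \<in> V" "v \<in> V"
  then show "by_vertices p \<alpha> (mat (p + q) (p + q)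
      (\<lambda>(i, j). by_vertices r \<beta> A (\<iota> (i + 1)) (\<iota> (lower.small.vertex_at (j + 1))))) u v = by_vertices r \<beta> A (\<iota> u) (\<iota> v)"
    by (rule lower.small.by_vertices_mat[where f="\<lambda>u v. by_vertices r \<beta> A (\<iota> u) (\<iota> v)"])
qed

lemma by_vertices_extension:
  assumes "u \<in> W" "v \<in> W"
  shows "by_vertices r \<beta> (extension B) u v =
    (if u \<in> I \<and> v \<in> I then by_vertices p \<alpha> B (the_inv_into V \<iota> u) (the_inv_into V \<iota> v) else base_entry \<beta> u v)"
  unfolding extension_def by (rule lower.big.by_vertices_mat[OF assms])

lemma restricts_extension: "lower.restricts (by_vertices r \<beta> (extension B)) (by_vertices p \<alpha> B)"
  unfolding lower.restricts_def
proof (intro ballI)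
  fix u v assume uv: "u \<in> V" "v \<in> V"
  show "by_vertices p \<alpha> B u v = by_vertices r \<beta> (extension B) (\<iota> u) (\<iota> v)"
    using by_vertices_extension[OF lower.embed_in[OF uv(1)] lower.embed_in[OF uv(2)], of B] uv
      the_inv_into_f_f[OF lower.inj_embed] by simp
qed

lemma trivial_outside_extension: "lower.trivial_outside (by_vertices r \<beta> (extension B))"
  unfolding lower.trivial_outside_def using by_vertices_extension by auto

lemma restriction_extension:
  assumes B: "B \<in> carrier_mat (p + q) (p + q)" shows "restriction (extension B) = B"
proof (rule lower.small.mat_eq_by_vertices[OF restriction_carrier B])
  fix u v assume uv: "u \<in> V" "v \<in> V"
  show "by_vertices p \<alpha> (restriction (extension B)) u v = by_vertices p \<alpha> B u v"
    using lower.restrictsD[OF restricts_restriction uv, of "extension B"] lower.restrictsD[OF restricts_extension uv, of B] by simp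
qed

lemma extension_restriction:
  assumes A: "A \<in> carrier_mat (r + s) (r + s)" and triv: "lower.trivial_outside (by_vertices r \<beta> A)"
  shows "extension (restriction A) = A"
proof (rule lower.big.mat_eq_by_vertices[OF extension_carrier A])
  fix u v assume uv: "u \<in> W" "v \<in> W"
  show "by_vertices r \<beta> (extension (restriction A)) u v = by_vertices r \<beta> A u v"
  proof (cases "u \<in> I \<and> v \<in> I")
    case True
    then obtain a b where ab: "a \<in> V" "b \<in> V" "u = \<iota> a" "v = \<iota> b" by auto
    show ?thesis
      using lower.restrictsD[OF restricts_restriction ab(1,2), of A]
        lower.restrictsD[OF restricts_extension ab(1,2), of "restriction A"] ab by simp
  next
    case False
    then show ?thesis
      using lower.trivial_outsideD[OF triv uv] lower.trivial_outsideD[OF trivial_outside_extension uv] by simp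
  qed
qed

lemma by_vertices_polynomial:
  assumes "u \<in> {1..n}" "clan_perm k \<delta> v \<in> {1..n}" shows "(\<lambda>A. by_vertices k \<delta> A u v) \<in> polynomial_funs n"
  unfolding by_vertices_def by (rule polynomial_funs.entry) (use assms in auto)

lemma restriction_polynomial:
  assumes "i < p + q" "j < p + q" shows "\<exists>f\<in>polynomial_funs (r + s). \<forall>A\<in>X. restriction A $$ (i, j) = f A"
proof -
  have V: "i + 1 \<in> V" "lower.small.vertex_at (j + 1) \<in> V" using assms lower.small.vertex_at(1)[of "j + 1"] by auto
  let ?f = "\<lambda>A. by_vertices r \<beta> A (\<iota> (i + 1)) (\<iota> (lower.small.vertex_at (j + 1)))"
  have p: "?f \<in> polynomial_funs (r + s)"
    by (rule by_vertices_polynomial[OF lower.embed_in[OF V(1)] lower.big.perm_in_V[OF lower.embed_in[OF V(2)]]])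
  have e: "restriction A $$ (i, j) = ?f A" for A using assms by (simp add: restriction_def)
  show ?thesis using p by (rule bexI[rotated]) (intro ballI e)
qed

lemma extension_polynomial:
  assumes "i < r + s" "j < r + s" shows "\<exists>f\<in>polynomial_funs (p + q). \<forall>B\<in>X. extension B $$ (i, j) = f B"
proof -
  define u v where "u = i + 1" and "v = lower.big.vertex_at (j + 1)"
  let ?f = "\<lambda>B. if u \<in> I \<and> v \<in> I then by_vertices p \<alpha> B (the_inv_into V \<iota> u) (the_inv_into V \<iota> v) else base_entry \<beta> u v"
  have p: "?f \<in> polynomial_funs (p + q)"
  proof (cases "u \<in> I \<and> v \<in> I")
    case True
    then obtain a b where ab: "a \<in> V" "b \<in> V" "u = \<iota> a" "v = \<iota> b" by auto
    have "(\<lambda>B. by_vertices p \<alpha> B a b) \<in> polynomial_funs (p + q)"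
      by (rule by_vertices_polynomial[OF ab(1) lower.small.perm_in_V[OF ab(2)]])
    moreover have "?f = (\<lambda>B. by_vertices p \<alpha> B a b)"
      using True ab the_inv_into_f_f[OF lower.inj_embed] by simp
    ultimately show ?thesis by simp
  next
    case False
    then have "?f = (\<lambda>B. base_entry \<beta> u v)" by auto
    then show ?thesis using polynomial_funs.const by simp
  qed
  have e: "extension B $$ (i, j) = ?f B" for B using assms by (simp add: extension_def u_def v_def)
  show ?thesis using p by (rule bexI[rotated]) (intro ballI e)
qed

text \<open>
  Restriction is injective on the big variety only because its points are trivial outside. The
  inequalities \<open>dominated\<close> used for this are supplied by the point itself.
\<close>
lemma isomorphic: "isomorphic_varieties (r + s) (p + q) (mars_springer r s \<theta> \<beta>) (mars_springer p q \<gamma> \<alpha>)"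
proof -
  let ?X = "mars_springer r s \<theta> \<beta>" and ?Y = "mars_springer p q \<gamma> \<alpha>"
  have carX: "A \<in> carrier_mat (r + s) (r + s)" if "A \<in> ?X" for A
    using that lower.big.slice_iff unfolding mars_springer_def by simp
  have carY: "B \<in> carrier_mat (p + q) (p + q)" if "B \<in> ?Y" for B
    using that lower.small.slice_iff unfolding mars_springer_def by simp
  have triv: "lower.trivial_outside (by_vertices r \<beta> A)" if "A \<in> ?X" for A
    by (rule trivial_outside_point[OF dominated_if_nonempty[OF that] that])
  have toY: "restriction A \<in> ?Y" if "A \<in> ?X" for A
    using mars_springer_transfer[OF carX[OF that] restriction_carrier restricts_restriction triv[OF that]] that by simp
  have toX: "extension B \<in> ?X" if "B \<in> ?Y" for B
    using mars_springer_transfer[OF extension_carrier carY[OF that] restricts_extension trivial_outside_extension] that by simp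
  show ?thesis
    unfolding isomorphic_varieties_def regular_map_def
  proof (rule exI[of _ restriction], rule exI[of _ extension], intro conjI ballI allI impI)
    fix A assume A: "A \<in> ?X"
    show "restriction A \<in> ?Y" by (rule toY[OF A])
    show "extension (restriction A) = A" by (rule extension_restriction[OF carX[OF A] triv[OF A]])
  next
    fix B assume B: "B \<in> ?Y"
    show "extension B \<in> ?X" by (rule toX[OF B])
    show "restriction (extension B) = B" by (rule restriction_extension[OF carY[OF B]])
  next
    fix i j assume "i < p + q" "j < p + q"
    then show "\<exists>f\<in>polynomial_funs (r + s). \<forall>A\<in>?X. restriction A $$ (i, j) = f A" by (rule restriction_polynomial)
  next
    fix i j assume "i < r + s" "j < r + s"
    then show "\<exists>f\<in>polynomial_funs (p + q). \<forall>B\<in>?Y. extension B $$ (i, j) = f B" by (rule extension_polynomial)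
  qed
qed

end

theorem theorem4p5:
  fixes p q r s :: nat and \<alpha> \<gamma> \<beta> \<theta> :: clan
  assumes "\<alpha> \<in> Clans p q" and "\<gamma> \<in> Clans p q" and "bruhat_le p q \<alpha> \<gamma>"
    and "\<beta> \<in> Clans r s" and "\<theta> \<in> Clans r s" and "bruhat_le r s \<beta> \<theta>"
    and "interval_contains p q r s \<beta> \<theta> \<alpha> \<gamma>"
  shows "isomorphic_varieties (r + s) (p + q) (mars_springer r s \<theta> \<beta>) (mars_springer p q \<gamma> \<alpha>)"
proof -
  obtain \<iota> where w: "witnesses p q r s \<iota> \<theta> \<gamma>" "witnesses p q r s \<iota> \<beta> \<alpha>"
    and agree: "agree_outside (\<iota> ` {1..p + q}) \<theta> \<beta>"
    and length_eq: "clan_length \<theta> - clan_length \<beta> = clan_length \<gamma> - clan_length \<alpha>"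
    using assms(7) unfolding interval_contains_def by auto
  interpret interval_embedding p q \<alpha> \<gamma> r s \<beta> \<theta> \<iota>
    by unfold_locales (fact assms w agree length_eq)+
  show ?thesis by (rule isomorphic)
qed

end
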